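(* For every integer $n\geq 1$, the decorated graph $\tilde{\Phi}_n$, constructed combinatorially from the $n$-th iterate of the piecewise-linear map $H_{PL}:T\to T$, is homeomorphic to the dessin d'enfant $\Gamma_n$ of the $n$-th iterate $H^{(n)}$ of the hessian dynamical system $H$, by a homeomorphism respecting the decorations (i.e. the black/white colors of the vertices and the cyclic orders of the germs of edges at each vertex).
   Context: Hessian dynamical system. Everything is over $\mathbb{C}$. For a plane cubic $C=Z(f)\subset\mathbb{P}^2$, $\mathrm{Hess}(C)$ is the curve defined by the determinant $\mathrm{Hess}(f)$ of the $3\times3$ matrix of second partial derivatives of $f$. The compactified coarse moduli space of elliptic curves $\overline{\mathcal{M}}_1$ is identified with $\mathbb{P}^1=\mathbb{C}\cup\{\infty\}$ by the coordinate $h$ with $j=2^6\cdot 3^3\cdot h$, where $j$ is the $j$-invariant normalized so that $y^2=4x^3-g_2x-g_3$ has $j=1728\,g_2^3/(g_2^3-27g_3^2)$. $H:\overline{\mathcal{M}}_1\to\overline{\mathcal{M}}_1$ is the unique algebraic morphism with $H([C])=[\mathrm{Hess}(C)]$ for every smooth plane cubic $C$ with smooth hessian curve; in terms of $h$ it is expressed by $h\mapsto -\frac{1}{27}\cdot\frac{(h-4)^3}{h^2}$. $H^{(n)}$ is its $n$-th iterate; it is a ramified cover of $\mathbb{P}^1$ with set of critical values $\{0,1,\infty\}$. Dessins d'enfants. For a holomorphic map $\psi:C\to\mathbb{P}^1=\mathbb{C}\cup\{\infty\}$ from a compact Riemann surface with critical values in $\{0,1,\infty\}$, its dessin d'enfant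 is the graph $\psi^{-1}([0,1])$, with vertices in $\psi^{-1}(0)$ colored black, vertices in $\psi^{-1}(1)$ colored white, and the germs of edges at each vertex cyclically ordered as they occur when turning positively with respect to the orientation of $C$ given by its complex structure. $\Gamma_n$ denotes the dessin d'enfant of $\psi=H^{(n)}$ (in the coordinate $h$). The piecewise-linear model. Let $T$ be a compact affine triangle with vertices named $0,1,\infty$. Let $a$ be the midpoint of the edge $[0,\infty]$ and $b$ the midpoint of the edge $[1,\infty]$. Let $\mathcal{T}_1$ be the triangulation of $T$ into the three closed triangles with vertex sets $\{0,1,b\}$, $\{0,a,b\}$, $\{a,b,\infty\}$. Let $H_{PL}:T\to T$ be the continuous map which is affine on each of these three triangles and sends $0\mapsto\infty$, $1\mapsto 1$, $\infty\mapsto\infty$, $a\mapsto 1$, $b\mapsto 0$; it restricts to an affine homeomorphism onto $T$ on each of the three triangles. Let $H_{PL}^{(n)}$ be its $n$-th iterate, and let $\mathcal{T}_n$ be the triangulation of $T$ with $1$-skeleton $\mathcal{T}_n^1=(H_{PL}^{(n)})^{-1}(\partial T)$; each of its edges is sent by $H_{PL}^{(n)}$ onto an edge of $T$, and its vertices are the preimages of the vertices of $T$. Equivalently, $\mathcal{T}_{n+1}$ is obtained from $\mathcal{T}_n$ by constructing inside each triangle of $\mathcal{T}_n$ a copy of $\mathcal{T}_1$, its vertices being matched with $0,1,\infty$ via $H_{PL}^{(n)}$. The graph $\tilde{\Phi}_n$. Let $\Phi_n$ be the subgraph of $\mathcal{T}_n^1$ which is the union of all edges whose image by $H_{PL}^{(n)}$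 is the edge $[0,1]$ of $T$, with preimages of $0$ colored black and preimages of $1$ colored white. Let $\Sigma=T\cup_{\partial T}T$ be the sphere obtained by gluing two copies of $T$ by the identity of $\partial T$, and let $\tilde{\Phi}_n=\Phi_n\cup_{\partial T\cap\Phi_n}\Phi_n\subset\Sigma$ be the corresponding double of $\Phi_n$. Orient $\Sigma$ arbitrarily and order cyclically the germs of edges of $\tilde{\Phi}_n$ at each vertex according to this orientation. *)

theory Defs
  imports "HOL-Analysis.Analysis" "HOL-Computational_Algebra.Polynomial"
begin

section \<open>The complex projective line\<close>

text \<open>Points of $\mathbb{P}^1 = \mathbb{C} \cup \{\infty\}$ are elements of \<^typ>\<open>complex option\<close>;
  the point at infinity is \<^const>\<open>None\<close>.\<close>

definition P1 :: "complex option topology" where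
  "P1 = Alexandroff_compactification euclidean"

text \<open>A holomorphic coordinate centred at the first argument: \<open>z - a\<close> at a finite point \<open>a\<close>,
  and \<open>1/z\<close> at infinity. The value at infinity of the coordinate centred at a finite point
  is irrelevant.\<close>

fun P1_coord :: "complex option \<Rightarrow> complex option \<Rightarrow> complex" where
  "P1_coord (Some a) (Some z) = z - a"
| "P1_coord (Some a) None = 0"
| "P1_coord None (Some z) = inverse z"
| "P1_coord None None = 0"

text \<open>Algebraic morphisms are given by \<open>[x : y] \<mapsto> [p(x,y) : q(x,y)]\<close> with \<open>p\<close>, \<open>q\<close>
  binary forms of the same degree \<open>d\<close> without common zero. Below \<open>p\<close>, \<open>q\<close> are the
  dehomogenized forms and \<open>d\<close> is the larger of their degrees.\<close>

definition algebraic_morphism_P1 :: "(complex option \<Rightarrow> complex option) \<Rightarrow> bool" where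
  "algebraic_morphism_P1 H \<longleftrightarrow>
     (\<exists>p q :: complex poly. coprime p q \<and>
        (\<forall>z. H (Some z) = (if poly q z = 0 then None else Some (poly p z / poly q z))) \<and>
        (let d = max (degree p) (degree q)
         in H None = (if coeff q d = 0 then None else Some (coeff p d / coeff q d))))"


section \<open>Plane cubics and the hessian dynamical system\<close>

definition cubic_form :: "(complex^3 \<Rightarrow> complex) \<Rightarrow> bool" where
  "cubic_form f \<longleftrightarrow>
     (\<exists>c :: 3 \<Rightarrow> 3 \<Rightarrow> 3 \<Rightarrow> complex.
        \<forall>x. f x = (\<Sum>i\<in>UNIV. \<Sum>j\<in>UNIV. \<Sum>k\<in>UNIV. c i j k * x$i * x$j * x$k))"

definition partial :: "3 \<Rightarrow> (complex^3 \<Rightarrow> complex) \<Rightarrow> complex^3 \<Rightarrow> complex" where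
  "partial i f x = deriv (\<lambda>t. f (x + t *s axis i 1)) 0"

definition Hess :: "(complex^3 \<Rightarrow> complex) \<Rightarrow> complex^3 \<Rightarrow> complex" where
  "Hess f x = det (\<chi> i j. partial i (partial j f) x)"

definition smooth_cubic :: "(complex^3 \<Rightarrow> complex) \<Rightarrow> bool" where
  "smooth_cubic f \<longleftrightarrow>
     cubic_form f \<and> (\<forall>x. x \<noteq> 0 \<and> f x = 0 \<longrightarrow> (\<exists>i. partial i f x \<noteq> 0))"

definition weierstrass_form :: "complex \<Rightarrow> complex \<Rightarrow> complex^3 \<Rightarrow> complex" where
  "weierstrass_form g2 g3 x =
     (x$2)^2 * x$3 - (4 * (x$1)^3 - g2 * x$1 * (x$3)^2 - g3 * (x$3)^3)"

text \<open>\<open>has_modulus f h\<close>: the isomorphism class of the smooth plane cubic \<open>Z(f)\<close> is the point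
  of $\mathcal{M}_1$ with coordinate \<open>h\<close>. A smooth plane cubic is carried by a linear change of
  homogeneous coordinates to a Weierstrass cubic, whose $j$-invariant is
  $1728\, g_2^3/(g_2^3-27g_3^2) = 2^6 3^3 h$.\<close>

definition has_modulus :: "(complex^3 \<Rightarrow> complex) \<Rightarrow> complex \<Rightarrow> bool" where
  "has_modulus f h \<longleftrightarrow>
     (\<exists>(A :: complex^3^3) k g2 g3.
        invertible A \<and> k \<noteq> 0 \<and> g2^3 - 27 * g3^2 \<noteq> 0 \<and>
        (\<forall>x. f (A *v x) = k * weierstrass_form g2 g3 x) \<and>
        1728 * g2^3 / (g2^3 - 27 * g3^2) = 2^6 * 3^3 * h)"

text \<open>The compactification of $\mathcal{M}_1$ is $\mathbb{P}^1$ with coordinate \<open>h\<close>. The property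
  below determines \<open>H\<close>.\<close>

definition hessian_dynamical_system :: "(complex option \<Rightarrow> complex option) \<Rightarrow> bool" where
  "hessian_dynamical_system H \<longleftrightarrow>
     algebraic_morphism_P1 H \<and>
     (\<forall>f h h'. smooth_cubic f \<and> smooth_cubic (Hess f) \<and> has_modulus f h \<and> has_modulus (Hess f) h'
        \<longrightarrow> H (Some h) = Some h')"


section \<open>Decorated graphs in oriented surfaces\<close>

text \<open>\<open>coord v\<close> is a local complex coordinate of the ambient surface, centred at \<open>v\<close> and
  compatible with the orientation; only its values near \<open>v\<close> matter. It encodes the cyclic orders
  of the germs of edges.\<close>

record 'a decorated_graph =
  gspace :: "'a topology"
  black :: "'a set"
  white :: "'a set"
  coord :: "'a \<Rightarrow> 'a \<Rightarrow> complex"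

text \<open>Germs of edges at \<open>v\<close> are represented by arcs in the graph issuing from \<open>v\<close>.\<close>

definition edge_arc :: "('a, 'b) decorated_graph_scheme \<Rightarrow> 'a \<Rightarrow> (real \<Rightarrow> 'a) \<Rightarrow> bool" where
  "edge_arc G v \<gamma> \<longleftrightarrow> pathin (gspace G) \<gamma> \<and> inj_on \<gamma> {0..1} \<and> \<gamma> 0 = v"

definition initial_direction ::
  "('a, 'b) decorated_graph_scheme \<Rightarrow> 'a \<Rightarrow> (real \<Rightarrow> 'a) \<Rightarrow> complex \<Rightarrow> bool" where
  "initial_direction G v \<gamma> u \<longleftrightarrow> ((\<lambda>t. sgn (coord G v (\<gamma> t))) \<longlongrightarrow> u) (at_right 0)"

text \<open>Three points of the unit circle are pairwise distinct and met in the given order when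
  turning positively iff the triangle they span is positively oriented.\<close>

definition positive_triple :: "complex \<Rightarrow> complex \<Rightarrow> complex \<Rightarrow> bool" where
  "positive_triple u1 u2 u3 \<longleftrightarrow> Im (cnj (u2 - u1) * (u3 - u1)) > 0"

text \<open>The cyclic order, as a ternary relation on germs of edges.\<close>

definition cyclic_order ::
  "('a, 'b) decorated_graph_scheme \<Rightarrow> 'a \<Rightarrow> (real \<Rightarrow> 'a) \<Rightarrow> (real \<Rightarrow> 'a) \<Rightarrow> (real \<Rightarrow> 'a) \<Rightarrow> bool" where
  "cyclic_order G v \<gamma>1 \<gamma>2 \<gamma>3 \<longleftrightarrow>
     (\<exists>u1 u2 u3. initial_direction G v \<gamma>1 u1 \<and> initial_direction G v \<gamma>2 u2 \<and>
        initial_direction G v \<gamma>3 u3 \<and> positive_triple u1 u2 u3)"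

definition decorated_homeomorphism ::
  "('a, 'c) decorated_graph_scheme \<Rightarrow> ('b, 'd) decorated_graph_scheme \<Rightarrow> ('a \<Rightarrow> 'b) \<Rightarrow> bool" where
  "decorated_homeomorphism G G' g \<longleftrightarrow>
     homeomorphic_map (gspace G) (gspace G') g \<and>
     g ` black G = black G' \<and> g ` white G = white G' \<and>
     (\<forall>v \<in> black G \<union> white G. \<forall>\<gamma>1 \<gamma>2 \<gamma>3.
        edge_arc G v \<gamma>1 \<and> edge_arc G v \<gamma>2 \<and> edge_arc G v \<gamma>3 \<longrightarrow>
        (cyclic_order G v \<gamma>1 \<gamma>2 \<gamma>3 \<longleftrightarrow>
         cyclic_order G' (g v) (g \<circ> \<gamma>1) (g \<circ> \<gamma>2) (g \<circ> \<gamma>3)))"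


section \<open>The dessin d'enfant of a map from the projective line to itself\<close>

definition dessin :: "(complex option \<Rightarrow> complex option) \<Rightarrow> complex option decorated_graph" where
  "dessin \<psi> = \<lparr>
     gspace = subtopology P1 {z. \<exists>t::real. 0 \<le> t \<and> t \<le> 1 \<and> \<psi> z = Some (complex_of_real t)},
     black = {z. \<psi> z = Some 0},
     white = {z. \<psi> z = Some 1},
     coord = P1_coord \<rparr>"


section \<open>The piecewise-linear model\<close>

text \<open>The affine plane containing the triangle \<open>T\<close> is \<^typ>\<open>complex\<close>. The vertices named
  $0, 1, \infty$ are \<open>p0\<close>, \<open>p1\<close>, \<open>pinf\<close>.\<close>

definition triangle :: "complex \<Rightarrow> complex \<Rightarrow> complex \<Rightarrow> complex set" where
  "triangle p q r = convex hull {p, q, r}"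

definition affine_map_on :: "complex set \<Rightarrow> (complex \<Rightarrow> complex) \<Rightarrow> bool" where
  "affine_map_on S F \<longleftrightarrow>
     (\<forall>x\<in>S. \<forall>y\<in>S. \<forall>t\<in>{0..1}. F ((1 - t) *\<^sub>R x + t *\<^sub>R y) = (1 - t) *\<^sub>R F x + t *\<^sub>R F y)"

text \<open>This determines \<open>F\<close> on the triangle; outside of it \<open>F\<close> is arbitrary and irrelevant.\<close>

definition is_H_PL :: "complex \<Rightarrow> complex \<Rightarrow> complex \<Rightarrow> (complex \<Rightarrow> complex) \<Rightarrow> bool" where
  "is_H_PL p0 p1 pinf F \<longleftrightarrow>
     (let a = midpoint p0 pinf; b = midpoint p1 pinf in
        continuous_on (triangle p0 p1 pinf) F \<and>
        affine_map_on (triangle p0 p1 b) F \<and>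
        affine_map_on (triangle p0 a b) F \<and>
        affine_map_on (triangle a b pinf) F \<and>
        F p0 = pinf \<and> F p1 = p1 \<and> F pinf = pinf \<and> F a = p1 \<and> F b = p0)"

text \<open>1-skeleton, vertices and edges of the triangulation $\mathcal{T}_n$, \<open>F\<close> being $H_{PL}$.
  The edges are the segments in the 1-skeleton joining two vertices and containing no other
  vertex.\<close>

definition PL_skeleton ::
  "complex \<Rightarrow> complex \<Rightarrow> complex \<Rightarrow> (complex \<Rightarrow> complex) \<Rightarrow> nat \<Rightarrow> complex set" where
  "PL_skeleton p0 p1 pinf F n =
     {z \<in> triangle p0 p1 pinf. (F ^^ n) z \<in> frontier (triangle p0 p1 pinf)}"

definition PL_vertices ::
  "complex \<Rightarrow> complex \<Rightarrow> complex \<Rightarrow> (complex \<Rightarrow> complex) \<Rightarrow> nat \<Rightarrow> complex set" where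
  "PL_vertices p0 p1 pinf F n = {z \<in> triangle p0 p1 pinf. (F ^^ n) z \<in> {p0, p1, pinf}}"

definition PL_edges ::
  "complex \<Rightarrow> complex \<Rightarrow> complex \<Rightarrow> (complex \<Rightarrow> complex) \<Rightarrow> nat \<Rightarrow> complex set set" where
  "PL_edges p0 p1 pinf F n =
     {closed_segment x y | x y.
        x \<in> PL_vertices p0 p1 pinf F n \<and> y \<in> PL_vertices p0 p1 pinf F n \<and> x \<noteq> y \<and>
        closed_segment x y \<subseteq> PL_skeleton p0 p1 pinf F n \<and>
        open_segment x y \<inter> PL_vertices p0 p1 pinf F n = {}}"

definition Phi ::
  "complex \<Rightarrow> complex \<Rightarrow> complex \<Rightarrow> (complex \<Rightarrow> complex) \<Rightarrow> nat \<Rightarrow> complex set" where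
  "Phi p0 p1 pinf F n =
     \<Union> {e \<in> PL_edges p0 p1 pinf F n. (F ^^ n) ` e = closed_segment p0 p1}"


section \<open>The double of a triangle\<close>

text \<open>\<open>(z, True)\<close> and \<open>(z, False)\<close> are the points \<open>z\<close> of the two copies of \<open>T\<close>. The two copies
  of a boundary point are both represented by \<open>(z, True)\<close>, and \<open>double_proj T\<close> is the projection
  from the disjoint union of the copies to the sphere $\Sigma = T \cup_{\partial T} T$.\<close>

definition double_proj :: "complex set \<Rightarrow> complex \<times> bool \<Rightarrow> complex \<times> bool" where
  "double_proj T = (\<lambda>(z, s). (z, s \<or> z \<in> frontier T))"

definition double :: "complex set \<Rightarrow> complex set \<Rightarrow> (complex \<times> bool) set" where
  "double T S = double_proj T ` (S \<times> UNIV)"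

text \<open>The quotient topology.\<close>

definition double_topology :: "complex set \<Rightarrow> (complex \<times> bool) topology" where
  "double_topology T = topology (\<lambda>U. U \<subseteq> double T T \<and>
     (\<forall>s. openin (top_of_set T) {z \<in> T. double_proj T (z, s) \<in> U}))"

lemma openin_double_topology:
  "openin (double_topology T) U \<longleftrightarrow>
     U \<subseteq> double T T \<and> (\<forall>s. openin (top_of_set T) {z \<in> T. double_proj T (z, s) \<in> U})"
proof -
  have "istopology (\<lambda>U. U \<subseteq> double T T \<and>
     (\<forall>s. openin (top_of_set T) {z \<in> T. double_proj T (z, s) \<in> U}))"
    unfolding istopology_def
  proof (intro conjI allI impI)
    fix A B s
    assume A: "A \<subseteq> double T T \<and> (\<forall>s. openin (top_of_set T) {z \<in> T. double_proj T (z, s) \<in> A})"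
      and B: "B \<subseteq> double T T \<and> (\<forall>s. openin (top_of_set T) {z \<in> T. double_proj T (z, s) \<in> B})"
    show "A \<inter> B \<subseteq> double T T" using A by blast
    have "{z \<in> T. double_proj T (z, s) \<in> A \<inter> B} =
        {z \<in> T. double_proj T (z, s) \<in> A} \<inter> {z \<in> T. double_proj T (z, s) \<in> B}" by blast
    then show "openin (top_of_set T) {z \<in> T. double_proj T (z, s) \<in> A \<inter> B}"
      using A B by (simp add: openin_Int)
  next
    fix K s
    assume K: "\<forall>U\<in>K. U \<subseteq> double T T \<and>
      (\<forall>s. openin (top_of_set T) {z \<in> T. double_proj T (z, s) \<in> U})"
    show "\<Union> K \<subseteq> double T T" using K by blast
    have "{z \<in> T. double_proj T (z, s) \<in> \<Union> K} = (\<Union>U\<in>K. {z \<in> T. double_proj T (z, s) \<in> U})"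
      by blast
    then show "openin (top_of_set T) {z \<in> T. double_proj T (z, s) \<in> \<Union> K}"
      using K by auto
  qed
  then show ?thesis
    by (simp add: double_topology_def)
qed

text \<open>For a boundary point \<open>v\<close> of a triangle \<open>T\<close> with interior point \<open>c\<close>, \<open>sector_angle c v z\<close> is
  the angle at \<open>v\<close> from \<open>c\<close> to \<open>z\<close>. On \<open>T - {v}\<close> it takes values in a closed interval contained
  in $(-\pi, \pi)$, whose length is the interior angle of \<open>T\<close> at \<open>v\<close> (which is $\pi$ unless \<open>v\<close> is
  a vertex).
  \<open>sector_coord T c v\<close> rescales this angle to $[0, \pi]$: it maps a neighbourhood of \<open>v\<close> in \<open>T\<close> to a
  neighbourhood of \<open>0\<close> in the closed upper half-plane, preserving the orientation of the plane.\<close>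

definition sector_angle :: "complex \<Rightarrow> complex \<Rightarrow> complex \<Rightarrow> real" where
  "sector_angle c v z = Arg ((z - v) / (c - v))"

definition sector_coord :: "complex set \<Rightarrow> complex \<Rightarrow> complex \<Rightarrow> complex \<Rightarrow> complex" where
  "sector_coord T c v z =
     (let lo = Inf (sector_angle c v ` (T - {v}));
          hi = Sup (sector_angle c v ` (T - {v}))
      in rcis (cmod (z - v)) (pi * (sector_angle c v z - lo) / (hi - lo)))"

text \<open>A local coordinate of $\Sigma$ centred at \<open>p\<close>: the copy \<open>True\<close> of \<open>T\<close> has the orientation of
  the complex plane and the other copy the opposite one. At a boundary point the two copies
  are mapped to the upper and to the lower half-plane.\<close>

definition double_coord ::
  "complex set \<Rightarrow> complex \<Rightarrow> complex \<times> bool \<Rightarrow> complex \<times> bool \<Rightarrow> complex" where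
  "double_coord T c p x =
     (let w = (if fst p \<in> frontier T then sector_coord T c (fst p) (fst x) else fst x - fst p)
      in if snd x then w else cnj w)"

text \<open>The parameter \<open>pos\<close> selects one of the two orientations of $\Sigma$.\<close>

definition Phi_tilde ::
  "bool \<Rightarrow> complex \<Rightarrow> complex \<Rightarrow> complex \<Rightarrow> (complex \<Rightarrow> complex) \<Rightarrow> nat
     \<Rightarrow> (complex \<times> bool) decorated_graph" where
  "Phi_tilde pos p0 p1 pinf F n =
     (let T = triangle p0 p1 pinf; \<Phi> = Phi p0 p1 pinf F n; c = (p0 + p1 + pinf) / 3 in
      \<lparr> gspace = subtopology (double_topology T) (double T \<Phi>),
        black = double T {z \<in> \<Phi>. (F ^^ n) z = p0},
        white = double T {z \<in> \<Phi>. (F ^^ n) z = p1},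
        coord = (\<lambda>p x. if pos then double_coord T c p x else cnj (double_coord T c p x)) \<rparr>)"

end

theory Submission
  imports Defs "HOL-Computational_Algebra.Fundamental_Theorem_Algebra"
begin

text \<open>The triangle $T$ and the closed upper half-plane carry the same dynamics. The map
$z \mapsto -(z-4)^3/(27 z^2)$ is real, so composing it with the reflection of the lower half-plane
onto the upper one (\<open>upper_fold\<close>) gives a selfmap of the closed upper half-plane. The points with
real image form an arc that joins $0$ to $4$ and $4$ to $-8$ and cuts the half-plane into three
regions. The folded map sends each region bijectively onto the half-plane (\<open>region_inj\<close>,
\<open>region_surj\<close>), and the regions meet and have their sides permuted (\<open>hess_sides\<close>) exactly like the
three triangles of $\mathcal{T}_1$ (\<open>tile_map_sides\<close>, \<open>tile_map_eq_iff\<close>), with $a = -8$ and $b = 4$.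
Matching points with equal itineraries therefore gives, by induction on $n$, a homeomorphism
\<open>bary_of n\<close> from the part of $\Gamma_n$ in the closed upper half-plane onto $\Phi_n$. It takes the
real points of $\Gamma_n$, and no others, into $\partial T$. Since $\Gamma_n$ is symmetric under
conjugation, it extends to a homeomorphism from $\Gamma_n$ onto the double $\tilde\Phi_n$
(\<open>to_double_homeomorphic\<close>).

The cyclic orders carry very little information, because the critical points are $4$, $-8$ and the
pole $0$, with $4 \mapsto 0 \mapsto \infty \mapsto \infty$ and $-8 \mapsto 1 \mapsto 1$.
A white vertex has at most two germs of edges (\<open>white_direction\<close>, \<open>white_germs_double\<close>), so its
cyclic order is empty on both sides. A black vertex of $\Gamma_n$ is mapped to the triple zero $4$ by
the $(n-1)$-st iterate, which is conformal there; so it has three germs, whose images at $4$ are real,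
or in the upper half-plane, or in the lower one. This labels the germs on both surfaces
(\<open>black_germs_dessin\<close>, \<open>black_germs_double\<close>), and their cyclic order is a single sign: on which side
of the real germ the germ with upper label lies. On the side of $\Sigma$ the sign is that of the
determinant of an affine inverse branch of $H_{PL}^{(n-1)}$, and it agrees with the sign at $4$ once
the copy of $T$ that goes to the upper half-plane is chosen according to the orientation of $\Sigma$
and of the triangle.

That the hessian dynamical system is this rational map follows from the Hesse pencil
$x^3 + y^3 + z^3 = 3kxyz$: it is stable under the hessian, it contains curves of every modulus
$h \neq 0$, and its members have explicit Weierstrass forms
(\<open>hessian_dynamical_system_formula\<close>).\<close>

section \<open>The rational map and the regions of the half-plane\<close>

text \<open>The pole $0$ gets the value $0$ by the convention on division, so statements about iterates exclude
it explicitly.\<close>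

definition hess_map :: "complex \<Rightarrow> complex" where
  "hess_map z = - ((z - 4)^3) / (27 * z^2)"

text \<open>Inside the half-plane this cuts out the points with real image; in polar coordinates
$(r, \theta)$ its zero set is $\cos\theta = (48 r - r^3)/128$ with $0 < r \le 8$.\<close>

definition quartic :: "complex \<Rightarrow> real" where
  "quartic z = cmod z ^ 4 - 48 * cmod z ^ 2 + 128 * Re z"

text \<open>The triangles $\{0,1,b\}$, $\{0,a,b\}$, $\{a,b,\infty\}$ of $\mathcal{T}_1$, and also the regions of
the upper half-plane that correspond to them.\<close>

datatype tile = T1 | T2 | T3

fun region :: "tile \<Rightarrow> complex set" where
  "region T1 = {z. z \<noteq> 0 \<and> Im z \<ge> 0 \<and> quartic z \<ge> 0 \<and> cmod z \<le> 4}"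
| "region T2 = {z. z \<noteq> 0 \<and> Im z \<ge> 0 \<and> quartic z \<le> 0}"
| "region T3 = {z. z \<noteq> 0 \<and> Im z \<ge> 0 \<and> quartic z \<ge> 0 \<and> cmod z \<ge> 4}"

definition upper_fold :: "complex \<Rightarrow> complex" where
  "upper_fold z = (if Im z \<ge> 0 then z else cnj z)"

lemma cmod_4: "cmod z ^ 4 = (Re z ^ 2 + Im z ^ 2)^2"
proof -
  have "cmod z ^ 4 = (cmod z ^ 2)^2" by (simp flip: power_mult)
  thus ?thesis by (simp add: cmod_power2)
qed

lemma hess_map_alt:
  assumes "z \<noteq> 0"
  shows "hess_map z = of_real (- (1 / (27 * cmod z ^ 4))) * ((z - 4)^3 * cnj z ^ 2)"
proof -
  have "z * cnj z = of_real (cmod z ^ 2)" by (simp only: complex_norm_square)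
  hence "(z * cnj z)^2 = of_real (cmod z) ^ 4" by (simp flip: power_mult)
  hence e: "of_real (cmod z) ^ 4 = z^2 * cnj z ^ 2" by (simp add: power_mult_distrib)
  show ?thesis unfolding hess_map_def using assms
    by (simp add: e field_simps)
qed

lemma Im_numerator: "Im ((z - 4)^3 * cnj z ^ 2) = Im z * quartic z"
  unfolding quartic_def cmod_4 cmod_power2
  by (simp add: power3_eq_cube power2_eq_square algebra_simps)

lemma Im_hess_map:
  assumes "z \<noteq> 0"
  shows "Im (hess_map z) = - (Im z * quartic z) / (27 * cmod z ^ 4)"
proof -
  have *: "Im (of_real r * w) = r * Im w" for r w by simp
  show ?thesis unfolding hess_map_alt[OF assms] * Im_numerator by simp
qed

lemma hess_map_cnj: "hess_map (cnj z) = cnj (hess_map z)"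
  by (simp add: hess_map_def)

lemma hess_map_eq_iff:
  assumes "z \<noteq> 0" "w \<noteq> 0"
  shows "hess_map z = hess_map w \<longleftrightarrow> z = w \<or> (z*w)^2 - 48*(z*w) + 64*(z+w) = 0"
proof -
  have "hess_map z = hess_map w \<longleftrightarrow> (z-4)^3 * w^2 = (w-4)^3 * z^2"
    using assms by (simp add: hess_map_def field_simps)
  also have "\<dots> \<longleftrightarrow> (z - w) * ((z*w)^2 - 48*(z*w) + 64*(z+w)) = 0"
    by (simp add: power3_eq_cube power2_eq_square algebra_simps)
  finally show ?thesis by simp
qed

lemma hess_map_of_real: "hess_map (of_real x) = of_real (- ((x-4)^3) / (27 * x^2))"
  by (simp add: hess_map_def)

lemma hess_map_minus_1: "z \<noteq> 0 \<Longrightarrow> hess_map z - 1 = - (z - 1) * (z + 8)^2 / (27 * z^2)"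
  by (simp add: hess_map_def field_simps power3_eq_cube power2_eq_square)

text \<open>On the arc the image is an increasing function of the modulus; it is negative between $0$ and $4$ and
lies in $[0,1]$ between $4$ and $-8$.\<close>

lemma hess_map_curve:
  assumes "z \<noteq> 0" "quartic z = 0"
  shows "hess_map z = of_real ((cmod z ^ 2 - 16)^3 / (1728 * cmod z ^ 2))"
proof -
  define N where "N = cmod z ^ 2"
  have N: "N > 0" using assms by (simp add: N_def)
  have N4: "cmod z ^ 4 = N^2" by (simp add: N_def flip: power_mult)
  have x: "Re z = (48 * N - N^2) / 128" using assms(2) by (simp add: quartic_def N4 N_def[symmetric])
  have "Re ((z - 4)^3 * cnj z ^ 2) = Re z * N^2 - 12 * N^2 + 48 * N * Re z - 64 * (2 * Re z ^ 2 - N)"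
    unfolding N_def cmod_power2 by (simp add: power3_eq_cube power2_eq_square algebra_simps)
  also have "\<dots> = - (N * (N - 16)^3) / 64"
    unfolding x by (simp add: field_simps power3_eq_cube power2_eq_square)
  finally have "(z - 4)^3 * cnj z ^ 2 = of_real (- (N * (N - 16)^3) / 64)"
    using assms(2) Im_numerator[of z] by (simp add: complex_eq_iff)
  thus ?thesis unfolding hess_map_alt[OF assms(1)] N4 N_def[symmetric] of_real_mult[symmetric] of_real_eq_iff
    using N by (simp add: field_simps power2_eq_square)
qed

section \<open>Injectivity on the regions\<close>

text \<open>In terms of $U = 4/h$, $V = 4/k$ and $q = (V-1)/(U-1)$ the equation reads $V = q^3 U$. For $q \neq 1$
it gives $U = -1/(q(q+1))$ and $V = -q^2/(q+1)$. The hypothesis on the arguments says that the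
argument of $q$ is a third of the difference of those of $h$ and $k$, so that $q$ has positive real
part; then the imaginary parts of $U$ and $V$ have opposite signs, whereas both are negative.\<close>

lemma hess_map_inj_upper:
  assumes h: "Im h > 0" and k: "Im k > 0" and eq: "hess_map h = hess_map k"
    and arg: "3 * Arg (h - 4) - 2 * Arg h = 3 * Arg (k - 4) - 2 * Arg k"
  shows "h = k"
proof (rule ccontr)
  assume ne: "h \<noteq> k"
  have nz: "h \<noteq> 0" "k \<noteq> 0" "h \<noteq> 4" "k \<noteq> 4" using h k by auto
  define U V where "U = 4 / h" and "V = 4 / k"
  define q where "q = (V - 1) / (U - 1)"
  have U1: "U \<noteq> 1" "V \<noteq> 1" "U \<noteq> 0" "V \<noteq> 0" using nz by (auto simp: U_def V_def)
  have q1: "V - 1 = q * (U - 1)" using U1 by (simp add: q_def)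
  have qalt: "q = ((k - 4) / k) / ((h - 4) / h)"
    using nz by (simp add: q_def U_def V_def divide_simps) (simp add: algebra_simps)
  have q3: "V = q^3 * U"
  proof -
    have "(h-4)^3 * k^2 = (k-4)^3 * h^2"
      using eq nz by (simp add: hess_map_def field_simps)
    hence Y: "(k-4)^3 = (h-4)^3 * k^2 / h^2" using nz by (simp add: field_simps)
    have "q^3 = ((k-4)^3 / k^3) / ((h-4)^3 / h^3)" by (simp add: qalt power_divide power_mult_distrib)
    also have "\<dots> = h / k" unfolding Y using nz by (simp add: power3_eq_cube power2_eq_square)
    finally show ?thesis unfolding V_def U_def using nz by simp
  qed
  have qne: "q \<noteq> 1" using q1 ne nz by (auto simp: U_def V_def)
  have UV: "U * (q * (q + 1)) = -1"
  proof -
    have "(q - 1) * (U * (q * (q + 1)) + 1) = 0"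
      using q1 q3 by (simp add: algebra_simps power3_eq_cube)
    thus ?thesis using qne by (simp add: eq_neg_iff_add_eq_0)
  qed
  have q0: "q \<noteq> 0" "q + 1 \<noteq> 0" using UV by auto
  have Ve: "V * (q + 1) = - (q^2)"
  proof -
    have "V * (q+1) = q^2 * (U * (q*(q+1)))" using q3 by (simp add: power3_eq_cube power2_eq_square)
    thus ?thesis using UV by simp
  qed
  \<comment> \<open>The argument of \<open>q\<close>; it has absolute value less than $\pi/3$.\<close>
  define d where "d = (Arg h - Arg k) / 3"
  have polar: "z = of_real (cmod z) * cis (Arg z)" for z
    by (metis rcis_cmod_Arg rcis_def)
  have "q = of_real (cmod ((k - 4) / k) / cmod ((h - 4) / h)) * cis ((Arg (k-4) - Arg k) - (Arg (h-4) - Arg h))"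
    unfolding qalt using polar[of k] polar[of h] polar[of "k-4"] polar[of "h-4"]
    by (smt (verit) cis_divide norm_divide of_real_divide times_divide_times_eq)
  also have "(Arg (k-4) - Arg k) - (Arg (h-4) - Arg h) = d"
    using arg by (simp add: d_def field_simps)
  finally have qd: "q = of_real (cmod ((k - 4) / k) / cmod ((h - 4) / h)) * cis d" .
  have "0 < Arg h" "Arg h < pi" "0 < Arg k" "Arg k < pi"
    using h k Arg_lt_pi[of h] Arg_lt_pi[of k] by auto
  hence "d * 3 < pi" "- pi < d * 3" by (simp_all add: d_def)
  hence "d < pi/2" "- (pi/2) < d" using pi_gt_zero by linarith+
  hence "cos d > 0" by (intro cos_gt_zero_pi) auto
  hence Rq: "Re q > 0" using nz unfolding qd by simp
  have "Im (4 / z) < 0" if "Im z > 0" for z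
  proof -
    have "z \<noteq> 0" using that by auto
    have "Im (4 / z) = - 4 * Im z / cmod z ^ 2" by (simp add: Im_divide cmod_power2)
    thus ?thesis using that \<open>z \<noteq> 0\<close> by (simp add: divide_neg_pos)
  qed
  hence "Im U < 0" "Im V < 0" unfolding U_def V_def using h k by auto
  moreover have "Im U = Im q * (2 * Re q + 1) / cmod (q * (q+1)) ^ 2"
  proof -
    have "U = (-1) / (q * (q + 1))"
      by (metis UV mult_eq_0_iff nonzero_eq_divide_eq q0)
    also have "\<dots> = (-1) * cnj (q * (q+1)) / of_real (cmod (q * (q+1)) ^ 2)"
      by (subst complex_div_cnj) simp
    finally have "Im U = Im ((-1) * cnj (q * (q+1))) / cmod (q * (q+1)) ^ 2"
      by (simp only: Im_divide_of_real)
    moreover have "Im ((-1) * cnj (q * (q+1))) = Im q * (2 * Re q + 1)" by (simp add: algebra_simps)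
    ultimately show ?thesis by simp
  qed
  moreover have "Im V = - Im q * (cmod q ^ 2 + 2 * Re q) / cmod (q+1) ^ 2"
  proof -
    have "V = - (q^2) / (q + 1)" by (metis Ve nonzero_eq_divide_eq q0(2))
    also have "\<dots> = - (q^2) * cnj (q+1) / of_real (cmod (q+1) ^ 2)"
      by (subst complex_div_cnj) simp
    finally have "Im V = Im (- (q^2) * cnj (q+1)) / cmod (q+1) ^ 2"
      by (simp only: Im_divide_of_real)
    moreover have "Im (- (q^2) * cnj (q+1)) = - Im q * (cmod q ^ 2 + 2 * Re q)"
      unfolding cmod_power2 by (simp add: power2_eq_square algebra_simps)
    ultimately show ?thesis by simp
  qed
  moreover have "2 * Re q + 1 > 0" "cmod q ^ 2 + 2 * Re q > 0"
    using Rq by (auto intro: add_nonneg_pos)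
  moreover have "cmod (q * (q+1)) ^ 2 > 0" "cmod (q+1) ^ 2 > 0" using q0 by auto
  ultimately have "Im q * (2 * Re q + 1) < 0" "- Im q * (cmod q ^ 2 + 2 * Re q) < 0"
      "2 * Re q + 1 > 0" "cmod q ^ 2 + 2 * Re q > 0"
    by (auto simp only: divide_less_0_iff)
  hence "Im q < 0" "Im q > 0" by (auto simp add: mult_less_0_iff zero_less_mult_iff)
  thus False by simp
qed

text \<open>The angles at which a point of the upper half-plane is seen from $4$ and from $0$ determine the
arguments of $(z-4)^i\,\overline{z}^j$; the signs follow from the imaginary parts of these products.\<close>

lemma upper_args:
  assumes "Im z > 0"
  defines "A \<equiv> Arg (z - 4)" and "B \<equiv> Arg z"
  shows "0 < B" "B < A" "A < pi"
    "sgn (sin (3*A - 2*B)) = sgn (quartic z)" "sgn (sin (2*A - B)) = sgn (cmod z - 4)"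
proof -
  have polar: "z = of_real (cmod z) * cis (Arg z)" for z
    by (metis rcis_cmod_Arg rcis_def)
  have nz: "z \<noteq> 0" "z - 4 \<noteq> 0" using assms by auto
  define r s where "r = cmod z" and "s = cmod (z - 4)"
  have z: "z = of_real r * cis B" "z - 4 = of_real s * cis A"
    unfolding r_def s_def A_def B_def by (rule polar)+
  have rs: "r > 0" "s > 0" using nz by (auto simp: r_def s_def)
  have AB: "0 < B \<and> B < pi" "0 < A \<and> A < pi" unfolding A_def B_def Arg_lt_pi using assms(1) by auto
  show B: "0 < B" and A: "A < pi" using AB by auto
  have A': "0 < A" "B < pi" using AB by auto
  have *: "cnj z = of_real r * cis (-B)" unfolding z(1) by (simp add: cis_cnj)
  have "Im ((z - 4) * cnj z) = r * s * sin (A - B)"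
    unfolding * z(2) by (simp add: sin_diff algebra_simps)
  moreover have "Im ((z - 4) * cnj z) > 0" using assms(1) by (simp add: algebra_simps)
  ultimately have "sin (A - B) > 0" using rs by (metis mult_pos_pos zero_less_mult_pos)
  thus "B < A" using A B A' by (smt (verit) sin_ge_zero sin_minus)
  have "(z - 4)^3 * cnj z ^ 2 = of_real (r^2 * s^3) * cis (3*A - 2*B)"
  proof -
    have c: "cis A ^ 3 * cis (- B) ^ 2 = cis (3*A - 2*B)" by (simp add: Complex.DeMoivre cis_mult)
    have "(z - 4)^3 * cnj z ^ 2 = of_real r ^ 2 * of_real s ^ 3 * (cis A ^ 3 * cis (- B) ^ 2)"
      unfolding * z(2) by (simp only: power_mult_distrib mult_ac)
    thus ?thesis unfolding c by simp
  qed
  hence "Im z * quartic z = r^2 * s^3 * sin (3*A - 2*B)"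
    unfolding Im_numerator[symmetric] by simp
  hence "sgn (Im z * quartic z) = sgn (r^2 * s^3 * sin (3*A - 2*B))" by simp
  thus "sgn (sin (3*A - 2*B)) = sgn (quartic z)" using rs assms(1) by (simp add: sgn_mult)
  have "(z - 4)^2 * cnj z = of_real (r * s^2) * cis (2*A - B)"
  proof -
    have c: "cis A ^ 2 * cis (- B) = cis (2*A - B)" by (simp add: Complex.DeMoivre cis_mult)
    have "(z - 4)^2 * cnj z = of_real r * of_real s ^ 2 * (cis A ^ 2 * cis (- B))"
      unfolding * z(2) by (simp only: power_mult_distrib mult_ac)
    thus ?thesis unfolding c by simp
  qed
  hence "Im ((z - 4)^2 * cnj z) = r * s^2 * sin (2*A - B)" by simp
  moreover have "Im ((z - 4)^2 * cnj z) = Im z * (r + 4) * (r - 4)"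
  proof -
    have "Im z * (r + 4) * (r - 4) = Im z * (r^2 - 16)" by (simp add: power2_eq_square algebra_simps)
    thus ?thesis unfolding r_def cmod_power2 by (simp add: power2_eq_square algebra_simps)
  qed
  ultimately have "sgn (r * s^2 * sin (2*A - B)) = sgn (Im z * (r + 4) * (r - 4))" by simp
  thus "sgn (sin (2*A - B)) = sgn (cmod z - 4)" using rs assms(1) by (simp add: sgn_mult r_def[symmetric])
qed

lemma upper_fold_alt: "upper_fold z = Complex (Re z) \<bar>Im z\<bar>"
  by (simp add: upper_fold_def complex_eq_iff)

lemma continuous_on_upper_fold [continuous_intros]:
  "continuous_on A g \<Longrightarrow> continuous_on A (\<lambda>x. upper_fold (g x))"
  unfolding upper_fold_alt Complex_eq by (intro continuous_intros)

lemma Im_upper_fold: "Im (upper_fold z) \<ge> 0" by (simp add: upper_fold_def)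

lemma norm_upper_fold [simp]: "cmod (upper_fold z) = cmod z" by (simp add: upper_fold_def)

definition conj_unless :: "bool \<Rightarrow> complex \<Rightarrow> complex" where
  "conj_unless b z = (if b then z else cnj z)"

fun preserves_sides :: "tile \<Rightarrow> bool" where
  "preserves_sides T1 = False" | "preserves_sides T2 = True" | "preserves_sides T3 = False"

lemma regionD: "z \<in> region t \<Longrightarrow> z \<noteq> 0" "z \<in> region t \<Longrightarrow> Im z \<ge> 0"
  by (cases t; simp)+

lemma hess_map_region:
  assumes "z \<in> region t"
  shows "hess_map z = conj_unless (preserves_sides t) (upper_fold (hess_map z))"
proof (cases "Im (hess_map z) = 0")
  case True
  thus ?thesis by (simp add: conj_unless_def upper_fold_def complex_eq_iff)
next
  case False
  have z: "z \<noteq> 0" using assms by (cases t) auto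
  have "cmod z ^ 4 > 0" using z by simp
  hence "Im (hess_map z) > 0 \<longleftrightarrow> Im z * quartic z < 0"
    unfolding Im_hess_map[OF z] using z by (auto simp add: zero_less_divide_iff divide_less_0_iff mult_less_0_iff)
  moreover have "Im z \<noteq> 0" "quartic z \<noteq> 0" using False Im_hess_map[OF z] by auto
  ultimately show ?thesis using assms False
    by (cases t) (auto simp: conj_unless_def upper_fold_def mult_less_0_iff)
qed

lemma quartic_of_real: "quartic (of_real x) = x * (x - 4)^2 * (x + 8)"
  by (simp add: quartic_def power2_eq_square power4_eq_xxxx algebra_simps)

text \<open>$3\arg(z-4) - 2\arg z$ is a continuous argument of $-h(z)$ for $h$ the rational map, and the
three regions are the sets where it lies between two consecutive multiples of $\pi$.\<close>

lemma region_phase: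
  assumes "z \<in> region t" "Im z > 0" "quartic z \<noteq> 0"
  defines "p \<equiv> 3 * Arg (z - 4) - 2 * Arg z"
  shows "case t of T1 \<Rightarrow> 2*pi < p \<and> p < 3*pi | T2 \<Rightarrow> pi < p \<and> p < 2*pi | T3 \<Rightarrow> 0 < p \<and> p < pi"
proof -
  define A B where "A = Arg (z - 4)" and "B = Arg z"
  note U = upper_args[OF assms(2), folded A_def B_def]
  have p: "p = 3 * A - 2 * B" by (simp add: p_def A_def B_def)
  have "3 * A - 2 * B = A + 2 * (A - B)" by simp
  hence p0: "0 < p" "p < 3 * pi" using U p by auto
  have s1: "sin p \<ge> 0 \<Longrightarrow> quartic z \<ge> 0" and s2: "sin p \<le> 0 \<Longrightarrow> quartic z \<le> 0"
    using U(4) unfolding p by (auto simp: sgn_if split: if_splits)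
  have low: "p \<le> pi \<Longrightarrow> quartic z \<ge> 0" using s1 sin_ge_zero p0 by auto
  have mid: "pi \<le> p \<Longrightarrow> p \<le> 2 * pi \<Longrightarrow> quartic z \<le> 0" using s2 sin_le_zero by (cases "p = 2 * pi") auto
  have high: "2 * pi \<le> p \<Longrightarrow> quartic z \<ge> 0"
  proof -
    assume "2 * pi \<le> p"
    hence "sin (p - 2 * pi) \<ge> 0" using p0 by (intro sin_ge_zero) auto
    thus ?thesis using s1 by (simp add: sin_diff)
  qed
  have c: "0 < 2*A - B" "2*A - B < 2*pi" using U by auto
  have c1: "cmod z \<le> 4 \<Longrightarrow> 2 * A - B \<ge> pi"
  proof (rule ccontr)
    assume a: "cmod z \<le> 4" "\<not> 2 * A - B \<ge> pi"
    hence "sin (2*A - B) > 0" using c by (intro sin_gt_zero) auto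
    thus False using U(5) a(1) by (auto simp: sgn_if split: if_splits)
  qed
  have c2: "cmod z \<ge> 4 \<Longrightarrow> 2 * A - B \<le> pi"
  proof (rule ccontr)
    assume a: "cmod z \<ge> 4" "\<not> 2 * A - B \<le> pi"
    hence "sin (2*A - B) < 0" using c by (intro sin_lt_zero) auto
    thus False using U(5) a(1) by (auto simp: sgn_if split: if_splits)
  qed
  show ?thesis
  proof (cases t)
    case T1
    hence Q: "quartic z > 0" "cmod z \<le> 4" using assms by auto
    have "p > pi" using c1[OF Q(2)] U p by auto
    thus ?thesis using Q mid p0 T1 by (cases "p \<le> 2*pi") auto
  next
    case T2
    thus ?thesis using assms low high by (cases "p \<le> pi"; cases "2 * pi \<le> p") auto
  next
    case T3
    hence Q: "quartic z > 0" "cmod z \<ge> 4" using assms by auto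
    have "p < 2 * pi" using c2[OF Q(2)] U p by auto
    thus ?thesis using Q mid p0 T3 by (cases "p \<ge> pi") auto
  qed
qed

lemma region_inj_interior:
  assumes z: "z \<in> region t" "Im z > 0" "quartic z \<noteq> 0"
    and w: "w \<in> region t" "Im w > 0" "quartic w \<noteq> 0"
    and eq: "hess_map z = hess_map w"
  shows "z = w"
proof -
  define P where "P z = 3 * Arg (z - 4) - 2 * Arg z" for z
  have polar: "z = of_real (cmod z) * cis (Arg z)" for z
    by (metis rcis_cmod_Arg rcis_def)
  have core: "(z - 4)^3 * cnj z ^ 2 = of_real (cmod (z - 4)^3 * cmod z ^ 2) * cis (P z)" for z
  proof -
    define r s A B where "r = cmod z" and "s = cmod (z - 4)" and "A = Arg (z - 4)" and "B = Arg z"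
    have z: "z = of_real r * cis B" "z - 4 = of_real s * cis A"
      unfolding r_def s_def A_def B_def by (rule polar)+
    have *: "cnj z = of_real r * cis (-B)" unfolding z(1) by (simp add: cis_cnj)
    have c: "cis A ^ 3 * cis (- B) ^ 2 = cis (P z)"
      by (simp add: Complex.DeMoivre cis_mult P_def A_def B_def)
    have "(z - 4)^3 * cnj z ^ 2 = of_real s ^ 3 * of_real r ^ 2 * (cis A ^ 3 * cis (- B) ^ 2)"
      unfolding * z(2) by (simp only: power_mult_distrib mult_ac)
    thus ?thesis unfolding c s_def r_def by simp
  qed
  define t' where "t' = cmod z ^ 4 / cmod w ^ 4"
  have nz: "z \<noteq> 0" "w \<noteq> 0" "z \<noteq> 4" "w \<noteq> 4" using z w by auto
  have "(z - 4)^3 * cnj z ^ 2 = of_real t' * ((w - 4)^3 * cnj w ^ 2)"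
    using eq nz unfolding hess_map_alt[OF nz(1)] hess_map_alt[OF nz(2)] t'_def
    by (simp add: divide_simps mult_ac)
  hence e: "of_real (cmod (z - 4)^3 * cmod z ^ 2) * cis (P z) = of_real (t' * (cmod (w - 4)^3 * cmod w ^ 2)) * cis (P w)"
    unfolding core by simp
  hence "of_real (cmod (z - 4)^3 * cmod z ^ 2) * cis (P z) * cis (- P w) = of_real (t' * (cmod (w - 4)^3 * cmod w ^ 2))"
    by (simp add: cis_mult mult.assoc)
  hence "of_real (cmod (z - 4)^3 * cmod z ^ 2) * cis (P z - P w) = of_real (t' * (cmod (w - 4)^3 * cmod w ^ 2))"
    by (simp add: cis_mult mult.assoc)
  hence "Im (of_real (cmod (z - 4)^3 * cmod z ^ 2) * cis (P z - P w)) = 0" by (metis Im_complex_of_real)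
  hence s0: "sin (P z - P w) = 0" using nz by simp
  have "\<bar>P z - P w\<bar> < pi"

  proof -
    have "\<exists>k. k < P z \<and> P z < k + pi \<and> k < P w \<and> P w < k + pi"
    proof (cases t)
      case T1
      thus ?thesis using region_phase[OF z] region_phase[OF w] unfolding P_def[symmetric]
        by (intro exI[of _ "2 * pi"]) simp
    next
      case T2
      thus ?thesis using region_phase[OF z] region_phase[OF w] unfolding P_def[symmetric]
        by (intro exI[of _ pi]) simp
    next
      case T3
      thus ?thesis using region_phase[OF z] region_phase[OF w] unfolding P_def[symmetric]
        by (intro exI[of _ 0]) simp
    qed
    then obtain k where "k < P z" "P z < k + pi" "k < P w" "P w < k + pi" by blast
    thus ?thesis unfolding abs_less_iff by simp
  qed
  hence "- pi < P z - P w" "P z - P w < pi" unfolding abs_less_iff by linarith+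
  hence "P z - P w = 0" by (rule sin_eq_0_pi) (rule s0)
  thus ?thesis using hess_map_inj_upper[OF z(2) w(2) eq] by (simp add: P_def)
qed

lemma region_real:
  assumes "of_real x \<in> region t"
  shows "case t of T1 \<Rightarrow> 0 < x \<and> x \<le> 4 | T2 \<Rightarrow> -8 \<le> x \<and> x < 0 \<or> x = 4 | T3 \<Rightarrow> x \<le> -8 \<or> x \<ge> 4"
proof -
  have x0: "x \<noteq> 0" using assms by (cases t) auto
  have ge: "x * (x - 4)^2 * (x + 8) \<ge> 0 \<Longrightarrow> x > 0 \<or> x \<le> -8"
  proof (rule ccontr)
    assume "x * (x - 4)^2 * (x + 8) \<ge> 0" "\<not> (x > 0 \<or> x \<le> -8)"
    moreover from this have "x * (x - 4)^2 * (x + 8) < 0" using x0 by (intro mult_neg_pos) auto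
    ultimately show False by simp
  qed
  have le: "x * (x - 4)^2 * (x + 8) \<le> 0 \<Longrightarrow> x = 4 \<or> (-8 \<le> x \<and> x < 0)"
  proof (rule ccontr)
    assume a: "x * (x - 4)^2 * (x + 8) \<le> 0" "\<not> (x = 4 \<or> (-8 \<le> x \<and> x < 0))"
    hence sq: "(x - 4)^2 > 0" by simp
    consider "x > 0" | "x < -8" using a(2) x0 by force
    hence "x * (x + 8) > 0" by cases (auto simp: zero_less_mult_iff)
    hence "x * (x + 8) * (x - 4)^2 > 0" using sq by (rule mult_pos_pos)
    thus False using a(1) by (simp add: mult_ac)
  qed
  show ?thesis
    using assms x0 ge le by (cases t) (auto simp: quartic_of_real)
qed

text \<open>With $u = 4/x$ and $v = 4/y$, distinct points with equal images satisfy $1 - 3uv + uv(u+v) = 0$.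
The left-hand side is strictly positive or strictly negative for distinct points of one region.\<close>

lemma region_inj_real:
  assumes "of_real x \<in> region t" "of_real y \<in> region t" "hess_map (of_real x) = hess_map (of_real y)"
  shows "x = y"
proof (rule ccontr)
  assume ne: "x \<noteq> y"
  have nz: "x \<noteq> 0" "y \<noteq> 0" using assms by (auto dest: regionD)
  have "(of_real x * of_real y)^2 - 48*(of_real x * of_real y) + 64*(of_real x + of_real y) = (0 :: complex)"
    using hess_map_eq_iff[of "of_real x" "of_real y"] assms(3) nz ne by auto
  hence "of_real ((x * y)^2 - 48*(x*y) + 64*(x + y)) = (0 :: complex)" by simp
  hence P: "(x * y)^2 - 48*(x*y) + 64*(x + y) = 0" by (simp only: of_real_eq_0_iff)
  define u v where "u = 4 / x" and "v = 4 / y"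
  have uv: "1 - 3*(u* v) + (u* v)*(u+v) = 0"
  proof -
    have "1 - 3*(u* v) + (u* v)*(u+v) = ((x * y)^2 - 48*(x*y) + 64*(x + y)) / (x*y)^2"
      using nz by (simp add: u_def v_def field_simps power2_eq_square)
    thus ?thesis using P by simp
  qed
  have une: "u \<noteq> v" using ne nz by (auto simp: u_def v_def)
  define a b where "a = u - 1" and "b = v - 1"
  have ab: "(a+b)^2 - a*b + a*b*(a+b) = 0"
    using uv by (simp add: a_def b_def power2_eq_square algebra_simps)
  have abne: "a \<noteq> b" using une by (simp add: a_def b_def)
  have sq: "a^2 + b^2 + a*b > 0"
  proof -
    have "a^2 + b^2 + a*b = ((a+b)^2 + a^2 + b^2) / 2" by (simp add: power2_eq_square algebra_simps)
    moreover have "a^2 + b^2 > 0" using abne by (simp add: sum_power2_gt_zero_iff)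
    ultimately show ?thesis by (smt (verit) zero_le_power2 half_gt_zero)
  qed
  have e1: "(a+b)^2 - a*b = a^2 + b^2 + a*b" by (simp add: power2_eq_square algebra_simps)
  show False
  proof (cases t)
    case T1
    hence "0 < x" "x \<le> 4" "0 < y" "y \<le> 4" using region_real[OF assms(1)] region_real[OF assms(2)] by auto
    hence "a \<ge> 0" "b \<ge> 0" by (auto simp: a_def b_def u_def v_def field_simps)
    hence "a*b*(a+b) \<ge> 0" by simp
    thus False using ab sq e1 by linarith
  next
    case T2
    hence xy: "-8 \<le> x \<and> x < 0 \<or> x = 4" "-8 \<le> y \<and> y < 0 \<or> y = 4" using region_real[OF assms(1)] region_real[OF assms(2)] by auto
    have h: False if "x = 4 \<and> y < 0 \<or> y = 4 \<and> x < 0"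
    proof -
      have "u = 1 \<and> v < 0 \<or> v = 1 \<and> u < 0" using that by (auto simp: u_def v_def divide_less_0_iff)
      moreover have "u = 1 \<Longrightarrow> (1 - v)^2 = 0" "v = 1 \<Longrightarrow> (1 - u)^2 = 0" using uv by (auto simp: power2_eq_square algebra_simps)
      ultimately show False by auto
    qed
    have "x < 0" "y < 0" "-8 \<le> x" "-8 \<le> y" using h xy ne by auto
    hence "u \<le> -1/2" "v \<le> -1/2" by (auto simp: u_def v_def field_simps)
    define m n where "m = - u - 1/2" and "n = - v - 1/2"
    have mn: "m \<ge> 0" "n \<ge> 0" using \<open>u \<le> -1/2\<close> \<open>v \<le> -1/2\<close> by (auto simp: m_def n_def)
    have u: "u = - m - 1/2" "v = - n - 1/2" by (auto simp: m_def n_def)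
    define R where "R = (m+n)^2/2 + 4*m*n + m*n*(m+n)"
    have "R \<ge> 0" using mn by (simp add: R_def)
    moreover have "1 - 3*(u* v) + (u* v)*(u+v) = - ((m+n)*(9/4) + R)"
      unfolding u R_def by (simp add: power2_eq_square field_simps)
    ultimately have "(m + n) * (9/4) \<le> 0" using uv by linarith
    hence "m + n \<le> 0" by simp
    thus False using mn une u by auto
  next
    case T3
    hence xy: "x \<le> -8 \<or> x \<ge> 4" "y \<le> -8 \<or> y \<ge> 4" using region_real[OF assms(1)] region_real[OF assms(2)] by auto
    have A: "0 < u \<and> u \<le> 1 \<or> -1/2 \<le> u \<and> u < 0" using xy by (auto simp: u_def field_simps)
    have B: "0 < v \<and> v \<le> 1 \<or> -1/2 \<le> v \<and> v < 0" using xy by (auto simp: v_def field_simps)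
    consider "0 < u" "u \<le> 1" "0 < v" "v \<le> 1" | "-1/2 \<le> u" "u < 0" "-1/2 \<le> v" "v < 0"
      | "u * v < 0" "u \<le> 1" "v \<le> 1" using A B by (auto simp: mult_less_0_iff)
    thus False
    proof cases
      case 1
      hence "a \<le> 0" "b \<le> 0" "a > -1" "b > -1" by (auto simp: a_def b_def)
      hence p: "a*b \<ge> 0" "a + b > -2" by (auto simp: mult_nonpos_nonpos)
      hence le: "a*b*(a+b) \<ge> a*b*(-2)" by (intro mult_left_mono) auto
      have "a^2 + b^2 + a*b - 2*(a*b) = ((a-b)^2 + (a^2 + b^2))/2" by (simp add: power2_eq_square algebra_simps)
      also have "\<dots> > 0" using abne by (intro divide_pos_pos add_pos_nonneg) auto
      finally have "a^2 + b^2 + a*b - 2*(a*b) > 0" .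
      moreover define R where "R = a*b*(a+b)"
      ultimately have "(a^2 + b^2 + a*b) + R > 0" using le by simp
      thus False using ab e1 by (simp add: R_def)
    next
      case 2
      define m n where "m = - u" and "n = - v"
      have mn: "0 < m" "m \<le> 1/2" "0 < n" "n \<le> 1/2" using 2 by (auto simp: m_def n_def)
      have "m \<noteq> n" using une by (auto simp: m_def n_def)
      hence "m + n < 1" using mn by auto
      have "m * n \<le> 1/2 * (1/2)" using mn by (intro mult_mono) auto
      moreover have "m*n*(3 + m + n) < m*n*4" using mn \<open>m + n < 1\<close> by (intro mult_strict_left_mono) auto
      moreover have "1 - 3*(u* v) + (u* v)*(u+v) = 1 - m*n*(3+m+n)"
        unfolding m_def n_def by (simp add: algebra_simps)
      ultimately show False using uv by linarith
    next
      case 3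
      hence "(u * v) * (3 - u - v) < 0" by (intro mult_neg_pos[of "u * v"]) auto
      moreover have "1 - 3*(u* v) + (u* v)*(u+v) = 1 - u * v * (3 - u - v)" by (simp add: algebra_simps)
      ultimately show False using uv by linarith
    qed
  qed
qed

text \<open>By Vieta, the preimages of a real value that is attained at a nonreal $z$ are $z$, $\overline{z}$ and
$64/|z|^2$. The last one can only belong to the region of $z$ if it equals $4$, which forces $z = 4$.\<close>

lemma curve_unique:
  assumes z: "z \<in> region t" "Im z > 0" "quartic z = 0" and w: "w \<in> region t"
    and eq: "hess_map z = hess_map w"
  shows "z = w"
proof (rule ccontr)
  assume ne: "z \<noteq> w"
  have nz: "z \<noteq> 0" "w \<noteq> 0" using z w by (auto dest: regionD)
  define N where "N = cmod z ^ 2"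
  have N: "N > 0" "cmod z > 0" using nz by (auto simp: N_def)
  have zz: "z + cnj z = of_real (2 * Re z)" "z * cnj z = of_real N"
    by (simp_all add: N_def complex_norm_square[symmetric] complex_add_cnj)
  have "hess_map z \<in> \<real>" by (simp add: hess_map_curve[OF nz(1) z(3)])
  hence eq': "hess_map (cnj z) = hess_map w" using eq by (simp add: hess_map_cnj Reals_cnj_iff)
  have ne': "cnj z \<noteq> w" using z(2) regionD(2)[OF w] by auto
  have P1: "(z*w)^2 - 48*(z*w) + 64*(z+w) = 0" using hess_map_eq_iff[of z w] nz ne eq by auto
  have P2: "(cnj z*w)^2 - 48*(cnj z*w) + 64*(cnj z+w) = 0"
    using hess_map_eq_iff[of "cnj z" w] nz ne' eq' by auto
  have "(z - cnj z) * (w^2 * (z + cnj z) - 48 * w + 64)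
      = ((z*w)^2 - 48*(z*w) + 64*(z+w)) - ((cnj z*w)^2 - 48*(cnj z*w) + 64*(cnj z+w))"
    by (simp add: power2_eq_square algebra_simps)
  also have "\<dots> = 0" using P1 P2 by simp
  finally have "(z - cnj z) * (w^2 * (z + cnj z) - 48 * w + 64) = 0" .
  moreover have "z - cnj z \<noteq> 0" using z(2) by (auto simp: complex_eq_iff)
  ultimately have L: "w^2 * (z + cnj z) - 48 * w + 64 = 0" by simp
  have "w * (64 - (z * cnj z) * w) = ((z*w)^2 - 48*(z*w) + 64*(z+w)) - z * (w^2 * (z + cnj z) - 48 * w + 64)"
    by (simp add: power2_eq_square algebra_simps)
  also have "\<dots> = 0" using P1 L by simp
  finally have "64 = of_real N * w" using nz by (simp add: zz)
  hence w': "w = of_real (64 / N)" using N by (simp add: field_simps)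
  have N16: "N = 16"
  proof -
    have wr: "of_real (64 / N) \<in> region t" using w w' by simp
    have p: "64 / N > 0" using N by simp
    have le: "cmod z \<le> 4 \<Longrightarrow> N \<le> 16" using power_mono[of "cmod z" 4 2] by (simp add: N_def)
    have ge: "cmod z \<ge> 4 \<Longrightarrow> N \<ge> 16" using power_mono[of 4 "cmod z" 2] by (simp add: N_def)
    show ?thesis using region_real[OF wr] p le ge z N by (cases t) (auto simp: field_simps)
  qed
  have "cmod z ^ 4 = N^2" by (simp add: N_def flip: power_mult)
  hence "Re z = 4" using z(3) N16 by (simp add: quartic_def N_def[symmetric])
  moreover have "Re z ^ 2 + Im z ^ 2 = 16" using N16 by (simp add: N_def cmod_power2)
  ultimately show False using z(2) by simp
qed

lemma hess_map_real_cases: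
  assumes "z \<noteq> 0" "Im (hess_map z) = 0" "Im z \<ge> 0"
  shows "Im z = 0 \<or> (Im z > 0 \<and> quartic z = 0)"
  using assms by (auto simp: Im_hess_map)

lemma region_inj:
  assumes z: "z \<in> region t" and w: "w \<in> region t"
    and eq: "upper_fold (hess_map z) = upper_fold (hess_map w)"
  shows "z = w"
proof -
  have e: "hess_map z = hess_map w"
    using hess_map_region[OF z] hess_map_region[OF w] eq by metis
  have nz: "z \<noteq> 0" "w \<noteq> 0" "Im z \<ge> 0" "Im w \<ge> 0" using z w by (auto dest: regionD)
  show ?thesis
  proof (cases "Im (hess_map z) = 0")
    case False
    hence "Im z \<noteq> 0" "quartic z \<noteq> 0" "Im w \<noteq> 0" "quartic w \<noteq> 0"
      using Im_hess_map[OF nz(1)] Im_hess_map[OF nz(2)] e by auto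
    thus ?thesis using region_inj_interior[OF z _ _ w _ _ e] nz by auto
  next
    case True
    hence True': "Im (hess_map w) = 0" using e by simp
    have cz: "Im z = 0 \<or> (Im z > 0 \<and> quartic z = 0)" by (rule hess_map_real_cases) (use nz True in auto)
    have cw: "Im w = 0 \<or> (Im w > 0 \<and> quartic w = 0)" by (rule hess_map_real_cases) (use nz True' in auto)
    show ?thesis
    proof (cases "Im z = 0 \<and> Im w = 0")
      case True
      hence r: "z = of_real (Re z)" "w = of_real (Re w)" by (auto simp: complex_eq_iff)
      have "Re z = Re w"
        by (rule region_inj_real[of "Re z" t "Re w"]) (use r z w e in metis)+
      thus ?thesis using r by metis
    next
      case False
      thus ?thesis using cz cw curve_unique[OF z _ _ w e] curve_unique[OF w _ _ z e[symmetric]] by auto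
    qed
  qed
qed

text \<open>The finite parts of the sides $[0,1]$, $[1,\infty]$ and $[\infty,0]$ of the half-plane.\<close>

definition "seg01 z \<longleftrightarrow> Im z = 0 \<and> 0 \<le> Re z \<and> Re z \<le> 1"
definition "seg1i z \<longleftrightarrow> Im z = 0 \<and> 1 \<le> Re z"
definition "segi0 z \<longleftrightarrow> Im z = 0 \<and> Re z \<le> 0"

lemma hess_map_on_reals:
  assumes "z \<noteq> 0" "Im z = 0"
  shows "Im (hess_map z) = 0" "Re (hess_map z) \<ge> 1 \<longleftrightarrow> Re z \<le> 1"
    "Re (hess_map z) \<le> 1 \<longleftrightarrow> Re z \<ge> 1 \<or> Re z = -8"
    "Re (hess_map z) \<ge> 0 \<longleftrightarrow> Re z \<le> 4" "Re (hess_map z) \<le> 0 \<longleftrightarrow> Re z \<ge> 4"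
proof -
  define x where "x = Re z"
  have zx: "z = of_real x" using assms by (simp add: complex_eq_iff x_def)
  have x: "x \<noteq> 0" using assms zx by auto
  define r where "r = - ((x-4)^3) / (27 * x^2)"
  have h: "hess_map z = of_real r" unfolding zx hess_map_of_real r_def ..
  have Rz: "Re z = x" "Re (hess_map z) = r" by (simp_all add: h x_def)
  have r1: "r - 1 = - ((x - 1) * (x + 8)^2 / (27 * x^2))"
    using x by (simp add: r_def field_simps power3_eq_cube power2_eq_square)
  have pos: "27 * x^2 > 0" using x by simp
  have sgn3: "(x-4)^3 \<ge> 0 \<longleftrightarrow> x \<ge> 4" "(x-4)^3 \<le> 0 \<longleftrightarrow> x \<le> 4" by (auto simp: zero_le_power_eq power_le_zero_eq)
  have s1: "(x - 1) * (x + 8)^2 \<ge> 0 \<longleftrightarrow> x \<ge> 1 \<or> x = -8" "(x - 1) * (x + 8)^2 \<le> 0 \<longleftrightarrow> x \<le> 1"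
    by (auto simp: zero_le_mult_iff mult_le_0_iff)
  show "Im (hess_map z) = 0" by (simp add: h)
  have "r \<ge> 1 \<longleftrightarrow> (x - 1) * (x + 8)^2 / (27 * x^2) \<le> 0" "r \<le> 1 \<longleftrightarrow> (x - 1) * (x + 8)^2 / (27 * x^2) \<ge> 0"
    using r1 by linarith+
  thus "Re (hess_map z) \<ge> 1 \<longleftrightarrow> Re z \<le> 1" "Re (hess_map z) \<le> 1 \<longleftrightarrow> Re z \<ge> 1 \<or> Re z = -8"
    unfolding Rz using pos s1 by (simp_all add: divide_le_0_iff zero_le_divide_iff)
  show "Re (hess_map z) \<ge> 0 \<longleftrightarrow> Re z \<le> 4" "Re (hess_map z) \<le> 0 \<longleftrightarrow> Re z \<ge> 4"
    unfolding Rz using pos sgn3 by (auto simp add: r_def divide_le_0_iff zero_le_divide_iff)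
qed

lemma hess_map_on_curve:
  assumes "Im z > 0" "quartic z = 0"
  shows "Im (hess_map z) = 0" "Re (hess_map z) < 1"
    "cmod z \<le> 4 \<Longrightarrow> Re (hess_map z) < 0" "cmod z \<ge> 4 \<Longrightarrow> Re (hess_map z) > 0"
proof -
  have nz: "z \<noteq> 0" using assms by auto
  define s where "s = cmod z"
  have s: "s > 0" using nz by (simp add: s_def)
  have h: "hess_map z = of_real ((s^2 - 16)^3 / (1728 * s^2))"
    using hess_map_curve[OF nz assms(2)] by (simp add: s_def)
  show "Im (hess_map z) = 0" by (simp add: h)
  have "\<bar>Re z\<bar> < s"
  proof -
    have "\<bar>Re z\<bar>^2 < s^2" unfolding s_def cmod_power2 using assms by simp
    thus ?thesis by (rule power2_less_imp_less) (use s in simp)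
  qed
  hence Re: "- s < Re z" "Re z < s" by auto
  have Q: "s^4 - 48 * s^2 + 128 * Re z = 0" using assms(2) by (simp add: quartic_def s_def)
  have "(s - 8) * (s + 4)^2 * s < 0"
  proof -
    have "(s - 8) * (s + 4)^2 * s = s^4 - 48 * s^2 - 128 * s"
      by (simp add: power2_eq_square power4_eq_xxxx algebra_simps)
    also have "\<dots> < 0" using Q Re by linarith
    finally show ?thesis .
  qed
  hence s8: "s < 8" using s by (smt (verit) mult_nonneg_nonneg zero_le_power2)
  have s4: "s \<noteq> 4"
  proof
    assume "s = 4"
    with Q have "Re z = 4" by simp
    with Re \<open>s = 4\<close> show False by simp
  qed
  have "s^2 < 64" using s8 s power_strict_mono[of s 8 2] by simp
  moreover have "s^2 + 8 > 0" by (simp add: add_nonneg_pos)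
  ultimately have "(s^2 - 64) * (s^2 + 8)^2 < 0" by (intro mult_neg_pos) simp_all
  moreover have "(s^2 - 16)^3 - 1728 * s^2 = (s^2 - 64) * (s^2 + 8)^2"
    by (simp add: power2_eq_square power3_eq_cube algebra_simps)
  ultimately show "Re (hess_map z) < 1" using s by (simp add: h)
  show "Re (hess_map z) < 0" if "cmod z \<le> 4"
  proof -
    have "s^2 < 16" using that s4 s power_strict_mono[of s 4 2] by (simp add: s_def)
    hence "(s^2 - 16)^3 < 0" by (simp add: power_less_zero_eq)
    thus ?thesis using s by (simp add: h divide_neg_pos)
  qed
  show "Re (hess_map z) > 0" if "cmod z \<ge> 4"
  proof -
    have "s^2 > 16" using that s4 s power_strict_mono[of 4 s 2] by (simp add: s_def)
    hence "(s^2 - 16)^3 > 0" by simp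
    thus ?thesis using s by (simp add: h)
  qed
qed

lemma upper_fold_seg: "seg01 (upper_fold w) = seg01 w" "seg1i (upper_fold w) = seg1i w" "segi0 (upper_fold w) = segi0 w"
  by (auto simp: seg01_def seg1i_def segi0_def upper_fold_def)

lemma region_real':
  assumes "z \<in> region t" "Im z = 0"
  shows "case t of T1 \<Rightarrow> 0 < Re z \<and> Re z \<le> 4 | T2 \<Rightarrow> -8 \<le> Re z \<and> Re z < 0 \<or> Re z = 4 | T3 \<Rightarrow> Re z \<le> -8 \<or> Re z \<ge> 4"
proof -
  have "z = of_real (Re z)" using assms by (simp add: complex_eq_iff)
  thus ?thesis using region_real[of "Re z" t] assms by simp
qed

text \<open>How the three regions have their sides mapped, and where they meet. The same table, with the sides
of the triangle in place of the real segments, governs the inverse branches of $H_{PL}$ in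
\<open>tile_map_sides\<close> and \<open>tile_map_eq_iff\<close>.\<close>

lemma hess_sides:
  assumes "z \<in> region t"
  defines "w \<equiv> hess_map z"
  shows "t = T1 \<Longrightarrow> seg01 z \<longleftrightarrow> seg1i w" "t = T1 \<Longrightarrow> seg1i z \<longleftrightarrow> seg01 w" "t = T1 \<Longrightarrow> \<not> segi0 z"
    "t = T2 \<Longrightarrow> \<not> seg01 z" "t = T2 \<Longrightarrow> seg1i z \<longleftrightarrow> seg01 w \<and> segi0 w" "t = T2 \<Longrightarrow> segi0 z \<longleftrightarrow> seg1i w"
    "t = T3 \<Longrightarrow> \<not> seg01 z" "t = T3 \<Longrightarrow> seg1i z \<longleftrightarrow> segi0 w" "t = T3 \<Longrightarrow> segi0 z \<longleftrightarrow> seg1i w"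
    "t = T1 \<Longrightarrow> segi0 w \<Longrightarrow> z \<in> region T2" "t = T3 \<Longrightarrow> seg01 w \<Longrightarrow> z \<in> region T2"
    "t = T1 \<Longrightarrow> z \<in> region T2 \<Longrightarrow> segi0 w" "t = T2 \<Longrightarrow> z \<in> region T3 \<Longrightarrow> seg01 w"
    "t = T1 \<Longrightarrow> z \<in> region T3 \<Longrightarrow> seg01 w \<and> segi0 w"
proof -
  have nz: "z \<noteq> 0" "Im z \<ge> 0" using assms by (auto dest: regionD)
  have c: "cmod z \<le> 4 \<Longrightarrow> t = T1 \<or> t = T2 \<or> cmod z = 4" "t = T1 \<Longrightarrow> cmod z \<le> 4" "t = T3 \<Longrightarrow> cmod z \<ge> 4"
    using assms by (cases t; force)+
  consider (real) "Im z = 0" | (curve) "Im z > 0" "quartic z = 0" | (int) "Im z > 0" "quartic z \<noteq> 0"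
    using nz by fastforce
  hence "(t = T1 \<longrightarrow> (seg01 z \<longleftrightarrow> seg1i w) \<and> (seg1i z \<longleftrightarrow> seg01 w) \<and> \<not> segi0 z \<and> (segi0 w \<longrightarrow> z \<in> region T2)
        \<and> (z \<in> region T2 \<longrightarrow> segi0 w) \<and> (z \<in> region T3 \<longrightarrow> seg01 w \<and> segi0 w))
    \<and> (t = T2 \<longrightarrow> \<not> seg01 z \<and> (seg1i z \<longleftrightarrow> seg01 w \<and> segi0 w) \<and> (segi0 z \<longleftrightarrow> seg1i w) \<and> (z \<in> region T3 \<longrightarrow> seg01 w))
    \<and> (t = T3 \<longrightarrow> \<not> seg01 z \<and> (seg1i z \<longleftrightarrow> segi0 w) \<and> (segi0 z \<longleftrightarrow> seg1i w) \<and> (seg01 w \<longrightarrow> z \<in> region T2))"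
  proof cases
    case real
    have zr: "z = of_real (Re z)" using real by (simp add: complex_eq_iff)
    have "quartic z = Re z * (Re z - 4)^2 * (Re z + 8)" using quartic_of_real[of "Re z"] zr by metis
    hence z2: "z \<in> region T2" if "Re z = 4 \<or> Re z = -8" using that nz by auto
    have m: "z \<in> region T1 \<Longrightarrow> 0 < Re z \<and> Re z \<le> 4" "z \<in> region T2 \<Longrightarrow> -8 \<le> Re z \<and> Re z < 0 \<or> Re z = 4"
      "z \<in> region T3 \<Longrightarrow> Re z \<le> -8 \<or> Re z \<ge> 4"
      using region_real'[OF _ real, of T1] region_real'[OF _ real, of T2] region_real'[OF _ real, of T3] by auto
    define x where "x = Re z"
    have w: "Im w = 0" "Re w \<ge> 1 \<longleftrightarrow> x \<le> 1" "Re w \<le> 1 \<longleftrightarrow> x \<ge> 1 \<or> x = -8"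
      "Re w \<ge> 0 \<longleftrightarrow> x \<le> 4" "Re w \<le> 0 \<longleftrightarrow> x \<ge> 4"
      using hess_map_on_reals[OF nz(1) real] by (simp_all add: w_def x_def)
    show ?thesis
    proof (cases t)
      case T1
      have "0 < x" "x \<le> 4" using assms(1) m(1) T1 by (simp_all only: x_def)
      thus ?thesis unfolding seg01_def seg1i_def segi0_def w real x_def[symmetric]
        using T1 z2 m(2,3) unfolding x_def[symmetric] by (auto simp del: region.simps)
    next
      case T2
      have "-8 \<le> x \<and> x < 0 \<or> x = 4" using assms(1) m(2) T2 by (simp only: x_def)
      thus ?thesis unfolding seg01_def seg1i_def segi0_def w real x_def[symmetric]
        using T2 z2 m(3) unfolding x_def[symmetric] by (auto simp del: region.simps)
    next
      case T3
      have "x \<le> -8 \<or> x \<ge> 4" using assms(1) m(3) T3 by (simp only: x_def)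
      thus ?thesis unfolding seg01_def seg1i_def segi0_def w real x_def[symmetric]
        using T3 z2 unfolding x_def[symmetric] by (auto simp del: region.simps)
    qed
  next
    case curve
    have z2: "z \<in> region T2" using curve nz by auto
    have m: "z \<in> region T1 \<Longrightarrow> Re w < 0" "z \<in> region T3 \<Longrightarrow> Re w > 0"
      using hess_map_on_curve(3,4)[OF curve] by (auto simp: w_def)
    have w: "Im w = 0" "Re w < 1" using hess_map_on_curve[OF curve] by (auto simp: w_def)
    have "Re w < 0 \<or> Re w > 0" using hess_map_on_curve(3,4)[OF curve] unfolding w_def by linarith
    thus ?thesis
      using m w z2 curve(1) assms(1)
      unfolding seg01_def seg1i_def segi0_def by (cases t) (auto simp del: region.simps)
  next
    case int
    have "Im w \<noteq> 0" unfolding w_def using Im_hess_map[OF nz(1)] int nz by auto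
    moreover have "\<not> (z \<in> region T1 \<and> z \<in> region T3)"
    proof
      assume a: "z \<in> region T1 \<and> z \<in> region T3"
      hence "cmod z = 4" "quartic z \<ge> 0" by auto
      hence "Re z \<ge> 4" by (simp add: quartic_def)
      hence "Re z = cmod z" using complex_Re_le_cmod[of z] \<open>cmod z = 4\<close> by simp
      hence "Im z = 0" using cmod_power2[of z] by simp
      thus False using int by simp
    qed
    moreover have "\<not> (z \<in> region T2 \<and> (z \<in> region T1 \<or> z \<in> region T3))" using int by auto
    ultimately show ?thesis using int assms(1)
      unfolding seg01_def seg1i_def segi0_def by (cases t) (auto simp del: region.simps)
  qed
  thus "t = T1 \<Longrightarrow> seg01 z \<longleftrightarrow> seg1i w" "t = T1 \<Longrightarrow> seg1i z \<longleftrightarrow> seg01 w" "t = T1 \<Longrightarrow> \<not> segi0 z"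
    "t = T2 \<Longrightarrow> \<not> seg01 z" "t = T2 \<Longrightarrow> seg1i z \<longleftrightarrow> seg01 w \<and> segi0 w" "t = T2 \<Longrightarrow> segi0 z \<longleftrightarrow> seg1i w"
    "t = T3 \<Longrightarrow> \<not> seg01 z" "t = T3 \<Longrightarrow> seg1i z \<longleftrightarrow> segi0 w" "t = T3 \<Longrightarrow> segi0 z \<longleftrightarrow> seg1i w"
    "t = T1 \<Longrightarrow> segi0 w \<Longrightarrow> z \<in> region T2" "t = T3 \<Longrightarrow> seg01 w \<Longrightarrow> z \<in> region T2"
    "t = T1 \<Longrightarrow> z \<in> region T2 \<Longrightarrow> segi0 w" "t = T2 \<Longrightarrow> z \<in> region T3 \<Longrightarrow> seg01 w"
    "t = T1 \<Longrightarrow> z \<in> region T3 \<Longrightarrow> seg01 w \<and> segi0 w"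
    by blast+
qed

section \<open>Surjectivity on the regions\<close>

lemma continuous_on_hess_map [continuous_intros]:
  "continuous_on A g \<Longrightarrow> (\<And>x. x \<in> A \<Longrightarrow> g x \<noteq> 0) \<Longrightarrow> continuous_on A (\<lambda>x. hess_map (g x))"
  unfolding hess_map_def by (intro continuous_intros) auto

lemma continuous_on_quartic [continuous_intros]:
  "continuous_on A g \<Longrightarrow> continuous_on A (\<lambda>x. quartic (g x))"
  unfolding quartic_def by (intro continuous_intros)

text \<open>The map is proper away from $0$, since it tends to infinity at $0$ and at infinity.\<close>

lemma compact_hess_preimage:
  assumes "compact C"
  shows "compact {z. z \<noteq> 0 \<and> hess_map z \<in> C}"
proof -
  obtain M where M: "M > 0" "\<And>w. w \<in> C \<Longrightarrow> cmod w \<le> M"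
    using compact_imp_bounded[OF assms] unfolding bounded_pos by blast
  \<comment> \<open>For $|z| \le 2$ one has $|z - 4| \ge 2$, and for $|z| \ge 8$ one has $|z - 4| \ge |z|/2$.\<close>
  define r R where "r = min 2 (sqrt (8 / (27 * M)))" and "R = max 8 (216 * M)"
  have r: "r > 0" "r \<le> 2" "r^2 \<le> 8 / (27 * M)"
  proof -
    show "r > 0" "r \<le> 2" using M by (auto simp: r_def)
    hence "r^2 \<le> (sqrt (8 / (27 * M)))^2" by (intro power_mono) (auto simp: r_def)
    thus "r^2 \<le> 8 / (27 * M)" using M by simp
  qed
  define S where "S = {z. r \<le> cmod z \<and> cmod z \<le> R}"
  have "S = cball 0 R - ball 0 r" by (auto simp: S_def)
  hence S: "compact S" by (simp add: compact_diff)
  have S0: "0 \<notin> S" using r by (auto simp: S_def)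
  have "{z. z \<noteq> 0 \<and> hess_map z \<in> C} = S \<inter> hess_map -` C"
  proof -
    have "z \<in> S" if z: "z \<noteq> 0" "hess_map z \<in> C" for z
    proof -
      have "cmod (z - 4)^3 / (27 * cmod z ^ 2) \<le> M"
        using M(2)[OF z(2)] by (simp add: hess_map_def norm_divide norm_mult norm_power)
      hence le: "cmod (z - 4)^3 \<le> 27 * M * cmod z ^ 2" using z by (simp add: divide_le_eq mult_ac)
      have "r \<le> cmod z"
      proof (rule ccontr)
        assume "\<not> r \<le> cmod z"
        hence lt: "cmod z < r" by simp
        hence "cmod (z - 4) \<ge> 2" using r norm_triangle_ineq2[of 4 z] by (simp add: norm_minus_commute)
        hence "2^3 \<le> cmod (z - 4)^3" by (intro power_mono) auto
        also note le
        also have "27 * M * cmod z ^ 2 < 27 * M * r^2"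
          using lt M by (intro mult_strict_left_mono power_strict_mono) auto
        also have "\<dots> \<le> 27 * M * (8 / (27 * M))" using r M by (intro mult_left_mono) auto
        also have "\<dots> = 8" using M by simp
        finally show False by simp
      qed
      moreover have "cmod z \<le> R"
      proof (rule ccontr)
        assume "\<not> cmod z \<le> R"
        hence gt: "cmod z > 8" "cmod z > 216 * M" by (auto simp: R_def)
        hence "cmod (z - 4) \<ge> cmod z / 2" using norm_triangle_ineq2[of z 4] by simp
        hence "(cmod z / 2)^3 \<le> cmod (z - 4)^3" by (intro power_mono) auto
        also note le
        finally have "cmod z ^ 2 * cmod z \<le> cmod z ^ 2 * (216 * M)" by (simp add: power3_eq_cube power2_eq_square mult_ac)
        hence "cmod z \<le> 216 * M" using z by simp
        thus False using gt by simp
      qed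
      ultimately show ?thesis by (simp add: S_def)
    qed
    thus ?thesis using S0 by auto
  qed
  moreover have "continuous_on S hess_map" by (intro continuous_intros) (use S0 in auto)
  hence "closed (S \<inter> hess_map -` C)"
    by (intro continuous_closed_preimage) (use S assms compact_imp_closed in auto)
  ultimately show ?thesis
    using S compact_Int_closed[OF S, of "S \<inter> hess_map -` C"] by (simp add: Int_absorb1 inf_assoc[symmetric])
qed

lemma closed_region: "closed {z. Im z \<ge> 0 \<and> quartic z \<ge> 0 \<and> cmod z \<le> 4}"
    "closed {z. Im z \<ge> 0 \<and> quartic z \<le> 0}" "closed {z. Im z \<ge> 0 \<and> quartic z \<ge> 0 \<and> cmod z \<ge> 4}"
  by (intro closed_Collect_conj closed_Collect_le continuous_intros)+

lemma region_closed_in: "\<exists>S. closed S \<and> region t = S - {0}"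
proof (cases t)
  case T1
  show ?thesis by (rule exI[of _ "{z. Im z \<ge> 0 \<and> quartic z \<ge> 0 \<and> cmod z \<le> 4}"]) (use closed_region T1 in auto)
next
  case T2
  show ?thesis by (rule exI[of _ "{z. Im z \<ge> 0 \<and> quartic z \<le> 0}"]) (use closed_region T2 in auto)
next
  case T3
  show ?thesis by (rule exI[of _ "{z. Im z \<ge> 0 \<and> quartic z \<ge> 0 \<and> cmod z \<ge> 4}"]) (use closed_region T3 in auto)
qed

lemma compact_fold_preimage:
  assumes "compact C"
  shows "compact {z. z \<noteq> 0 \<and> upper_fold (hess_map z) \<in> C}"
proof -
  obtain M where M: "\<And>w. w \<in> C \<Longrightarrow> cmod w \<le> M"
    using compact_imp_bounded[OF assms] unfolding bounded_pos by blast
  have "closed (upper_fold -` C)"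
    using continuous_closed_preimage[of UNIV upper_fold C] continuous_on_upper_fold[of UNIV "\<lambda>x. x"] compact_imp_closed[OF assms] by simp
  hence "compact (cball 0 M \<inter> upper_fold -` C)" by (intro compact_Int_closed) auto
  moreover have "upper_fold w \<in> C \<longleftrightarrow> w \<in> cball 0 M \<inter> upper_fold -` C" for w
    using M[of "upper_fold w"] by auto
  ultimately show ?thesis using compact_hess_preimage by presburger
qed

lemma compact_region_preimage:
  assumes "compact C"
  shows "compact {z \<in> region t. upper_fold (hess_map z) \<in> C}"
proof -
  obtain S where S: "closed S" "region t = S - {0}" using region_closed_in by blast
  have "{z \<in> region t. upper_fold (hess_map z) \<in> C} = {z. z \<noteq> 0 \<and> upper_fold (hess_map z) \<in> C} \<inter> S"
    using S by auto
  thus ?thesis using compact_Int_closed[OF compact_fold_preimage[OF assms] S(1)] by simp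
qed

lemma continuous_on_region: "continuous_on (region t) (\<lambda>z. upper_fold (hess_map z))"
  by (intro continuous_intros) (auto dest: regionD)

lemma closed_region_image: "closed ((\<lambda>z. upper_fold (hess_map z)) ` region t)" (is "closed (?f ` _)")
proof -
  have "l \<in> ?f ` region t" if x: "\<And>n. x n \<in> ?f ` region t" "x \<longlonglongrightarrow> l" for x l
  proof -
    obtain M where "\<And>n. cmod (x n) \<le> M"
      using convergent_imp_Bseq[OF convergentI[OF x(2)]] unfolding Bseq_def by blast
    hence b: "x n \<in> cball 0 M" for n by simp
    have xm: "x n \<in> ?f ` {z \<in> region t. ?f z \<in> cball 0 M}" for n
    proof -
      obtain z where "z \<in> region t" "x n = ?f z" using x(1)[of n] by blast
      thus ?thesis using b[of n] by (intro image_eqI[of _ _ z]) (simp_all del: mem_cball)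
    qed
    have "compact (?f ` {z \<in> region t. ?f z \<in> cball 0 M})"
      by (intro compact_continuous_image compact_region_preimage continuous_on_subset[OF continuous_on_region]) auto
    hence "l \<in> ?f ` {z \<in> region t. ?f z \<in> cball 0 M}"
      using xm x(2) closed_sequentially compact_imp_closed by blast
    thus ?thesis by blast
  qed
  thus ?thesis unfolding closed_sequential_limits by blast
qed

definition region_interior :: "tile \<Rightarrow> complex set" where
  "region_interior t = {z \<in> region t. Im z > 0 \<and> quartic z \<noteq> 0}"

lemma open_region_interior: "open (region_interior t)"
proof -
  have circ: "cmod z \<noteq> 4" if "Im z > 0" "quartic z > 0" for z
  proof
    assume "cmod z = 4"
    hence "Re z \<ge> 4" using that by (simp add: quartic_def)
    hence "Re z = cmod z" using complex_Re_le_cmod[of z] \<open>cmod z = 4\<close> by simp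
    hence "Im z = 0" using cmod_power2[of z] by simp
    thus False using that by simp
  qed
  have "region_interior t = (case t of T1 \<Rightarrow> {z. Im z > 0 \<and> quartic z > 0 \<and> cmod z < 4}
      | T2 \<Rightarrow> {z. Im z > 0 \<and> quartic z < 0} | T3 \<Rightarrow> {z. Im z > 0 \<and> quartic z > 0 \<and> cmod z > 4})"
    using circ by (cases t) (force simp: region_interior_def less_le)+
  moreover have "open {z. Im z > 0 \<and> quartic z > 0 \<and> cmod z < 4}" "open {z. Im z > 0 \<and> quartic z < 0}"
      "open {z. Im z > 0 \<and> quartic z > 0 \<and> cmod z > 4}"
    by (intro open_Collect_conj open_Collect_less continuous_intros)+
  ultimately show ?thesis by (cases t) simp_all
qed

lemma region_interior_nonempty: "region_interior t \<noteq> {}"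
proof (cases t)
  case T1
  have "cmod (Complex 2 (1/2)) \<le> 4" by (rule order.trans[OF cmod_le]) simp
  hence "Complex 2 (1/2) \<in> region_interior t" using T1
    by (simp add: region_interior_def quartic_def cmod_4 cmod_power2 complex_eq_iff power_divide)
  thus ?thesis by blast
next
  case T2
  have "\<i> \<in> region_interior t" using T2 by (simp add: region_interior_def quartic_def)
  thus ?thesis by blast
next
  case T3
  have "cmod (Complex 10 1) \<ge> 4" using abs_Re_le_cmod[of "Complex 10 1"] by simp
  hence "Complex 10 1 \<in> region_interior t" using T3
    by (simp add: region_interior_def quartic_def cmod_4 cmod_power2 complex_eq_iff power_divide)
  thus ?thesis by blast
qed

text \<open>The image of the interior of a region is open by invariance of domain and relatively closed by
properness, hence it is the whole open half-plane; the boundary values follow because the image of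
the region is closed.\<close>

lemma region_surj:
  assumes "Im w \<ge> 0"
  shows "\<exists>z \<in> region t. upper_fold (hess_map z) = w"
proof -
  define f where "f = (\<lambda>z. upper_fold (hess_map z))"
  define U where "U = {w. Im w > 0}"
  have oU: "open U" unfolding U_def by (rule open_halfspace_Im_gt)
  have cU: "connected U" unfolding U_def by (intro convex_connected convex_halfspace_Im_gt)
  have img: "f ` region_interior t = U \<inter> f ` region t"
  proof -
    have "z \<in> region_interior t \<longleftrightarrow> f z \<in> U" if z: "z \<in> region t" for z
    proof -
      have nz: "z \<noteq> 0" "Im z \<ge> 0" using z by (auto dest: regionD)
      have "f z \<in> U \<longleftrightarrow> Im (hess_map z) \<noteq> 0" by (auto simp: f_def U_def upper_fold_def)
      also have "\<dots> \<longleftrightarrow> Im z \<noteq> 0 \<and> quartic z \<noteq> 0" using nz by (auto simp: Im_hess_map)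
      finally show ?thesis using nz z by (auto simp: region_interior_def)
    qed
    moreover have "region_interior t \<subseteq> region t" by (auto simp: region_interior_def)
    ultimately show ?thesis by blast
  qed
  have incl: "region_interior t \<subseteq> region t" by (auto simp: region_interior_def)
  have "inj_on f (region t)" using region_inj by (auto intro!: inj_onI simp: f_def)
  hence "open (f ` region_interior t)"
    by (intro invariance_of_domain open_region_interior)
      (use incl continuous_on_region in \<open>auto simp: f_def intro: continuous_on_subset inj_on_subset\<close>)
  hence "openin (top_of_set U) (f ` region_interior t)"
    by (intro open_subset) (use img in auto)
  moreover have "closedin (top_of_set U) (f ` region_interior t)"
    unfolding img using closed_region_image[of t] by (auto simp: f_def intro: closedin_closed_Int)
  ultimately have "f ` region_interior t = U"
    using cU region_interior_nonempty[of t] unfolding connected_clopen by blast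
  hence UI: "U \<subseteq> f ` region t" using img by blast
  have lim: "(\<lambda>n. w + of_real (1 / real (Suc n)) * \<i>) \<longlonglongrightarrow> w + of_real 0 * \<i>"
    using LIMSEQ_inverse_real_of_nat unfolding inverse_eq_divide by (intro tendsto_intros)
  have mem: "w + of_real (1 / real (Suc n)) * \<i> \<in> f ` region t" for n
    using assms by (intro subsetD[OF UI]) (simp add: U_def add_nonneg_pos)
  have "w + of_real 0 * \<i> \<in> f ` region t"
    using closed_sequentially[OF closed_region_image[of t, folded f_def] mem lim] .
  thus ?thesis by (auto simp: f_def)
qed

section \<open>The hessian of a plane cubic\<close>

text \<open>The Hesse pencil, with a scalar factor that makes it stable under taking hessians.\<close>

definition hesse_cubic :: "complex \<Rightarrow> complex \<Rightarrow> complex^3 \<Rightarrow> complex" where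
  "hesse_cubic c k x = c * ((x$1)^3 + (x$2)^3 + (x$3)^3 - 3 * k * x$1 * x$2 * x$3)"

lemma shift_nth: "(x + t *s axis j 1) $ i = x $ i + t * (if i = j then 1 else 0 :: complex)"
  by (simp add: axis_def)

lemma partial_hesse_cubic:
  "partial 1 (hesse_cubic c k) = (\<lambda>x. c * (3 * (x$1)^2 - 3 * k * x$2 * x$3))"
  "partial 2 (hesse_cubic c k) = (\<lambda>x. c * (3 * (x$2)^2 - 3 * k * x$1 * x$3))"
  "partial 3 (hesse_cubic c k) = (\<lambda>x. c * (3 * (x$3)^2 - 3 * k * x$1 * x$2))"
  unfolding partial_def hesse_cubic_def shift_nth
  by (rule ext, rule DERIV_imp_deriv, auto intro!: derivative_eq_intros simp: algebra_simps)+

lemma partial_quadric: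
  "partial i (\<lambda>x. c * (3 * (x$a)^2 - 3 * k * x$b * x$d)) x
    = c * (6 * x$a * (if a = i then 1 else 0) - 3 * k * ((if b = i then 1 else 0) * x$d + x$b * (if d = i then 1 else 0)))"
  unfolding partial_def shift_nth
  by (rule DERIV_imp_deriv) (auto intro!: derivative_eq_intros simp: algebra_simps)

lemma Hess_hesse_cubic:
  assumes "k \<noteq> 0"
  shows "Hess (hesse_cubic c k) = hesse_cubic (- (54 * k^2 * c^3)) ((4 - k^3) / (3 * k^2))"
proof
  fix x
  have "Hess (hesse_cubic c k) x
      = c^3 * ((216 - 54 * k^3) * x$1 * x$2 * x$3 - 54 * k^2 * ((x$1)^3 + (x$2)^3 + (x$3)^3))"
    unfolding Hess_def det_3
    by (simp add: partial_hesse_cubic partial_quadric)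
       (simp add: power2_eq_square power3_eq_cube algebra_simps)
  also have "\<dots> = hesse_cubic (- (54 * k^2 * c^3)) ((4 - k^3) / (3 * k^2)) x"
    using assms by (simp add: hesse_cubic_def field_simps)
  finally show "Hess (hesse_cubic c k) x = hesse_cubic (- (54 * k^2 * c^3)) ((4 - k^3) / (3 * k^2)) x" .
qed

lemma cubic_form_hesse_cubic: "cubic_form (hesse_cubic c k)"
proof -
  define C :: "3 \<Rightarrow> 3 \<Rightarrow> 3 \<Rightarrow> complex" where
    "C i j l = (if i = j \<and> j = l then c else if i = 1 \<and> j = 2 \<and> l = 3 then - (3 * c * k) else 0)" for i j l
  have "hesse_cubic c k x = (\<Sum>i\<in>UNIV. \<Sum>j\<in>UNIV. \<Sum>l\<in>UNIV. C i j l * x$i * x$j * x$l)" for x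
    by (simp add: sum_3 C_def hesse_cubic_def power3_eq_cube algebra_simps)
  thus ?thesis unfolding cubic_form_def by blast
qed

lemma smooth_hesse_cubic:
  assumes "c \<noteq> 0" "k^3 \<noteq> 1"
  shows "smooth_cubic (hesse_cubic c k)"
proof -
  have "\<exists>i. partial i (hesse_cubic c k) x \<noteq> 0" if "x \<noteq> 0" for x
  proof (rule ccontr)
    assume "\<not> (\<exists>i. partial i (hesse_cubic c k) x \<noteq> 0)"
    hence "partial 1 (hesse_cubic c k) x = 0" "partial 2 (hesse_cubic c k) x = 0" "partial 3 (hesse_cubic c k) x = 0"
      by blast+
    hence e: "(x$1)^2 = k * (x$2 * x$3)" "(x$2)^2 = k * (x$1 * x$3)" "(x$3)^2 = k * (x$1 * x$2)"
      using assms(1) by (simp_all add: partial_hesse_cubic mult.assoc)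
    define P where "P = x$1 * x$2 * x$3"
    have c3: "(x$1)^3 = k * P" "(x$2)^3 = k * P" "(x$3)^3 = k * P"
      using e by (simp_all add: P_def power3_eq_cube power2_eq_square mult_ac)
    have "P^3 = (x$1)^3 * (x$2)^3 * (x$3)^3" by (simp add: P_def power_mult_distrib)
    also have "\<dots> = k^3 * P^3" unfolding c3 by (simp add: power3_eq_cube mult_ac)
    finally have "P = 0" using assms(2) by simp
    hence "x$1 = 0" "x$2 = 0" "x$3 = 0" using c3 by simp_all
    hence "x = 0" by (simp add: vec_eq_iff forall_3)
    thus False using that by simp
  qed
  thus ?thesis unfolding smooth_cubic_def using cubic_form_hesse_cubic by blast
qed

definition hesse_modulus :: "complex \<Rightarrow> complex" where
  "hesse_modulus K = K * (K + 8)^3 / (64 * (K - 1)^3)"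

text \<open>The inflection point $(1:-1:0)$ has the tangent $x + y + kz = 0$. Taking this line as the line at
infinity and $x - y$ as the second coordinate leaves only a cubic to be depressed, which gives the
matrix below.\<close>

lemma has_modulus_hesse_cubic:
  assumes "c \<noteq> 0" "k^3 \<noteq> 1"
  shows "has_modulus (hesse_cubic c k) (hesse_modulus (k^3))"
proof -
  define q where "q = (k^3 - 4) / 24"
  define A :: "complex^3^3" where
    "A = vector [vector [- (k/2), 1/2, q], vector [- (k/2), - (1/2), q], vector [1, 0, k^2/4]]"
  define g2 where "g2 = k * (k^3 + 8) / 12"
  define g3 where "g3 = (8 + 20 * k^3 - k^6) / 216"
  define K where "K = k^3"
  have k6: "k^6 = K^2" by (simp add: K_def flip: power_mult)
  have K1: "K \<noteq> 1" "K - 1 \<noteq> 0" using assms by (auto simp: K_def)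
  have "det A = (k^3 - 1) / 6"
    unfolding det_3 A_def q_def by (simp add: power3_eq_cube power2_eq_square field_simps)
  hence "det A \<noteq> 0" using assms by (simp only: divide_eq_0_iff) simp
  hence inv: "invertible A" by (simp add: invertible_det_nz)
  have Av: "(A *v x)$1 = - (k/2) * x$1 + 1/2 * x$2 + q * x$3"
       "(A *v x)$2 = - (k/2) * x$1 - 1/2 * x$2 + q * x$3"
       "(A *v x)$3 = x$1 + k^2/4 * x$3" for x
    by (simp_all add: A_def matrix_vector_mult_def sum_3)
  have W: "hesse_cubic c k (A *v x) = (c * (k^3 - 1) / 4) * weierstrass_form g2 g3 x" for x
    unfolding hesse_cubic_def weierstrass_form_def Av g2_def g3_def q_def
    by (simp add: power3_eq_cube power2_eq_square field_simps eval_nat_numeral)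
  have g23: "g2^3 = K * (K + 8)^3 / 1728"
    by (simp add: g2_def K_def power_mult_distrib power_divide)
  have D: "g2^3 - 27 * g3^2 = (K - 1)^3 / 27"
    unfolding g23 g3_def k6 K_def[symmetric] by (simp add: power3_eq_cube power2_eq_square field_simps)
  have "1728 * g2^3 / (g2^3 - 27 * g3^2) = 2^6 * 3^3 * hesse_modulus (k^3)"
    unfolding D unfolding g23 hesse_modulus_def K_def[symmetric] using K1 by (simp add: field_simps)
  moreover have "g2^3 - 27 * g3^2 \<noteq> 0" "c * (k^3 - 1) / 4 \<noteq> 0" unfolding D using K1 assms by auto
  ultimately show ?thesis unfolding has_modulus_def using inv W by blast
qed

lemma hesse_modulus_surj: "\<exists>K. K \<noteq> 1 \<and> hesse_modulus K = h"
proof -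
  define p where "p = [:64*h, 512 - 192*h, 192 + 192*h, 24 - 64*h, 1:]"
  have "degree p = 4" by (simp add: p_def)
  hence "\<not> constant (poly p)" by (simp add: constant_degree)
  then obtain K where K: "poly p K = 0" using fundamental_theorem_of_algebra by blast
  have "poly p K = K * (K + 8)^3 - 64 * h * (K - 1)^3"
    by (simp add: p_def power3_eq_cube algebra_simps)
  hence e: "K * (K + 8)^3 = 64 * h * (K - 1)^3" using K by simp
  have "K \<noteq> 1" using e by auto
  hence "hesse_modulus K = h" using e by (simp add: hesse_modulus_def field_simps)
  thus ?thesis using \<open>K \<noteq> 1\<close> by blast
qed

text \<open>On the parameter $K = k^3$ the hessian acts by $K \mapsto (4-K)^3/(27K^2)$, and the modulus is a
semiconjugacy from this map to the rational map in question.\<close>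

lemma hesse_modulus_hess_map:
  assumes "K \<noteq> 0" "K \<noteq> 1" "K + 8 \<noteq> 0"
  defines "K' \<equiv> (4 - K)^3 / (27 * K^2)"
  shows "K' \<noteq> 1" "hesse_modulus K' = hess_map (hesse_modulus K)"
proof -
  define a b c E where "a = K - 1" and "b = K + 8" and "c = K - 4" and "E = K^3 - 228 * K^2 + 48 * K - 64"
  have nz: "a \<noteq> 0" "b \<noteq> 0" "K \<noteq> 0" using assms by (auto simp: a_def b_def)
  have K'c: "K' = - (c^3) / (27 * K^2)"
    by (simp add: K'_def c_def power3_eq_cube algebra_simps)
  have K'1: "K' - 1 = - (a * b^2) / (27 * K^2)"
    using assms by (simp add: K'_def a_def b_def field_simps power3_eq_cube power2_eq_square)
  have K'8: "K' + 8 = - E / (27 * K^2)"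
    using assms by (simp add: K'_def E_def field_simps power3_eq_cube power2_eq_square)
  show "K' \<noteq> 1" using K'1 nz by auto
  have h: "hesse_modulus K = K * b^3 / (64 * a^3)" by (simp add: hesse_modulus_def a_def b_def)
  have num: "K * b^3 - 256 * a^3 = c * E"
    by (simp add: a_def b_def c_def E_def field_simps power3_eq_cube power2_eq_square)
  have "hesse_modulus K - 4 = (K * b^3 - 256 * a^3) / (64 * a^3)"
    unfolding h using nz by (simp add: field_simps)
  hence h4: "hesse_modulus K - 4 = c * E / (64 * a^3)" by (simp add: num)
  show "hesse_modulus K' = hess_map (hesse_modulus K)"
    unfolding hess_map_def h4 unfolding h hesse_modulus_def[of K'] K'8 K'1 unfolding K'c
    using nz by (simp add: field_simps)
qed

text \<open>The values away from $0$ come from the Hesse pencil. If $H = p/q$, they give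
$27X^2 p = -(X-4)^3 q$, which forces $q(0) = 0$ and $\deg p > \deg q$, that is, the values at $0$ and
at infinity.\<close>

lemma hessian_dynamical_system_formula:
  assumes "hessian_dynamical_system H"
  shows "z \<noteq> 0 \<Longrightarrow> H (Some z) = Some (hess_map z)" "H (Some 0) = None" "H None = None"
proof -
  have *: "H (Some h) = Some (hess_map h)" if h0: "h \<noteq> 0" for h
  proof -
    obtain K where K: "K \<noteq> 1" "hesse_modulus K = h" using hesse_modulus_surj by blast
    have nz: "K \<noteq> 0" "K + 8 \<noteq> 0" using K(2) h0 by (auto simp: hesse_modulus_def)
    define k where "k = exp (Ln K / 3)"
    have k3: "k^3 = K" using nz by (simp add: k_def flip: exp_of_nat_mult)
    hence k0: "k \<noteq> 0" using nz by auto
    define k' where "k' = (4 - k^3) / (3 * k^2)"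
    have k'3: "k'^3 = (4 - K)^3 / (27 * K^2)"
      by (simp add: k'_def power_divide power_mult_distrib flip: k3 power_mult)
    note HM = hesse_modulus_hess_map[OF nz(1) K(1) nz(2), folded k'3]
    have Hs: "Hess (hesse_cubic 1 k) = hesse_cubic (- (54 * k^2 * 1^3)) k'"
      unfolding k'_def by (rule Hess_hesse_cubic[OF k0])
    have c: "- (54 * k^2 * 1^3) \<noteq> 0" using k0 by simp
    have "smooth_cubic (hesse_cubic 1 k)" "has_modulus (hesse_cubic 1 k) h"
      using smooth_hesse_cubic[of 1 k] has_modulus_hesse_cubic[of 1 k] K k3 by auto
    moreover have "smooth_cubic (Hess (hesse_cubic 1 k))" "has_modulus (Hess (hesse_cubic 1 k)) (hess_map h)"
      unfolding Hs using smooth_hesse_cubic[OF c HM(1)] has_modulus_hesse_cubic[OF c HM(1)] HM(2) K(2) by auto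
    ultimately show ?thesis using assms unfolding hessian_dynamical_system_def by blast
  qed
  thus "z \<noteq> 0 \<Longrightarrow> H (Some z) = Some (hess_map z)" .
  obtain p q :: "complex poly" where pq: "coprime p q"
      "\<And>z. H (Some z) = (if poly q z = 0 then None else Some (poly p z / poly q z))"
      "H None = (if coeff q (max (degree p) (degree q)) = 0 then None
        else Some (coeff p (max (degree p) (degree q)) / coeff q (max (degree p) (degree q))))"
    using assms unfolding hessian_dynamical_system_def algebraic_morphism_P1_def Let_def by blast
  have id: "poly (p * [:0,0,27:]) z = poly (- ([:-4,1:]^3 * q)) z" if "z \<noteq> 0" for z
  proof -
    have "poly q z \<noteq> 0" "poly p z / poly q z = hess_map z"
      using *[OF that] pq(2)[of z] by (auto split: if_splits)
    thus ?thesis using that by (simp add: hess_map_def field_simps power2_eq_square)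
  qed
  have "poly ([:0,1:] * (p * [:0,0,27:])) = poly ([:0,1:] * (- ([:-4,1:]^3 * q)))"
  proof
    fix z show "poly ([:0,1:] * (p * [:0,0,27:])) z = poly ([:0,1:] * (- ([:-4,1:]^3 * q))) z"
      using id[of z] by (cases "z = 0") simp_all
  qed
  hence "[:0,1:] * (p * [:0,0,27:]) = [:0,1:] * (- ([:-4,1:]^3 * q))"
    by (simp only: poly_eq_poly_eq_iff)
  hence pq_id: "p * [:0,0,27:] = - ([:-4,1:]^3 * q)" by (simp only: mult_cancel_left) simp
  have "poly q 0 = 0" using arg_cong[OF pq_id, of "\<lambda>r. poly r 0"] by simp
  thus "H (Some 0) = None" using pq(2) by simp
  have q0: "q \<noteq> 0" using *[of 1] pq(2)[of 1] by (auto split: if_splits)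
  have p0: "p \<noteq> 0" using *[of 1] pq(2)[of 1] by (auto simp: hess_map_def split: if_splits)
  have "degree (p * [:0,0,27:]) = degree p + 2" using p0 by (subst degree_mult_eq) auto
  moreover have "degree (- ([:-4,1:]^3 * q)) = 3 + degree q"
    using q0 by (simp add: degree_mult_eq degree_power_eq)
  ultimately have "degree p = degree q + 1" unfolding pq_id by linarith
  hence "coeff q (max (degree p) (degree q)) = 0" by (simp add: coeff_eq_0)
  thus "H None = None" using pq(3) by simp
qed

section \<open>The subdivided triangle in barycentric coordinates\<close>

text \<open>The weights of the vertices named $0$, $1$, $\infty$.\<close>

type_synonym bary = "real \<times> real \<times> real"

definition std_simplex :: "bary set" where
  "std_simplex = {(l0, l1, li). 0 \<le> l0 \<and> 0 \<le> l1 \<and> 0 \<le> li \<and> l0 + l1 + li = 1}"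

text \<open>The inverse of $H_{PL}$ on each of the three triangles of $\mathcal{T}_1$.\<close>

fun tile_map :: "tile \<Rightarrow> bary \<Rightarrow> bary" where
  "tile_map T1 (l0, l1, li) = (li, l1 + l0/2, l0/2)"
| "tile_map T2 (l0, l1, li) = (li + l1/2, l0/2, l0/2 + l1/2)"
| "tile_map T3 (l0, l1, li) = (l1/2, l0/2, li + l1/2 + l0/2)"

lemma tile_map_simplex: "l \<in> std_simplex \<Longrightarrow> tile_map t l \<in> std_simplex"
  by (cases l; cases t) (auto simp: std_simplex_def)

lemma continuous_on_tile_map: "continuous_on A g \<Longrightarrow> continuous_on A (\<lambda>x. tile_map t (g x))"
proof -
  have "continuous_on UNIV (tile_map t)"
  proof -
    have "tile_map t = (case t of T1 \<Rightarrow> (\<lambda>l. (snd (snd l), fst (snd l) + fst l / 2, fst l / 2))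
      | T2 \<Rightarrow> (\<lambda>l. (snd (snd l) + fst (snd l) / 2, fst l / 2, fst l / 2 + fst (snd l) / 2))
      | T3 \<Rightarrow> (\<lambda>l. (fst (snd l) / 2, fst l / 2, snd (snd l) + fst (snd l) / 2 + fst l / 2)))"
      by (cases t) auto
    thus ?thesis by (cases t) (auto intro!: continuous_intros)
  qed
  thus "continuous_on A g \<Longrightarrow> continuous_on A (\<lambda>x. tile_map t (g x))"
    using continuous_on_compose2 by blast
qed

lemma simplex_cover: "l \<in> std_simplex \<Longrightarrow> \<exists>t. l \<in> tile_map t ` std_simplex"
proof -
  assume l: "l \<in> std_simplex"
  obtain c0 c1 ci where c: "l = (c0, c1, ci)" by (cases l)
  have s: "0 \<le> c0" "0 \<le> c1" "0 \<le> ci" "c0 + c1 + ci = 1" using l by (auto simp: std_simplex_def c)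
  consider "c1 \<ge> ci" | "ci \<ge> c0 + c1" | "ci \<ge> c1" "ci \<le> c0 + c1" by linarith
  thus ?thesis
  proof cases
    case 1
    thus ?thesis using s unfolding c
      by (intro exI[of _ T1] image_eqI[of _ _ "(2*ci, c1 - ci, c0)"]) (auto simp: std_simplex_def)
  next
    case 2
    thus ?thesis using s unfolding c
      by (intro exI[of _ T3] image_eqI[of _ _ "(2*c1, 2*c0, ci - c0 - c1)"]) (auto simp: std_simplex_def)
  next
    case 3
    thus ?thesis using s unfolding c
      by (intro exI[of _ T2] image_eqI[of _ _ "(2*c1, 2*ci - 2*c1, c0 - ci + c1)"]) (auto simp: std_simplex_def field_simps)
  qed
qed

definition "side01 (l::bary) \<longleftrightarrow> snd (snd l) = 0"
definition "side1i (l::bary) \<longleftrightarrow> fst l = 0"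
definition "sidei0 (l::bary) \<longleftrightarrow> fst (snd l) = 0"

lemma tile_map_sides:
  assumes "l \<in> std_simplex"
  shows "side01 (tile_map T1 l) \<longleftrightarrow> side1i l" "side1i (tile_map T1 l) \<longleftrightarrow> side01 l" "sidei0 (tile_map T1 l) \<longleftrightarrow> side1i l \<and> sidei0 l"
    "side01 (tile_map T2 l) \<longleftrightarrow> side1i l \<and> sidei0 l" "side1i (tile_map T2 l) \<longleftrightarrow> side01 l \<and> sidei0 l" "sidei0 (tile_map T2 l) \<longleftrightarrow> side1i l"
    "\<not> side01 (tile_map T3 l)" "side1i (tile_map T3 l) \<longleftrightarrow> sidei0 l" "sidei0 (tile_map T3 l) \<longleftrightarrow> side1i l"
proof -
  obtain a b c where l: "l = (a, b, c)" by (cases l)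
  have s: "0 \<le> a" "0 \<le> b" "0 \<le> c" "a + b + c = 1" using assms by (auto simp: std_simplex_def l)
  note d = l side01_def side1i_def sidei0_def tile_map.simps fst_conv snd_conv
  show "side01 (tile_map T1 l) \<longleftrightarrow> side1i l" "side1i (tile_map T1 l) \<longleftrightarrow> side01 l" "sidei0 (tile_map T1 l) \<longleftrightarrow> side1i l \<and> sidei0 l"
    "side01 (tile_map T2 l) \<longleftrightarrow> side1i l \<and> sidei0 l" "side1i (tile_map T2 l) \<longleftrightarrow> side01 l \<and> sidei0 l" "sidei0 (tile_map T2 l) \<longleftrightarrow> side1i l"
    "\<not> side01 (tile_map T3 l)" "side1i (tile_map T3 l) \<longleftrightarrow> sidei0 l" "sidei0 (tile_map T3 l) \<longleftrightarrow> side1i l"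
    unfolding d using s by (smt (verit) field_sum_of_halves)+
qed

text \<open>Two inverse branches agree exactly along the common edge of the two triangles, and only at equal
arguments.\<close>

lemma tile_map_eq_iff:
  assumes "l \<in> std_simplex" "m \<in> std_simplex"
  shows "tile_map t l = tile_map t m \<longleftrightarrow> l = m"
    "tile_map T1 l = tile_map T2 m \<longleftrightarrow> l = m \<and> sidei0 l" "tile_map T2 l = tile_map T3 m \<longleftrightarrow> l = m \<and> side01 l"
    "tile_map T1 l = tile_map T3 m \<longleftrightarrow> l = m \<and> side01 l \<and> sidei0 l"
proof -
  show "tile_map t l = tile_map t m \<longleftrightarrow> l = m" by (cases t; cases l; cases m) auto
  show "tile_map T1 l = tile_map T2 m \<longleftrightarrow> l = m \<and> sidei0 l" "tile_map T2 l = tile_map T3 m \<longleftrightarrow> l = m \<and> side01 l"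
    "tile_map T1 l = tile_map T3 m \<longleftrightarrow> l = m \<and> side01 l \<and> sidei0 l"
  proof -
    obtain a b c where l: "l = (a, b, c)" by (cases l)
    obtain a' b' c' where m: "m = (a', b', c')" by (cases m)
    have s: "0 \<le> a" "0 \<le> b" "0 \<le> c" "a + b + c = 1" "0 \<le> a'" "0 \<le> b'" "0 \<le> c'" "a' + b' + c' = 1"
      using assms by (auto simp: std_simplex_def l m)
    note d = l m side01_def sidei0_def tile_map.simps fst_conv snd_conv prod.inject
    show "tile_map T1 l = tile_map T2 m \<longleftrightarrow> l = m \<and> sidei0 l" "tile_map T2 l = tile_map T3 m \<longleftrightarrow> l = m \<and> side01 l"
      "tile_map T1 l = tile_map T3 m \<longleftrightarrow> l = m \<and> side01 l \<and> sidei0 l"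
      unfolding d using s by (smt (verit) field_sum_of_halves)+
  qed
qed

fun word_map :: "tile list \<Rightarrow> bary \<Rightarrow> bary" where
  "word_map [] l = l"
| "word_map (t # w) l = tile_map t (word_map w l)"

lemma word_map_append: "word_map (v @ w) l = word_map v (word_map w l)"
  by (induction v) auto

lemma word_map_simplex: "l \<in> std_simplex \<Longrightarrow> word_map w l \<in> std_simplex"
  by (induction w) (auto intro: tile_map_simplex)

lemma word_map_eq_iff: "l \<in> std_simplex \<Longrightarrow> m \<in> std_simplex \<Longrightarrow> word_map w l = word_map w m \<longleftrightarrow> l = m"
  by (induction w) (auto simp: tile_map_eq_iff word_map_simplex)

lemma word_map_inj: "length v = length w \<Longrightarrow> l \<in> std_simplex \<Longrightarrow> m \<in> std_simplex \<Longrightarrow> word_map v l = word_map w m \<Longrightarrow> l = m"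
proof (induction v w rule: list_induct2)
  case (Cons s v t w)
  have S: "word_map v l \<in> std_simplex" "word_map w m \<in> std_simplex" using Cons by (auto intro: word_map_simplex)
  have "word_map v l = word_map w m" using Cons.prems(3) S tile_map_eq_iff[OF S] tile_map_eq_iff[OF S(2) S(1)]
    by (cases s; cases t) (auto simp del: tile_map.simps dest!: sym[of "tile_map _ _" "tile_map _ _"])
  thus ?case using Cons by simp
qed simp

definition mix :: "real \<Rightarrow> bary \<Rightarrow> bary \<Rightarrow> bary" where
  "mix e l m = (1 - e) *\<^sub>R l + e *\<^sub>R m"

lemma tile_map_mix: "tile_map t (mix e l m) = mix e (tile_map t l) (tile_map t m)"
  by (cases t; cases l; cases m) (auto simp: mix_def field_simps)

lemma word_map_mix: "word_map w (mix e l m) = mix e (word_map w l) (word_map w m)"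
  by (induction w) (auto simp: tile_map_mix)

lemma mix_simplex: "l \<in> std_simplex \<Longrightarrow> m \<in> std_simplex \<Longrightarrow> 0 \<le> e \<Longrightarrow> e \<le> 1 \<Longrightarrow> mix e l m \<in> std_simplex"
proof -
  assume lm: "l \<in> std_simplex" "m \<in> std_simplex" and e: "0 \<le> e" "e \<le> 1"
  obtain a b c where l: "l = (a, b, c)" by (cases l)
  obtain a' b' c' where m: "m = (a', b', c')" by (cases m)
  have s: "0 \<le> a" "0 \<le> b" "0 \<le> c" "a + b + c = 1" "0 \<le> a'" "0 \<le> b'" "0 \<le> c'" "a' + b' + c' = 1"
    using lm by (auto simp: std_simplex_def l m)
  have "((1-e)*a + e*a') + ((1-e)*b + e*b') + ((1-e)*c + e*c') = (1 - e) * (a + b + c) + e * (a' + b' + c')"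
    by (simp add: algebra_simps)
  also have "\<dots> = 1" unfolding s by simp
  finally show ?thesis using s e by (simp add: mix_def std_simplex_def l m)
qed

text \<open>The determinant of the matrix with rows $l$, $m$, $n$; its sign is the orientation of the triangle
$lmn$ relative to that of $T$.\<close>

definition bary_det :: "bary \<Rightarrow> bary \<Rightarrow> bary \<Rightarrow> real" where
  "bary_det l m n = (case (l, m, n) of ((l0, l1, li), (m0, m1, mi), (n0, n1, ni)) \<Rightarrow>
     l0 * (m1 * ni - mi * n1) - l1 * (m0 * ni - mi * n0) + li * (m0 * n1 - m1 * n0))"

text \<open>Whether the inverse branch along a word preserves orientation; the same sign tells in \<open>dessin_pt_word_map\<close>
whether the iterate has to be followed by conjugation.\<close>

fun word_sign :: "tile list \<Rightarrow> bool" where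
  "word_sign [] = True"
| "word_sign (t # w) = (preserves_sides t = word_sign w)"

lemma bary_det_tile_map: "bary_det (tile_map t l) (tile_map t m) (tile_map t n) = (case t of T1 \<Rightarrow> - 1/2 | T2 \<Rightarrow> 1/4 | T3 \<Rightarrow> - 1/4) * bary_det l m n"
  by (cases t; cases l; cases m; cases n) (auto simp: bary_det_def field_simps)

lemma bary_det_word_map: "\<exists>r>0. bary_det (word_map w l) (word_map w m) (word_map w n) = (if word_sign w then r else - r) * bary_det l m n"
proof (induction w)
  case (Cons t w)
  then obtain r where r: "r > 0" "bary_det (word_map w l) (word_map w m) (word_map w n) = (if word_sign w then r else - r) * bary_det l m n"
    by blast
  have "bary_det (word_map (t # w) l) (word_map (t # w) m) (word_map (t # w) n)
     = (if word_sign (t # w) then (case t of T1 \<Rightarrow> 1/2 | _ \<Rightarrow> 1/4) * r else - ((case t of T1 \<Rightarrow> 1/2 | _ \<Rightarrow> 1/4) * r)) * bary_det l m n"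
    by (cases t) (simp_all add: bary_det_tile_map r(2))
  moreover have "(case t of T1 \<Rightarrow> 1/2 | _ \<Rightarrow> 1/4) * r > 0" using r(1) by (cases t) auto
  ultimately show ?case by blast
qed (auto intro: exI[of _ 1])

text \<open>$\Phi_n$, produced by subdivision instead of as a union of edges; see \<open>Phi_eq\<close>.\<close>

fun Phi_bary :: "nat \<Rightarrow> bary set" where
  "Phi_bary 0 = {l \<in> std_simplex. side01 l}"
| "Phi_bary (Suc n) = (\<Union>t. tile_map t ` Phi_bary n)"

definition edge_pt :: "real \<Rightarrow> bary" where "edge_pt e = (1 - e, e, 0)"

lemma edge_pt_simplex: "0 \<le> e \<Longrightarrow> e \<le> 1 \<Longrightarrow> edge_pt e \<in> std_simplex"
  by (simp add: edge_pt_def std_simplex_def)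

lemma Phi_bary_subset: "Phi_bary n \<subseteq> std_simplex"
proof (induction n)
  case (Suc n)
  thus ?case unfolding Phi_bary.simps using tile_map_simplex by blast
qed auto

lemma Phi_bary_words: "Phi_bary n = (\<Union>w \<in> {w. length w = n}. word_map w ` edge_pt ` {0..1})"
proof (induction n)
  case 0
  show ?case by (auto simp: std_simplex_def side01_def edge_pt_def image_iff)
next
  case (Suc n)
  have "(\<Union>w \<in> {w. length w = Suc n}. word_map w ` edge_pt ` {0..1}) = (\<Union>t. tile_map t ` (\<Union>w \<in> {w. length w = n}. word_map w ` edge_pt ` {0..1}))"
    by (force simp: length_Suc_conv image_image)
  thus ?case using Suc by simp
qed

section \<open>The dessin in the upper half-plane\<close>

text \<open>The dessin of the $n$-th iterate as a set of complex numbers. It does not contain $\infty$, which is a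
fixed point of the hessian dynamical system; hence an orbit can meet the pole $0$ only at its end.\<close>

fun dessin_set :: "nat \<Rightarrow> complex set" where
  "dessin_set 0 = {z. seg01 z}"
| "dessin_set (Suc n) = {z. z \<noteq> 0 \<and> hess_map z \<in> dessin_set n}"

definition dessin_up :: "nat \<Rightarrow> complex set" where "dessin_up n = {z \<in> dessin_set n. Im z \<ge> 0}"

lemma dessin_set_cnj: "cnj z \<in> dessin_set n \<longleftrightarrow> z \<in> dessin_set n"
  by (induction n arbitrary: z) (auto simp: seg01_def hess_map_cnj)

lemma dessin_set_fold: "upper_fold z \<in> dessin_set n \<longleftrightarrow> z \<in> dessin_set n"
  by (simp add: upper_fold_def dessin_set_cnj)

lemma dessin_up_fold: "upper_fold z \<in> dessin_up n \<longleftrightarrow> z \<in> dessin_set n"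
  by (simp add: dessin_up_def dessin_set_fold Im_upper_fold)

lemma dessin_up_Suc: "z \<in> dessin_up (Suc n) \<longleftrightarrow> z \<noteq> 0 \<and> Im z \<ge> 0 \<and> upper_fold (hess_map z) \<in> dessin_up n"
  by (auto simp: dessin_up_fold) (auto simp: dessin_up_def)

lemma compact_dessin_set: "compact (dessin_set n)"
proof (induction n)
  case 0
  have "{z. seg01 z} = of_real ` {0..1}" by (force simp: seg01_def image_iff complex_eq_iff)
  thus ?case by (auto intro!: compact_continuous_image continuous_intros)
next
  case (Suc n)
  thus ?case by (simp add: compact_hess_preimage)
qed

lemma compact_dessin_up: "compact (dessin_up n)"
proof -
  have "dessin_up n = dessin_set n \<inter> {z. Im z \<ge> 0}" by (auto simp: dessin_up_def)
  thus ?thesis using compact_dessin_set closed_halfspace_Im_ge[of 0] by (simp add: compact_Int_closed)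
qed

text \<open>On the common boundary of two regions the choice is arbitrary, which \<open>bary_of_region\<close> justifies.\<close>

definition tile_of :: "complex \<Rightarrow> tile" where
  "tile_of z = (if quartic z \<le> 0 then T2 else if cmod z \<le> 4 then T1 else T3)"

lemma tile_of: "z \<noteq> 0 \<Longrightarrow> Im z \<ge> 0 \<Longrightarrow> z \<in> region (tile_of z)"
  by (auto simp: tile_of_def)

text \<open>The point of $\Phi_n$ with the same itinerary as \<open>z\<close>: the regions visited by the folded orbit of
\<open>z\<close> tell which inverse branches of $H_{PL}$ to apply to a point of $[0,1]$.\<close>

fun bary_of :: "nat \<Rightarrow> complex \<Rightarrow> bary" where
  "bary_of 0 z = edge_pt (Re z)"
| "bary_of (Suc n) z = tile_map (tile_of z) (bary_of n (upper_fold (hess_map z)))"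

text \<open>That sides correspond to sides is what keeps the induction going: it makes the pieces of the
next map fit together.\<close>

lemma bary_of_props:
  assumes "z \<in> dessin_up n"
  shows "bary_of n z \<in> Phi_bary n" "side01 (bary_of n z) \<longleftrightarrow> seg01 z" "side1i (bary_of n z) \<longleftrightarrow> seg1i z" "sidei0 (bary_of n z) \<longleftrightarrow> segi0 z"
proof -
  have "bary_of n z \<in> Phi_bary n \<and> (side01 (bary_of n z) \<longleftrightarrow> seg01 z) \<and> (side1i (bary_of n z) \<longleftrightarrow> seg1i z) \<and> (sidei0 (bary_of n z) \<longleftrightarrow> segi0 z)"
    using assms
  proof (induction n arbitrary: z)
    case 0
    thus ?case
      by (auto simp: dessin_up_def seg01_def seg1i_def segi0_def side01_def side1i_def sidei0_def edge_pt_def std_simplex_def)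
  next
    case (Suc n)
    define w where "w = upper_fold (hess_map z)"
    define t where "t = tile_of z"
    have w: "w \<in> dessin_up n" and z: "z \<in> region t" using Suc.prems tile_of by (auto simp: dessin_up_Suc w_def t_def)
    note IH = Suc.IH[OF w]
    have l: "bary_of n w \<in> std_simplex" using IH Phi_bary_subset by blast
    note S = hess_sides[OF z]
    note w_on = upper_fold_seg[of "hess_map z", folded w_def]
    have "tile_map t (bary_of n w) \<in> Phi_bary (Suc n)" using IH by auto
    moreover have "(side01 (tile_map t (bary_of n w)) \<longleftrightarrow> seg01 z) \<and> (side1i (tile_map t (bary_of n w)) \<longleftrightarrow> seg1i z) \<and> (sidei0 (tile_map t (bary_of n w)) \<longleftrightarrow> segi0 z)"
    proof -
      have nb: "\<not> (seg1i (hess_map z) \<and> segi0 (hess_map z))" by (auto simp: seg1i_def segi0_def)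
      note simps = tile_map_sides[OF l] IH w_on nb
      show ?thesis
      proof (cases t)
        case T1
        show ?thesis unfolding T1 using S(1-3)[OF T1] nb by (auto simp only: simps)
      next
        case T2
        show ?thesis unfolding T2 using S(4-6)[OF T2] nb by (auto simp only: simps)
      next
        case T3
        show ?thesis unfolding T3 using S(7-9)[OF T3] nb by (auto simp only: simps)
      qed
    qed
    ultimately show ?case by (simp add: w_def[symmetric] t_def[symmetric])
  qed
  thus "bary_of n z \<in> Phi_bary n" "side01 (bary_of n z) \<longleftrightarrow> seg01 z" "side1i (bary_of n z) \<longleftrightarrow> seg1i z" "sidei0 (bary_of n z) \<longleftrightarrow> segi0 z"
    by auto
qed

lemma bary_of_simplex: "z \<in> dessin_up n \<Longrightarrow> bary_of n z \<in> std_simplex"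
  using bary_of_props(1) Phi_bary_subset by blast

text \<open>The inverse branches agree wherever the regions meet, so the choice of region does not matter.\<close>

lemma tile_map_glue:
  assumes z: "z \<in> region s" "z \<in> region t" and l: "l \<in> std_simplex"
    and sides: "side01 l \<longleftrightarrow> seg01 (hess_map z)" "sidei0 l \<longleftrightarrow> segi0 (hess_map z)"
  shows "tile_map s l = tile_map t l"
proof -
  have 12: "tile_map T1 l = tile_map T2 l" if "z \<in> region T1" "z \<in> region T2"
    using hess_sides(12)[OF that(1) refl that(2)] tile_map_eq_iff(2)[OF l l] sides by blast
  have 23: "tile_map T2 l = tile_map T3 l" if "z \<in> region T2" "z \<in> region T3"
    using hess_sides(13)[OF that(1) refl that(2)] tile_map_eq_iff(3)[OF l l] sides by blast
  have 13: "tile_map T1 l = tile_map T3 l" if "z \<in> region T1" "z \<in> region T3"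
    using hess_sides(14)[OF that(1) refl that(2)] tile_map_eq_iff(4)[OF l l] sides by blast
  show ?thesis using z 12 23 13 by (cases s; cases t; metis)
qed

text \<open>Conversely, different regions yield equal values only at points whose image lies on a side that
these regions share with the middle one; injectivity on the middle region then applies.\<close>

lemma tile_map_cross:
  assumes z: "z \<in> region s" "z' \<in> region t" and l: "l \<in> std_simplex" and ne: "s \<noteq> t"
    and sides: "side01 l \<longleftrightarrow> seg01 (hess_map z)" "sidei0 l \<longleftrightarrow> segi0 (hess_map z)"
      "side01 l \<longleftrightarrow> seg01 (hess_map z')" "sidei0 l \<longleftrightarrow> segi0 (hess_map z')"
    and eq: "tile_map s l = tile_map t l"
  shows "z \<in> region T2 \<and> z' \<in> region T2"
proof -
  have 1: "x \<in> region T2" if "x \<in> region T1" "segi0 (hess_map x)" for x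
    using hess_sides(10)[OF that(1) refl that(2)] .
  have 3: "x \<in> region T2" if "x \<in> region T3" "seg01 (hess_map x)" for x
    using hess_sides(11)[OF that(1) refl that(2)] .
  have 12: "sidei0 l" if "tile_map T1 l = tile_map T2 l" using tile_map_eq_iff(2)[OF l l] that by blast
  have 23: "side01 l" if "tile_map T2 l = tile_map T3 l" using tile_map_eq_iff(3)[OF l l] that by blast
  have 13: "side01 l \<and> sidei0 l" if "tile_map T1 l = tile_map T3 l" using tile_map_eq_iff(4)[OF l l] that by blast
  show ?thesis using z ne eq sides 1 3 12 23 13 by (cases s; cases t; metis)
qed

lemma bary_of_region:
  assumes "z \<in> dessin_up (Suc n)" "z \<in> region t"
  shows "bary_of (Suc n) z = tile_map t (bary_of n (upper_fold (hess_map z)))"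
proof -
  define w where "w = upper_fold (hess_map z)"
  have w: "w \<in> dessin_up n" using assms by (auto simp: dessin_up_Suc w_def)
  have l: "bary_of n w \<in> std_simplex" by (rule bary_of_simplex[OF w])
  note P = bary_of_props[OF w]
  note w_on = upper_fold_seg[of "hess_map z", folded w_def]
  define s where "s = tile_of z"
  have s: "z \<in> region s" using assms tile_of by (auto simp: dessin_up_Suc s_def)
  have "tile_map s (bary_of n w) = tile_map t (bary_of n w)"
    by (rule tile_map_glue[OF s assms(2) l]) (simp_all add: P w_on)
  thus ?thesis by (simp add: s_def w_def)
qed

lemma bary_of_inj: "inj_on (bary_of n) (dessin_up n)"
proof (induction n)
  case 0
  show ?case by (auto simp: inj_on_def edge_pt_def dessin_up_def seg01_def complex_eq_iff)
next
  case (Suc n)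
  show ?case
  proof (rule inj_onI)
    fix z z' assume z: "z \<in> dessin_up (Suc n)" and z': "z' \<in> dessin_up (Suc n)" and eq: "bary_of (Suc n) z = bary_of (Suc n) z'"
    define w w' where "w = upper_fold (hess_map z)" and "w' = upper_fold (hess_map z')"
    have w: "w \<in> dessin_up n" "w' \<in> dessin_up n" using z z' by (auto simp: dessin_up_Suc w_def w'_def)
    note l = bary_of_simplex[OF w(1)] bary_of_simplex[OF w(2)]
    have t: "z \<in> region (tile_of z)" "z' \<in> region (tile_of z')" using z z' tile_of by (auto simp: dessin_up_Suc)
    have eq': "tile_map (tile_of z) (bary_of n w) = tile_map (tile_of z') (bary_of n w')" using eq by (simp add: w_def w'_def)
    have "bary_of n w = bary_of n w'" using eq' word_map_inj[of "[tile_of z]" "[tile_of z']" "bary_of n w" "bary_of n w'"] l by simp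
    hence ww: "w = w'" using Suc.IH w by (auto dest: inj_onD)
    note E = tile_map_eq_iff[OF l(1) l(1)]
    note P = bary_of_props[OF w(1)]
    note w_on = upper_fold_seg[of "hess_map z", folded w_def]
    note w_on' = upper_fold_seg[of "hess_map z'", folded w'_def, folded ww]
    have eq2: "tile_map (tile_of z) (bary_of n w) = tile_map (tile_of z') (bary_of n w)" using eq' ww by simp
    show "z = z'"
    proof (cases "tile_of z = tile_of z'")
      case True
      thus ?thesis using region_inj[OF t(1)] t ww by (simp add: w_def w'_def)
    next
      case False
      have "z \<in> region T2 \<and> z' \<in> region T2"
        by (rule tile_map_cross[OF t l(1) False _ _ _ _ eq2]) (use P w_on w_on' in metis)+
      thus ?thesis using region_inj[of z T2 z'] ww by (simp add: w_def w'_def)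
    qed
  qed
qed

lemma bary_of_lift:
  assumes "w \<in> dessin_up n"
  obtains z where "z \<in> dessin_up (Suc n)" "z \<in> region t" "upper_fold (hess_map z) = w" "bary_of (Suc n) z = tile_map t (bary_of n w)"
proof -
  have "Im w \<ge> 0" using assms by (simp add: dessin_up_def)
  then obtain z where z: "z \<in> region t" "upper_fold (hess_map z) = w" using region_surj by blast
  have "z \<in> dessin_up (Suc n)" using z assms regionD[OF z(1)] by (simp add: dessin_up_Suc)
  thus ?thesis using that z bary_of_region by metis
qed

lemma bary_of_image: "bary_of n ` dessin_up n = Phi_bary n"
proof (induction n)
  case 0
  have "l \<in> bary_of 0 ` dessin_up 0" if l: "l \<in> Phi_bary 0" for l
  proof -
    obtain a b c where c: "l = (a, b, c)" by (cases l)
    have "l = edge_pt b" "0 \<le> b" "b \<le> 1" using l by (auto simp: c side01_def std_simplex_def edge_pt_def)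
    thus ?thesis by (intro image_eqI[of _ _ "of_real b"]) (auto simp: dessin_up_def seg01_def)
  qed
  thus ?case using bary_of_props(1) by blast
next
  case (Suc n)
  have "l \<in> bary_of (Suc n) ` dessin_up (Suc n)" if l: "l \<in> Phi_bary (Suc n)" for l
  proof -
    obtain t m where m: "m \<in> Phi_bary n" "l = tile_map t m" using l by auto
    then obtain w where w: "w \<in> dessin_up n" "m = bary_of n w" using Suc by blast
    show ?thesis using bary_of_lift[OF w(1), of t] m w by (metis imageI)
  qed
  thus ?case using bary_of_props(1) by blast
qed

lemma continuous_on_bary_of: "continuous_on (dessin_up n) (bary_of n)"
proof (induction n)
  case 0
  show ?case unfolding bary_of.simps edge_pt_def by (intro continuous_intros)
next
  case (Suc n)
  have cl: "closed (dessin_up (Suc n) \<inter> region t)" and co: "continuous_on (dessin_up (Suc n) \<inter> region t) (bary_of (Suc n))" for t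
  proof -
    obtain S where S: "closed S" "region t = S - {0}" using region_closed_in by blast
    have "0 \<notin> dessin_up (Suc n)" by (simp add: dessin_up_Suc)
    hence e: "dessin_up (Suc n) \<inter> region t = dessin_up (Suc n) \<inter> S" using S(2) by blast
    show "closed (dessin_up (Suc n) \<inter> region t)"
      unfolding e by (rule closed_Int[OF compact_imp_closed[OF compact_dessin_up] S(1)])
    have "continuous_on (dessin_up (Suc n) \<inter> region t) (\<lambda>z. tile_map t (bary_of n (upper_fold (hess_map z))))"
      by (intro continuous_on_tile_map continuous_on_compose2[OF Suc] continuous_intros) (auto simp: dessin_up_Suc)
    thus "continuous_on (dessin_up (Suc n) \<inter> region t) (bary_of (Suc n))"
      by (rule continuous_on_eq) (blast intro: bary_of_region[symmetric])
  qed
  have "dessin_up (Suc n) = (dessin_up (Suc n) \<inter> region T1) \<union> (dessin_up (Suc n) \<inter> region T2) \<union> (dessin_up (Suc n) \<inter> region T3)"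
    (is "_ = ?A \<union> ?B \<union> ?C")
  proof -
    have "z \<in> ?A \<union> ?B \<union> ?C" if z: "z \<in> dessin_up (Suc n)" for z
    proof -
      have "z \<in> region (tile_of z)" using z by (intro tile_of) (simp_all add: dessin_up_Suc)
      thus ?thesis using z by (cases "tile_of z") (simp_all del: region.simps)
    qed
    thus ?thesis by blast
  qed
  moreover have "continuous_on (?A \<union> ?B \<union> ?C) (bary_of (Suc n))"
    by (intro continuous_on_closed_Un closed_Un cl co)
  ultimately show ?case by simp
qed

definition dessin_pt :: "nat \<Rightarrow> bary \<Rightarrow> complex" where "dessin_pt n = inv_into (dessin_up n) (bary_of n)"

lemma dessin_pt: "l \<in> Phi_bary n \<Longrightarrow> dessin_pt n l \<in> dessin_up n" "l \<in> Phi_bary n \<Longrightarrow> bary_of n (dessin_pt n l) = l"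
  unfolding dessin_pt_def bary_of_image[symmetric] by (auto intro: inv_into_into f_inv_into_f)

lemma dessin_pt_bary_of: "z \<in> dessin_up n \<Longrightarrow> dessin_pt n (bary_of n z) = z"
  unfolding dessin_pt_def by (rule inv_into_f_f[OF bary_of_inj])

lemma Phi_bary_tile_map: "l \<in> Phi_bary n \<Longrightarrow> tile_map t l \<in> Phi_bary (Suc n)" by auto

lemma Phi_bary_word_map: "l \<in> Phi_bary k \<Longrightarrow> word_map w l \<in> Phi_bary (length w + k)"
  by (induction w) (auto simp del: Phi_bary.simps(2) intro: Phi_bary_tile_map)

lemma dessin_pt_tile_map:
  assumes "l \<in> Phi_bary n"
  shows "dessin_pt (Suc n) (tile_map t l) \<in> region t" "hess_map (dessin_pt (Suc n) (tile_map t l)) = conj_unless (preserves_sides t) (dessin_pt n l)"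
proof -
  obtain z where z: "z \<in> dessin_up (Suc n)" "z \<in> region t" "upper_fold (hess_map z) = dessin_pt n l" "bary_of (Suc n) z = tile_map t (bary_of n (dessin_pt n l))"
    using bary_of_lift[OF dessin_pt(1)[OF assms]] by blast
  hence "dessin_pt (Suc n) (tile_map t l) = z" using dessin_pt_bary_of[OF z(1)] dessin_pt(2)[OF assms] by simp
  thus "dessin_pt (Suc n) (tile_map t l) \<in> region t" "hess_map (dessin_pt (Suc n) (tile_map t l)) = conj_unless (preserves_sides t) (dessin_pt n l)"
    using z hess_map_region[OF z(2)] by simp_all
qed

lemma hess_iter_conj: "(hess_map ^^ m) (conj_unless b z) = conj_unless b ((hess_map ^^ m) z)"
  by (induction m) (auto simp: conj_unless_def hess_map_cnj)

lemma conj_unless_conj_unless: "conj_unless a (conj_unless b z) = conj_unless (a = b) z"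
  by (auto simp: conj_unless_def)

text \<open>Folding replaces the iterate by its conjugate at every step that reverses the sides, so unfolding
produces the sign of the word.\<close>

lemma dessin_pt_word_map:
  assumes "l \<in> Phi_bary k"
  shows "(hess_map ^^ length w) (dessin_pt (length w + k) (word_map w l)) = conj_unless (word_sign w) (dessin_pt k l)"
proof (induction w)
  case (Cons t w)
  have "(hess_map ^^ length (t # w)) (dessin_pt (length (t # w) + k) (word_map (t # w) l))
      = (hess_map ^^ length w) (hess_map (dessin_pt (Suc (length w + k)) (tile_map t (word_map w l))))"
    by (simp add: funpow_swap1)
  also have "\<dots> = conj_unless (word_sign (t # w)) (dessin_pt k l)"
    unfolding dessin_pt_tile_map(2)[OF Phi_bary_word_map[OF assms]] hess_iter_conj Cons conj_unless_conj_unless by simp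
  finally show ?case .
qed (simp add: conj_unless_def)

lemma dessin_pt_real_iff: "l \<in> Phi_bary n \<Longrightarrow> Im (dessin_pt n l) = 0 \<longleftrightarrow> side01 l \<or> side1i l \<or> sidei0 l"
  using bary_of_props(2-)[OF dessin_pt(1), of l n] dessin_pt(2)[of l n] by (auto simp: seg01_def seg1i_def segi0_def)

lemma dessin_pt_edge_pt: "0 \<le> e \<Longrightarrow> e \<le> 1 \<Longrightarrow> dessin_pt 0 (edge_pt e) = of_real e"
  using dessin_pt_bary_of[of "of_real e" 0] by (simp add: dessin_up_def seg01_def)

section \<open>The triangle in the plane\<close>

locale frame =
  fixes p0 p1 pinf :: complex
  assumes noncollinear: "\<not> collinear {p0, p1, pinf}"
begin

abbreviation "T \<equiv> triangle p0 p1 pinf"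

definition point :: "bary \<Rightarrow> complex" where
  "point l = fst l *\<^sub>R p0 + fst (snd l) *\<^sub>R p1 + snd (snd l) *\<^sub>R pinf"

definition area :: real where "area = Im (cnj (p1 - p0) * (pinf - p0))"

lemma area_nonzero: "area \<noteq> 0"
proof
  assume a: "area = 0"
  define u v where "u = p1 - p0" and "v = pinf - p0"
  have "collinear {0, u, v}"
  proof (cases "u = 0")
    case False
    define c where "c = Re (cnj u * v) / cmod u ^ 2"
    have "cnj u * v = of_real (Re (cnj u * v))" using a by (simp add: area_def u_def v_def complex_eq_iff)
    hence "of_real (cmod u ^ 2) * v = u * of_real (Re (cnj u * v))"
      by (metis complex_norm_square mult.assoc mult.left_commute)
    hence "v = c *\<^sub>R u" using False by (simp add: c_def scaleR_conv_of_real field_simps)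
    thus ?thesis by (auto simp: collinear_lemma)
  qed (simp add: collinear_lemma)
  hence "collinear {0, p1 - p0, pinf - p0}" unfolding u_def v_def .
  hence "collinear {p1, p0, pinf}" by (subst collinear_3) (simp_all add: NO_MATCH_def)
  thus False using noncollinear by (simp add: insert_commute)
qed

lemma point_diff:
  assumes "fst l + fst (snd l) + snd (snd l) = fst m + fst (snd m) + snd (snd m)"
  shows "point m - point l = (fst (snd m) - fst (snd l)) *\<^sub>R (p1 - p0) + (snd (snd m) - snd (snd l)) *\<^sub>R (pinf - p0)"
proof -
  have "point k = (fst k + fst (snd k) + snd (snd k)) *\<^sub>R p0 + fst (snd k) *\<^sub>R (p1 - p0) + snd (snd k) *\<^sub>R (pinf - p0)" for k
    by (simp add: point_def algebra_simps)
  thus ?thesis using assms by (simp add: scaleR_diff_left)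
qed

lemma simplex_sum: "l \<in> std_simplex \<Longrightarrow> fst l + fst (snd l) + snd (snd l) = 1"
  by (auto simp: std_simplex_def)

lemma point_eq_iff:
  assumes "l \<in> std_simplex" "m \<in> std_simplex"
  shows "point l = point m \<longleftrightarrow> l = m"
proof
  assume eq: "point l = point m"
  define \<alpha> \<beta> where "\<alpha> = fst (snd m) - fst (snd l)" and "\<beta> = snd (snd m) - snd (snd l)"
  have "\<alpha> *\<^sub>R (p1 - p0) + \<beta> *\<^sub>R (pinf - p0) = 0"
    using point_diff[of l m] eq simplex_sum[OF assms(1)] simplex_sum[OF assms(2)] by (simp add: \<alpha>_def \<beta>_def)
  hence z: "Im (cnj (p1 - p0) * (\<alpha> *\<^sub>R (p1 - p0) + \<beta> *\<^sub>R (pinf - p0))) = 0"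
     "Im (cnj (pinf - p0) * (\<alpha> *\<^sub>R (p1 - p0) + \<beta> *\<^sub>R (pinf - p0))) = 0" by simp_all
  have "Im (cnj (p1 - p0) * (\<alpha> *\<^sub>R (p1 - p0) + \<beta> *\<^sub>R (pinf - p0))) = \<beta> * area"
    "Im (cnj (pinf - p0) * (\<alpha> *\<^sub>R (p1 - p0) + \<beta> *\<^sub>R (pinf - p0))) = - \<alpha> * area"
    by (simp_all add: area_def algebra_simps)
  hence "\<beta> * area = 0" "- \<alpha> * area = 0" using z by (simp_all only:)
  hence "\<alpha> = 0" "\<beta> = 0" using area_nonzero by auto
  thus "l = m" using simplex_sum[OF assms(1)] simplex_sum[OF assms(2)]
    by (cases l; cases m) (auto simp: \<alpha>_def \<beta>_def)
qed simp

lemma point_bary_det: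
  assumes "l \<in> std_simplex" "m \<in> std_simplex" "n \<in> std_simplex"
  shows "Im (cnj (point m - point l) * (point n - point l)) = bary_det l m n * area"
proof -
  obtain l0 l1 li where l: "l = (l0, l1, li)" by (cases l)
  obtain m0 m1 mi where m: "m = (m0, m1, mi)" by (cases m)
  obtain n0 n1 ni where n: "n = (n0, n1, ni)" by (cases n)
  have s: "l0 = 1 - l1 - li" "m0 = 1 - m1 - mi" "n0 = 1 - n1 - ni"
    using assms by (auto simp: std_simplex_def l m n)
  define u v where "u = p1 - p0" and "v = pinf - p0"
  have d: "point m - point l = (m1 - l1) *\<^sub>R u + (mi - li) *\<^sub>R v" "point n - point l = (n1 - l1) *\<^sub>R u + (ni - li) *\<^sub>R v"
    using point_diff[of l m] point_diff[of l n] assms[THEN simplex_sum] by (simp_all add: l m n u_def v_def)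
  have "Im (cnj (point m - point l) * (point n - point l)) = ((m1 - l1) * (ni - li) - (mi - li) * (n1 - l1)) * Im (cnj u * v)"
    unfolding d by (simp add: algebra_simps)
  also have "(m1 - l1) * (ni - li) - (mi - li) * (n1 - l1) = bary_det l m n"
    by (simp add: bary_det_def l m n s algebra_simps)
  finally show ?thesis by (simp add: area_def u_def v_def)
qed

lemma point_mix: "point (mix e l m) = (1 - e) *\<^sub>R point l + e *\<^sub>R point m"
  by (simp add: point_def mix_def algebra_simps)

lemma continuous_on_point: "continuous_on A point"
  unfolding point_def by (intro continuous_intros)

lemma point_image: "point ` std_simplex = T"
proof -
  have "T = {u *\<^sub>R p0 + v *\<^sub>R p1 + w *\<^sub>R pinf | u v w. 0 \<le> u \<and> 0 \<le> v \<and> 0 \<le> w \<and> u + v + w = 1}"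
    by (simp add: triangle_def convex_hull_3)
  also have "\<dots> = point ` std_simplex"
    by (force simp: std_simplex_def point_def image_iff)
  finally show ?thesis ..
qed

lemma closed_T: "closed T"
  unfolding triangle_def by (intro compact_imp_closed finite_imp_compact_convex_hull) simp

lemma frontier_T:
  assumes "l \<in> std_simplex"
  shows "point l \<in> frontier T \<longleftrightarrow> side01 l \<or> side1i l \<or> sidei0 l"
proof -
  have int: "interior T = {v. \<exists>x y z. 0 < x \<and> 0 < y \<and> 0 < z \<and> x + y + z = 1 \<and> x *\<^sub>R p0 + y *\<^sub>R p1 + z *\<^sub>R pinf = v}"
    unfolding triangle_def by (rule interior_convex_hull_3_minimal[OF noncollinear]) simp
  have "point l \<in> interior T \<longleftrightarrow> fst l > 0 \<and> fst (snd l) > 0 \<and> snd (snd l) > 0"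
  proof
    assume "point l \<in> interior T"
    then obtain x y z where x: "0 < x" "0 < y" "0 < z" "x + y + z = 1" "x *\<^sub>R p0 + y *\<^sub>R p1 + z *\<^sub>R pinf = point l"
      unfolding int by blast
    hence "(x, y, z) \<in> std_simplex" "point (x, y, z) = point l" by (auto simp: std_simplex_def point_def)
    hence "l = (x, y, z)" using point_eq_iff[of "(x, y, z)" l] assms by simp
    thus "fst l > 0 \<and> fst (snd l) > 0 \<and> snd (snd l) > 0" using x by simp
  next
    assume "fst l > 0 \<and> fst (snd l) > 0 \<and> snd (snd l) > 0"
    thus "point l \<in> interior T" unfolding int using simplex_sum[OF assms] unfolding point_def by blast
  qed
  moreover have "point l \<in> frontier T \<longleftrightarrow> point l \<notin> interior T"
    using assms point_image closed_T by (auto simp: frontier_def)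
  ultimately show ?thesis using assms
    by (cases l) (auto simp: std_simplex_def side01_def side1i_def sidei0_def)
qed

end

section \<open>The piecewise-linear map and its graph\<close>

lemma affine_map_on_triangle:
  assumes "affine_map_on (triangle x y z) F" "0 \<le> a" "0 \<le> b" "0 \<le> c" "a + b + c = 1"
  shows "F (a *\<^sub>R x + b *\<^sub>R y + c *\<^sub>R z) = a *\<^sub>R F x + b *\<^sub>R F y + c *\<^sub>R F z"
proof (cases "c = 1")
  case True
  hence "a = 0" "b = 0" using assms by auto
  thus ?thesis using True by simp
next
  case False
  define t where "t = b / (1 - c)"
  have c: "1 - c > 0" "1 - c = a + b" using False assms by auto
  have t: "t \<in> {0..1}" "(1 - c) * t = b" using c assms by (auto simp: t_def)
  have "(1 - c) * (1 - t) = (1 - c) - (1 - c) * t" by (simp add: algebra_simps)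
  hence t': "(1 - c) * (1 - t) = a" using c(2) t(2) by simp
  define q where "q = (1 - t) *\<^sub>R x + t *\<^sub>R y"
  have v: "x \<in> triangle x y z" "y \<in> triangle x y z" "z \<in> triangle x y z"
    unfolding triangle_def by (auto intro: hull_inc)
  have q: "q \<in> triangle x y z" unfolding q_def
    using convexD_alt[of "triangle x y z" x y t] v t by (simp add: triangle_def)
  have Fq: "F q = (1 - t) *\<^sub>R F x + t *\<^sub>R F y" unfolding q_def
    using assms(1) v t unfolding affine_map_on_def by blast
  have r: "(1 - c) *\<^sub>R ((1 - t) *\<^sub>R x' + t *\<^sub>R y') = a *\<^sub>R x' + b *\<^sub>R y'" for x' y' :: complex
    using t t' by (simp add: scaleR_add_right)
  have "F ((1 - c) *\<^sub>R q + c *\<^sub>R z) = (1 - c) *\<^sub>R F q + c *\<^sub>R F z"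
    using assms(1)[unfolded affine_map_on_def, rule_format, of q z c] v q c assms(4) by simp
  thus ?thesis unfolding Fq unfolding q_def r .
qed

locale pl_model = frame +
  fixes F :: "complex \<Rightarrow> complex"
  assumes is_H_PL: "is_H_PL p0 p1 pinf F"
begin

lemma F_tile_map:
  assumes "l \<in> std_simplex"
  shows "F (point (tile_map t l)) = point l"
proof -
  obtain x y z where l: "l = (x, y, z)" by (cases l)
  have s: "0 \<le> x" "0 \<le> y" "0 \<le> z" "x + y + z = 1" using assms by (auto simp: std_simplex_def l)
  define a b where "a = midpoint p0 pinf" and "b = midpoint p1 pinf"
  note H = is_H_PL[unfolded is_H_PL_def Let_def, folded a_def b_def]
  have a: "r *\<^sub>R a = (r/2) *\<^sub>R p0 + (r/2) *\<^sub>R pinf" and b: "r *\<^sub>R b = (r/2) *\<^sub>R p1 + (r/2) *\<^sub>R pinf" for r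
    by (simp_all add: a_def b_def midpoint_def scaleR_add_right)
  show ?thesis
  proof (cases t)
    case T1
    have "point (tile_map t l) = z *\<^sub>R p0 + y *\<^sub>R p1 + x *\<^sub>R b" unfolding b by (simp add: point_def l T1 algebra_simps)
    thus ?thesis using affine_map_on_triangle[of p0 p1 b F z y x] H s by (simp add: point_def l)
  next
    case T2
    have "point (tile_map t l) = z *\<^sub>R p0 + y *\<^sub>R a + x *\<^sub>R b" unfolding a b by (simp add: point_def l T2 algebra_simps)
    thus ?thesis using affine_map_on_triangle[of p0 a b F z y x] H s by (simp add: point_def l)
  next
    case T3
    have "point (tile_map t l) = y *\<^sub>R a + x *\<^sub>R b + z *\<^sub>R pinf" unfolding a b by (simp add: point_def l T3 algebra_simps)
    thus ?thesis using affine_map_on_triangle[of a b pinf F y x z] H s by (simp add: point_def l)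
  qed
qed

lemma F_word_map: "l \<in> std_simplex \<Longrightarrow> (F ^^ length w) (point (word_map w l)) = point l"
  by (induction w) (simp_all add: F_tile_map word_map_simplex funpow_swap1)

lemma simplex_words: "l \<in> std_simplex \<Longrightarrow> \<exists>w m. length w = n \<and> m \<in> std_simplex \<and> l = word_map w m"
proof (induction n arbitrary: l)
  case (Suc n)
  obtain t k where k: "k \<in> std_simplex" "l = tile_map t k" using simplex_cover[OF Suc.prems] by blast
  obtain w m where "length w = n" "m \<in> std_simplex" "k = word_map w m" using Suc.IH[OF k(1)] by blast
  thus ?case using k by (intro exI[of _ "t # w"] exI[of _ m]) simp
qed auto

lemma point_edge_pt: "point (edge_pt e) = (1 - e) *\<^sub>R p0 + e *\<^sub>R p1"
  by (simp add: point_def edge_pt_def)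

lemma edge_pt_mix: "edge_pt e = mix e (edge_pt 0) (edge_pt 1)"
  by (simp add: mix_def edge_pt_def)

lemma point_vertices: "point (1,0,0) = p0" "point (0,1,0) = p1" "point (0,0,1) = pinf"
  by (simp_all add: point_def)

text \<open>In one direction, a point of an edge that is mapped onto $[0,1]$ lies in some triangle of
$\mathcal{T}_n$, where its coordinates can be read off. In the other direction, the inverse branch
along a word takes the segment $[0,1]$ to an edge: its interior contains no vertices because the
iterate undoes the branch.\<close>

lemma Phi_eq: "Phi p0 p1 pinf F n = point ` Phi_bary n"
proof
  show "Phi p0 p1 pinf F n \<subseteq> point ` Phi_bary n"
  proof
    fix z assume "z \<in> Phi p0 p1 pinf F n"
    then obtain e where e: "e \<in> PL_edges p0 p1 pinf F n" "(F ^^ n) ` e = closed_segment p0 p1" "z \<in> e"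
      unfolding Phi_def by blast
    have "e \<subseteq> T" using e(1) by (auto simp: PL_edges_def PL_skeleton_def)
    then obtain l where l: "l \<in> std_simplex" "z = point l" using e(3) point_image by blast
    obtain w m where m: "length w = n" "m \<in> std_simplex" "l = word_map w m" using simplex_words[OF l(1)] by blast
    have "(F ^^ n) z = point m" using F_word_map[OF m(2), of w] m l by simp
    hence "point m \<in> closed_segment p0 p1" using e(2,3) by (metis imageI)
    then obtain r where r: "0 \<le> r" "r \<le> 1" "point m = (1 - r) *\<^sub>R p0 + r *\<^sub>R p1"
      unfolding closed_segment_def by blast
    hence "point m = point (edge_pt r)" by (simp add: point_edge_pt)
    hence "m = edge_pt r" using point_eq_iff m(2) edge_pt_simplex r by blast
    hence "l \<in> word_map w ` edge_pt ` {0..1}" using m r by auto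
    hence "l \<in> Phi_bary n" unfolding Phi_bary_words using m(1) by blast
    thus "z \<in> point ` Phi_bary n" using l by blast
  qed
  show "point ` Phi_bary n \<subseteq> Phi p0 p1 pinf F n"
  proof
    fix z assume "z \<in> point ` Phi_bary n"
    then obtain w r where w: "length w = n" "0 \<le> r" "r \<le> 1" "z = point (word_map w (edge_pt r))"
      unfolding Phi_bary_words by auto
    define e where "e = (\<lambda>s. point (word_map w (edge_pt s))) ` {0..1}"
    define x y where "x = point (word_map w (edge_pt 0))" and "y = point (word_map w (edge_pt 1))"
    have Jx: "point (word_map w (edge_pt s)) = (1 - s) *\<^sub>R x + s *\<^sub>R y" for s
      by (subst edge_pt_mix) (simp add: word_map_mix point_mix x_def y_def)
    have es: "e = closed_segment x y" unfolding e_def Jx closed_segment_image_interval ..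
    have FF: "(F ^^ n) (point (word_map w (edge_pt s))) = point (edge_pt s)" if "0 \<le> s" "s \<le> 1" for s
      using F_word_map[OF edge_pt_simplex[OF that], of w] w by simp
    have mem: "point (word_map w (edge_pt s)) \<in> T" if "0 \<le> s" "s \<le> 1" for s
      using point_image edge_pt_simplex[OF that] word_map_simplex by blast
    have vert: "point (edge_pt s) \<in> {p0, p1, pinf} \<longleftrightarrow> s = 0 \<or> s = 1" if "0 \<le> s" "s \<le> 1" for s
    proof -
      have S: "(1,0,0) \<in> std_simplex" "(0,1,0) \<in> std_simplex" "(0,0,1) \<in> std_simplex" by (auto simp: std_simplex_def)
      have "point (edge_pt s) = p0 \<longleftrightarrow> edge_pt s = (1,0,0)" "point (edge_pt s) = p1 \<longleftrightarrow> edge_pt s = (0,1,0)"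
        "point (edge_pt s) = pinf \<longleftrightarrow> edge_pt s = (0,0,1)"
        using point_eq_iff[OF edge_pt_simplex[OF that] S(1)] point_eq_iff[OF edge_pt_simplex[OF that] S(2)]
          point_eq_iff[OF edge_pt_simplex[OF that] S(3)] unfolding point_vertices by auto
      thus ?thesis by (auto simp: edge_pt_def)
    qed
    have PV: "point (word_map w (edge_pt s)) \<in> PL_vertices p0 p1 pinf F n \<longleftrightarrow> s = 0 \<or> s = 1" if "0 \<le> s" "s \<le> 1" for s
      unfolding PL_vertices_def using mem[OF that] FF[OF that] vert[OF that] by simp
    have "x \<in> PL_vertices p0 p1 pinf F n" "y \<in> PL_vertices p0 p1 pinf F n"
      using PV[of 0] PV[of 1] by (simp_all add: x_def y_def)
    moreover have "x \<noteq> y"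
    proof
      assume "x = y"
      hence "point (edge_pt 0) = point (edge_pt 1)" using FF[of 0] FF[of 1] by (simp add: x_def y_def)
      hence "edge_pt 0 = edge_pt 1" by (subst (asm) point_eq_iff) (auto intro: edge_pt_simplex)
      thus False by (simp add: edge_pt_def)
    qed
    moreover have "closed_segment x y \<subseteq> PL_skeleton p0 p1 pinf F n"
    proof -
      have "point (edge_pt s) \<in> frontier T" if "0 \<le> s" "s \<le> 1" for s
        using frontier_T[OF edge_pt_simplex[OF that]] by (simp add: side01_def edge_pt_def)
      thus ?thesis unfolding es[symmetric] e_def PL_skeleton_def using mem FF by auto
    qed
    moreover have "open_segment x y \<inter> PL_vertices p0 p1 pinf F n = {}"
    proof -
      have "q \<notin> PL_vertices p0 p1 pinf F n" if q: "q \<in> open_segment x y" for q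
      proof -
        obtain s where s: "0 < s" "s < 1" "q = (1 - s) *\<^sub>R x + s *\<^sub>R y" using q by (auto simp: in_segment)
        hence "q = point (word_map w (edge_pt s))" by (simp add: Jx)
        thus ?thesis using PV[of s] s by auto
      qed
      thus ?thesis by blast
    qed
    ultimately have "e \<in> PL_edges p0 p1 pinf F n" unfolding PL_edges_def es by blast
    moreover have "(F ^^ n) ` e = closed_segment p0 p1"
    proof -
      have "(F ^^ n) ` e = (\<lambda>s. point (edge_pt s)) ` {0..1}" unfolding e_def image_image by (intro image_cong refl) (simp add: FF)
      thus ?thesis unfolding point_edge_pt closed_segment_image_interval .
    qed
    moreover have "z \<in> e" using w by (auto simp: e_def)
    ultimately show "z \<in> Phi p0 p1 pinf F n" unfolding Phi_def by blast
  qed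
qed

end

section \<open>The double of the triangle\<close>

lemma topspace_double_topology: "topspace (double_topology T) = double T T"
proof -
  have "{z \<in> T. double_proj T (z, s) \<in> double T T} = T" for s by (auto simp: double_def)
  hence "openin (double_topology T) (double T T)" by (simp add: openin_double_topology)
  moreover have "\<And>U. openin (double_topology T) U \<Longrightarrow> U \<subseteq> double T T" by (simp add: openin_double_topology)
  ultimately show ?thesis by (meson openin_subset openin_topspace subset_antisym)
qed

lemma continuous_map_double_proj:
  "continuous_map (top_of_set T) (double_topology T) (\<lambda>z. double_proj T (z, s))"
  unfolding continuous_map_def
proof (intro conjI allI impI)
  show "(\<lambda>z. double_proj T (z, s)) \<in> topspace (top_of_set T) \<rightarrow> topspace (double_topology T)"
    by (auto simp: topspace_double_topology double_def)
next
  fix U assume "openin (double_topology T) U"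
  thus "openin (top_of_set T) {x \<in> topspace (top_of_set T). double_proj T (x, s) \<in> U}"
    by (simp add: openin_double_topology)
qed

text \<open>Together with the projection to the plane this separates the points of the double, which shows that
the double is a Hausdorff space.\<close>

definition signed_dist :: "complex set \<Rightarrow> complex \<times> bool \<Rightarrow> real" where
  "signed_dist T p = (if snd p then infdist (fst p) (frontier T) else - infdist (fst p) (frontier T))"

lemma continuous_map_double_coords:
  "continuous_map (double_topology T) euclidean (\<lambda>p. (fst p, signed_dist T p))"
  unfolding continuous_map_def
proof (intro conjI allI impI)
  fix W :: "(complex \<times> real) set" assume W: "openin euclidean W"
  have sd: "signed_dist T (double_proj T (z, s)) = (if s then infdist z (frontier T) else - infdist z (frontier T))" for z s
    by (auto simp: signed_dist_def double_proj_def)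
  have e: "{z \<in> T. double_proj T (z, s) \<in> {p \<in> double T T. (fst p, signed_dist T p) \<in> W}}
     = T \<inter> (\<lambda>z. (z, if s then infdist z (frontier T) else - infdist z (frontier T))) -` W" for s
    using sd by (auto simp: double_def) (auto simp: double_proj_def)
  have "continuous_on T (\<lambda>z. (z, if s then infdist z (frontier T) else - infdist z (frontier T)))" for s
    by (cases s) (auto intro!: continuous_intros)
  hence "openin (top_of_set T) (T \<inter> (\<lambda>z. (z, if s then infdist z (frontier T) else - infdist z (frontier T))) -` W)" for s
    by (rule continuous_openin_preimage_gen) (use W in simp)
  thus "openin (double_topology T) {p \<in> topspace (double_topology T). (fst p, signed_dist T p) \<in> W}"
    unfolding openin_double_topology topspace_double_topology e by auto
qed simp

lemma Hausdorff_double: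
  assumes "frontier T \<noteq> {}"
  shows "Hausdorff_space (double_topology T)"
proof (rule Hausdorff_space_injective_preimage[OF _ continuous_map_double_coords])
  show "inj_on (\<lambda>p. (fst p, signed_dist T p)) (topspace (double_topology T))"
  proof (rule inj_onI)
    fix p q assume p: "p \<in> topspace (double_topology T)" and q: "q \<in> topspace (double_topology T)"
      and eq: "(fst p, signed_dist T p) = (fst q, signed_dist T q)"
    have pq: "fst p \<in> frontier T \<Longrightarrow> snd p" "fst q \<in> frontier T \<Longrightarrow> snd q"
      using p q by (auto simp: topspace_double_topology double_def double_proj_def)
    show "p = q"
    proof (cases "fst p \<in> frontier T")
      case True
      thus ?thesis using eq pq by (auto intro: prod_eqI)
    next
      case False
      hence "infdist (fst p) (frontier T) > 0"
        using assms in_closed_iff_infdist_zero[of "frontier T" "fst p"] infdist_nonneg[of "fst p" "frontier T"]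
        by (auto simp: less_le)
      thus ?thesis using eq by (auto simp: signed_dist_def intro!: prod_eqI split: if_splits)
    qed
  qed
qed simp

context pl_model
begin

text \<open>The copy \<open>up\<close> of the triangle receives the points of the closed upper half-plane, the other copy
those of the lower one.\<close>

definition to_double :: "nat \<Rightarrow> bool \<Rightarrow> complex \<Rightarrow> complex \<times> bool" where
  "to_double n up z = double_proj T (point (bary_of n (upper_fold z)), (Im z \<ge> 0) = up)"

lemma to_double_frontier:
  assumes "z \<in> dessin_set n"
  shows "point (bary_of n (upper_fold z)) \<in> frontier T \<longleftrightarrow> Im z = 0"
proof -
  have w: "upper_fold z \<in> dessin_up n" using assms by (simp add: dessin_up_fold)
  show ?thesis unfolding frontier_T[OF bary_of_simplex[OF w]] bary_of_props(2-)[OF w]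
    by (auto simp: seg01_def seg1i_def segi0_def upper_fold_def split: if_splits)
qed

lemma dessin_set_repr: "z \<in> dessin_set n \<Longrightarrow> \<exists>l \<in> Phi_bary n. z = conj_unless (Im z \<ge> 0) (dessin_pt n l)"
proof -
  assume z: "z \<in> dessin_set n"
  hence w: "upper_fold z \<in> dessin_up n" by (simp add: dessin_up_fold)
  show ?thesis using bary_of_props(1)[OF w] dessin_pt_bary_of[OF w]
    by (intro bexI[of _ "bary_of n (upper_fold z)"]) (auto simp: conj_unless_def upper_fold_def)
qed

lemma dessin_pt_dessin_set: "l \<in> Phi_bary n \<Longrightarrow> conj_unless b (dessin_pt n l) \<in> dessin_set n"
  using dessin_pt(1)[of l n] by (auto simp: conj_unless_def dessin_up_def dessin_set_cnj)

text \<open>For points on the real line the two sides of the equation are independent of \<open>s\<close>, because both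
copies of a boundary point of the triangle are identified.\<close>

lemma to_double_conj:
  assumes l: "l \<in> Phi_bary n"
  shows "to_double n up (conj_unless (s = up) (dessin_pt n l)) = double_proj T (point l, s)"
proof -
  define w z where "w = dessin_pt n l" and "z = conj_unless (s = up) w"
  have w: "w \<in> dessin_up n" "bary_of n w = l" using dessin_pt[OF l] by (auto simp: w_def)
  have Imw: "Im w \<ge> 0" using w by (simp add: dessin_up_def)
  have zd: "z \<in> dessin_set n" unfolding z_def w_def by (rule dessin_pt_dessin_set[OF l])
  have fz: "upper_fold z = w" using Imw by (auto simp: z_def conj_unless_def upper_fold_def complex_eq_iff)
  show ?thesis
  proof (cases "Im w = 0")
    case True
    hence "point l \<in> frontier T" using to_double_frontier[OF zd] w by (simp add: fz) (simp add: z_def conj_unless_def)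
    thus ?thesis using w by (simp add: to_double_def z_def[symmetric] w_def[symmetric] fz double_proj_def)
  next
    case False
    hence "(Im z \<ge> 0) = (s = up)" using Imw by (auto simp: z_def conj_unless_def)
    hence "((Im z \<ge> 0) = up) = s" by blast
    thus ?thesis using w by (simp add: to_double_def z_def[symmetric] w_def[symmetric] fz)
  qed
qed

lemma to_double_inj: "inj_on (to_double n up) (dessin_set n)"
proof (rule inj_onI)
  fix z z' assume z: "z \<in> dessin_set n" and z': "z' \<in> dessin_set n" and eq: "to_double n up z = to_double n up z'"
  have w: "upper_fold z \<in> dessin_up n" "upper_fold z' \<in> dessin_up n" using z z' by (simp_all add: dessin_up_fold)
  have same: "point (bary_of n (upper_fold z)) = point (bary_of n (upper_fold z'))" using eq by (simp add: to_double_def double_proj_def)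
  hence "bary_of n (upper_fold z) = bary_of n (upper_fold z')"
    using point_eq_iff[OF bary_of_simplex[OF w(1)] bary_of_simplex[OF w(2)]] by simp
  hence f: "upper_fold z = upper_fold z'" using bary_of_inj w by (auto dest: inj_onD)
  show "z = z'"
  proof (cases "Im z = 0")
    case True
    hence "Im z' = 0" using to_double_frontier[OF z] to_double_frontier[OF z'] f by simp
    thus ?thesis using f True by (auto simp: upper_fold_def split: if_splits)
  next
    case False
    hence "Im z' \<noteq> 0" using to_double_frontier[OF z] to_double_frontier[OF z'] f by simp
    hence "((Im z \<ge> 0) = up) = ((Im z' \<ge> 0) = up)"
      using eq False to_double_frontier[OF z] to_double_frontier[OF z'] by (simp add: to_double_def double_proj_def)
    hence "(Im z \<ge> 0) = (Im z' \<ge> 0)" by blast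
    thus ?thesis using f by (auto simp: upper_fold_def split: if_splits)
  qed
qed

lemma to_double_image: "to_double n up ` dessin_set n = double T (point ` Phi_bary n)"
proof
  show "to_double n up ` dessin_set n \<subseteq> double T (point ` Phi_bary n)"
  proof
    fix p assume "p \<in> to_double n up ` dessin_set n"
    then obtain z where z: "z \<in> dessin_set n" "p = to_double n up z" by blast
    have "bary_of n (upper_fold z) \<in> Phi_bary n" using z by (intro bary_of_props) (simp add: dessin_up_fold)
    thus "p \<in> double T (point ` Phi_bary n)" using z(2) by (auto simp: to_double_def double_def)
  qed
  show "double T (point ` Phi_bary n) \<subseteq> to_double n up ` dessin_set n"
  proof
    fix p assume "p \<in> double T (point ` Phi_bary n)"
    then obtain l s where l: "l \<in> Phi_bary n" "p = double_proj T (point l, s)" by (auto simp: double_def)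
    thus "p \<in> to_double n up ` dessin_set n" using to_double_conj[OF l(1), of up s] dessin_pt_dessin_set[OF l(1)] by (metis imageI)
  qed
qed

lemma to_double_continuous: "continuous_map (top_of_set (dessin_set n)) (double_topology T) (to_double n up)"
proof -
  define f where "f = (\<lambda>z. double_proj T (point (bary_of n z), up))"
  define g where "g = (\<lambda>z. double_proj T (point (bary_of n (cnj z)), \<not> up))"
  have JK: "continuous_map (top_of_set (dessin_up n)) (top_of_set T) (\<lambda>z. point (bary_of n z))"
  proof -
    have "continuous_on (dessin_up n) (\<lambda>z. point (bary_of n z))"
      using continuous_on_compose2[OF continuous_on_point[of UNIV] continuous_on_bary_of[of n]] by simp
    moreover have "point (bary_of n z) \<in> T" if "z \<in> dessin_up n" for z using bary_of_simplex[OF that] point_image by blast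
    ultimately show ?thesis by (auto simp: continuous_map_in_subtopology)
  qed
  \<comment> \<open>The two halves of the dessin are closed and meet in real points, which go to the boundary of the triangle.\<close>
  have A: "{x \<in> topspace (top_of_set (dessin_set n)). 0 \<le> Im x} = dessin_up n" by (auto simp: dessin_up_def)
  have B: "cnj z \<in> dessin_up n" if "z \<in> {x \<in> topspace (top_of_set (dessin_set n)). Im x \<le> 0}" for z
    using that by (auto simp: dessin_up_def dessin_set_cnj)
  have incl: "dessin_set n \<inter> dessin_up n = dessin_up n" by (auto simp: dessin_up_def)
  have "continuous_map (top_of_set (dessin_set n)) (double_topology T) (\<lambda>z. if 0 \<le> Im z then f z else g z)"
  proof (rule continuous_map_cases_le)
    show "continuous_map (top_of_set (dessin_set n)) euclideanreal (\<lambda>x. 0)" by simp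
    show "continuous_map (top_of_set (dessin_set n)) euclideanreal Im" by (simp add: continuous_on_Im)
    show "continuous_map (subtopology (top_of_set (dessin_set n)) {x \<in> topspace (top_of_set (dessin_set n)). 0 \<le> Im x}) (double_topology T) f"
      unfolding A f_def subtopology_subtopology incl
      using continuous_map_compose[OF JK continuous_map_double_proj[of T up]] by (simp add: o_def)
    have "continuous_map (top_of_set {x \<in> dessin_set n. Im x \<le> 0}) (top_of_set (dessin_up n)) cnj"
      using B by (auto simp: continuous_map_in_subtopology intro!: continuous_intros)
    from continuous_map_compose[OF continuous_map_compose[OF this JK] continuous_map_double_proj[of T "\<not> up"]]
    have "continuous_map (top_of_set {x \<in> dessin_set n. Im x \<le> 0}) (double_topology T) g"
      by (simp add: o_def g_def)
    moreover have "dessin_set n \<inter> {x \<in> dessin_set n. Im x \<le> 0} = {x \<in> dessin_set n. Im x \<le> 0}" by blast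
    ultimately show "continuous_map (subtopology (top_of_set (dessin_set n)) {x \<in> topspace (top_of_set (dessin_set n)). Im x \<le> 0}) (double_topology T) g"
      by (simp add: subtopology_subtopology)
    show "f x = g x" if "x \<in> topspace (top_of_set (dessin_set n))" "0 = Im x" for x
    proof -
      have "cnj x = x" "upper_fold x = x" using that by (auto simp: complex_eq_iff upper_fold_def)
      moreover have "point (bary_of n (upper_fold x)) \<in> frontier T" using that to_double_frontier by simp
      ultimately show ?thesis by (simp add: f_def g_def double_proj_def)
    qed
  qed
  moreover have "to_double n up = (\<lambda>z. if 0 \<le> Im z then f z else g z)"
    by (rule ext) (simp add: to_double_def f_def g_def upper_fold_def)
  ultimately show ?thesis by simp
qed

lemma frontier_nonempty: "frontier T \<noteq> {}"
  using frontier_T[of "(1,0,0)"] by (auto simp: std_simplex_def side01_def)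

lemma to_double_homeomorphic:
  "homeomorphic_map (top_of_set (dessin_set n)) (subtopology (double_topology T) (double T (Phi p0 p1 pinf F n))) (to_double n up)"
proof (rule continuous_imp_homeomorphic_map)
  have incl: "double T (Phi p0 p1 pinf F n) \<subseteq> double T T"
    unfolding Phi_eq using Phi_bary_subset point_image unfolding double_def by blast
  show "continuous_map (top_of_set (dessin_set n)) (subtopology (double_topology T) (double T (Phi p0 p1 pinf F n))) (to_double n up)"
    unfolding continuous_map_in_subtopology using to_double_continuous to_double_image[of n up] by (auto simp: Phi_eq)
  show "compact_space (top_of_set (dessin_set n))" by (simp add: compact_space_subtopology compact_dessin_set)
  show "Hausdorff_space (subtopology (double_topology T) (double T (Phi p0 p1 pinf F n)))"
    by (intro Hausdorff_space_subtopology Hausdorff_double frontier_nonempty)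
  show "to_double n up ` topspace (top_of_set (dessin_set n)) = topspace (subtopology (double_topology T) (double T (Phi p0 p1 pinf F n)))"
    using to_double_image incl by (auto simp: topspace_double_topology Phi_eq)
  show "inj_on (to_double n up) (topspace (top_of_set (dessin_set n)))" using to_double_inj by simp
qed

end

text \<open>An orbit that reaches $[0,1]$ never visits infinity, so it is an orbit of the rational map.\<close>

lemma iterate_hessian_dynamical_system:
  assumes H: "hessian_dynamical_system H"
  shows "(H ^^ n) z = Some t \<and> seg01 t \<longleftrightarrow> (\<exists>x \<in> dessin_set n. z = Some x \<and> t = (hess_map ^^ n) x)"
proof (induction n arbitrary: z)
  case (Suc n)
  have N: "(H ^^ m) None = None" for m
    by (induction m) (auto simp: hessian_dynamical_system_formula[OF H])
  show ?case
  proof (cases z)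
    case None
    thus ?thesis by (simp only: N) simp
  next
    case (Some x)
    show ?thesis
    proof (cases "x = 0")
      case True
      have "(H ^^ Suc n) z = None"
        using Some True by (simp add: funpow_swap1 hessian_dynamical_system_formula[OF H] N)
      thus ?thesis using Some True by simp
    next
      case False
      have "(H ^^ Suc n) z = (H ^^ n) (Some (hess_map x))"
        using Some False by (simp add: funpow_swap1 hessian_dynamical_system_formula[OF H])
      thus ?thesis using Suc[of "Some (hess_map x)"] False Some by (auto simp: funpow_swap1)
    qed
  qed
qed auto

lemma homeomorphic_map_Some: "homeomorphic_map (top_of_set D) (subtopology P1 (Some ` D)) Some"
proof -
  have "homeomorphic_map euclidean (subtopology P1 (Some ` topspace euclidean)) (Some :: complex \<Rightarrow> _)"
    using embedding_map_Some[of euclidean] unfolding embedding_map_def P1_def .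
  from homeomorphic_map_subtopologies[OF this, of D "Some ` D"]
  have "homeomorphic_map (top_of_set D) (subtopology (subtopology P1 (Some ` topspace euclidean)) (Some ` D)) Some"
    by (auto simp: P1_def)
  moreover have "range Some \<inter> Some ` D = Some ` D" by blast
  ultimately show ?thesis by (simp add: subtopology_subtopology)
qed

section \<open>Orbits of the vertices and conformality\<close>

text \<open>Both the derivative and local injectivity pass to compositions, hence to iterates. The derivative
transports the directions of germs, injectivity allows a germ to be recognized by its image.\<close>

definition conformal_at :: "(complex \<Rightarrow> complex) \<Rightarrow> complex \<Rightarrow> complex \<Rightarrow> bool" where
  "conformal_at f z d \<longleftrightarrow> d \<noteq> 0 \<and> (f has_field_derivative d) (at z) \<and>
     (\<exists>Q. eventually Q (nhds z) \<and> (\<forall>x y. Q x \<and> Q y \<and> f x = f y \<longrightarrow> x = y))"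

lemma conformal_at_compose:
  assumes g: "conformal_at g z d" and f: "conformal_at f (g z) d'"
  shows "conformal_at (f \<circ> g) z (d' * d)"
proof -
  obtain Q where Q: "eventually Q (nhds z)" "\<And>x y. Q x \<Longrightarrow> Q y \<Longrightarrow> g x = g y \<Longrightarrow> x = y"
    using g unfolding conformal_at_def by blast
  obtain Q' where Q': "eventually Q' (nhds (g z))" "\<And>x y. Q' x \<Longrightarrow> Q' y \<Longrightarrow> f x = f y \<Longrightarrow> x = y"
    using f unfolding conformal_at_def by blast
  have "isCont g z" using g DERIV_isCont unfolding conformal_at_def by blast
  hence "filterlim g (nhds (g z)) (nhds z)" by (simp add: isCont_def tendsto_at_iff_tendsto_nhds)
  hence "eventually (\<lambda>x. Q' (g x)) (nhds z)" using Q'(1) by (simp add: filterlim_iff)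
  hence "eventually (\<lambda>x. Q x \<and> Q' (g x)) (nhds z)" using Q(1) by (rule eventually_conj[rotated])
  moreover have "\<forall>x y. (Q x \<and> Q' (g x)) \<and> (Q y \<and> Q' (g y)) \<and> (f \<circ> g) x = (f \<circ> g) y \<longrightarrow> x = y"
    using Q(2) Q'(2) by auto
  moreover have "((f \<circ> g) has_field_derivative (d' * d)) (at z)"
    using f g unfolding conformal_at_def by (intro DERIV_chain) auto
  ultimately show ?thesis using f g unfolding conformal_at_def by auto
qed

lemma pair_nonvanishing:
  fixes P :: "complex \<Rightarrow> complex \<Rightarrow> complex"
  assumes "continuous_on UNIV (\<lambda>p. P (fst p) (snd p))" "P a a \<noteq> 0"
  shows "\<exists>Q. eventually Q (nhds a) \<and> (\<forall>x y. Q x \<and> Q y \<longrightarrow> P x y \<noteq> 0)"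
proof -
  have "((\<lambda>p. P (fst p) (snd p)) \<longlongrightarrow> P (fst (a, a)) (snd (a, a))) (nhds (a, a))"
  proof -
    have "isCont (\<lambda>p. P (fst p) (snd p)) (a, a)" using assms(1) by (simp add: continuous_on_eq_continuous_at)
    thus ?thesis unfolding isCont_def by (rule tendsto_at_iff_tendsto_nhds[THEN iffD1])
  qed
  hence "eventually (\<lambda>p. P (fst p) (snd p) \<noteq> 0) (nhds (a, a))"
    by (rule tendsto_imp_eventually_ne) (use assms in simp)
  hence "eventually (\<lambda>p. P (fst p) (snd p) \<noteq> 0) (nhds a \<times>\<^sub>F nhds a)" by (simp add: nhds_prod)
  thus ?thesis unfolding eventually_prod_same by fastforce
qed

text \<open>Distinct points with equal images satisfy a symmetric equation $P(x,y) = 0$, and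
$P(z,z) = z(z-4)^2(z+8)$ does not vanish.\<close>

lemma conformal_at_hess_map:
  assumes "z \<noteq> 0" "z \<noteq> 4" "z \<noteq> -8"
  shows "\<exists>d. conformal_at hess_map z d"
proof -
  define d where "d = - ((z - 4)^2 * (z + 8)) / (27 * z^3)"
  have z8: "z + 8 \<noteq> 0" using assms(3) by (simp add: eq_neg_iff_add_eq_0)
  have d0: "d \<noteq> 0" using assms z8 by (simp add: d_def)
  have der: "(hess_map has_field_derivative d) (at z)"
    unfolding hess_map_def d_def using assms
    by (auto intro!: derivative_eq_intros simp: field_simps power2_eq_square power3_eq_cube)
  define P where "P x y = (x * y)^2 - 48 * (x * y) + 64 * (x + y)" for x y :: complex
  have "P z z = z * ((z - 4)^2 * (z + 8))" by (simp add: P_def power2_eq_square algebra_simps)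
  hence "P z z \<noteq> 0" using assms z8 by simp
  moreover have "continuous_on UNIV (\<lambda>p. P (fst p) (snd p))" unfolding P_def by (intro continuous_intros)
  ultimately obtain Q where Q: "eventually Q (nhds z)" "\<And>x y. Q x \<Longrightarrow> Q y \<Longrightarrow> P x y \<noteq> 0"
    using pair_nonvanishing by blast
  have "eventually (\<lambda>x. x \<noteq> 0) (nhds z)" using assms(1) by (intro t1_space_nhds)
  hence "eventually (\<lambda>x. Q x \<and> x \<noteq> 0) (nhds z)" using Q(1) by (rule eventually_conj[rotated])
  moreover have "\<forall>x y. (Q x \<and> x \<noteq> 0) \<and> (Q y \<and> y \<noteq> 0) \<and> hess_map x = hess_map y \<longrightarrow> x = y"
    using Q(2) hess_map_eq_iff unfolding P_def by blast
  ultimately show ?thesis using der d0 unfolding conformal_at_def by blast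
qed

lemma conformal_at_iterate:
  assumes "\<And>j. j < m \<Longrightarrow> (hess_map ^^ j) z \<notin> {0, 4, -8}"
  shows "\<exists>d. conformal_at (hess_map ^^ m) z d"
  using assms
proof (induction m)
  case 0
  have "conformal_at (hess_map ^^ 0) z 1"
    unfolding conformal_at_def by (auto intro!: derivative_eq_intros exI[of _ "\<lambda>_. True"] simp: id_def)
  thus ?case by blast
next
  case (Suc m)
  obtain d where d: "conformal_at (hess_map ^^ m) z d" using Suc by force
  have "(hess_map ^^ m) z \<notin> {0, 4, -8}" using Suc.prems[of m] by simp
  then obtain d' where "conformal_at hess_map ((hess_map ^^ m) z) d'" using conformal_at_hess_map by force
  hence "\<exists>d. conformal_at (hess_map \<circ> hess_map ^^ m) z d" using conformal_at_compose[OF d] by blast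
  thus ?case by (simp only: funpow.simps)
qed

lemma conformal_quotient:
  assumes c: "conformal_at f z d" and lim: "filterlim \<zeta> (at z) G"
  shows "((\<lambda>x. sgn ((f (\<zeta> x) - f z) / (\<zeta> x - z))) \<longlongrightarrow> sgn d) G"
proof -
  have "(f has_field_derivative d) (at z)" "d \<noteq> 0" using c by (auto simp: conformal_at_def)
  hence "((\<lambda>y. (f y - f z) / (y - z)) \<longlongrightarrow> d) (at z)" unfolding has_field_derivative_iff by simp
  hence "((\<lambda>x. (f (\<zeta> x) - f z) / (\<zeta> x - z)) \<longlongrightarrow> d) G" using lim by (rule filterlim_compose)
  thus ?thesis using \<open>d \<noteq> 0\<close> by (rule tendsto_sgn)
qed

lemma sgn_divide_complex: "sgn (a / b) = sgn a / sgn (b :: complex)"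
  by (simp add: complex_sgn_def norm_divide scaleR_conv_of_real divide_simps)

lemma sgn_mult_complex: "sgn (a * b) = sgn a * sgn (b :: complex)"
  by (simp add: complex_sgn_def norm_mult scaleR_conv_of_real)

text \<open>A conformal map multiplies directions by the direction of its derivative.\<close>

lemma conformal_direction:
  assumes c: "conformal_at f z d" and lim: "filterlim \<zeta> (at z) G"
  shows "((\<lambda>x. sgn (\<zeta> x - z)) \<longlongrightarrow> u) G \<longleftrightarrow> ((\<lambda>x. sgn (f (\<zeta> x) - f z)) \<longlongrightarrow> sgn d * u) G"
proof -
  have d: "sgn d \<noteq> 0" using c by (auto simp: conformal_at_def sgn_zero_iff)
  note q = conformal_quotient[OF c lim]
  have ne: "eventually (\<lambda>x. \<zeta> x \<noteq> z) G" using lim by (simp add: filterlim_at eventually_conj_iff)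
  have q0: "eventually (\<lambda>x. sgn ((f (\<zeta> x) - f z) / (\<zeta> x - z)) \<noteq> 0) G"
    by (rule tendsto_imp_eventually_ne[OF q d])
  show ?thesis
  proof
    assume "((\<lambda>x. sgn (\<zeta> x - z)) \<longlongrightarrow> u) G"
    from tendsto_mult[OF q this]
    show "((\<lambda>x. sgn (f (\<zeta> x) - f z)) \<longlongrightarrow> sgn d * u) G"
      by (rule Lim_transform_eventually)
         (use ne in \<open>eventually_elim, auto simp: sgn_divide_complex sgn_zero_iff\<close>)
  next
    assume "((\<lambda>x. sgn (f (\<zeta> x) - f z)) \<longlongrightarrow> sgn d * u) G"
    from tendsto_divide[OF this q d] d
    have "((\<lambda>x. sgn (f (\<zeta> x) - f z) / sgn ((f (\<zeta> x) - f z) / (\<zeta> x - z))) \<longlongrightarrow> u) G" by simp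
    thus "((\<lambda>x. sgn (\<zeta> x - z)) \<longlongrightarrow> u) G"
      by (rule Lim_transform_eventually)
         (use ne q0 in \<open>eventually_elim, auto simp: sgn_divide_complex sgn_zero_iff\<close>)
  qed
qed

lemma conformal_filterlim:
  assumes c: "conformal_at f z d" and lim: "filterlim \<zeta> (at z) G"
  shows "filterlim (\<lambda>x. f (\<zeta> x)) (at (f z)) G"
proof -
  have d: "sgn d \<noteq> 0" using c by (auto simp: conformal_at_def sgn_zero_iff)
  have "eventually (\<lambda>x. sgn ((f (\<zeta> x) - f z) / (\<zeta> x - z)) \<noteq> 0) G"
    by (rule tendsto_imp_eventually_ne[OF conformal_quotient[OF c lim] d])
  hence "eventually (\<lambda>x. f (\<zeta> x) \<noteq> f z) G" by eventually_elim auto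
  moreover have "((\<lambda>x. f (\<zeta> x)) \<longlongrightarrow> f z) G"
  proof -
    have "isCont f z" using c DERIV_isCont unfolding conformal_at_def by blast
    moreover have "(\<zeta> \<longlongrightarrow> z) G" using lim by (simp add: filterlim_at)
    ultimately show ?thesis by (rule isCont_tendsto_compose)
  qed
  ultimately show ?thesis by (simp add: filterlim_at)
qed


lemma dessin_set_iterate: "z \<in> dessin_set (m + k) \<Longrightarrow> (hess_map ^^ m) z \<in> dessin_set k"
  by (induction m arbitrary: z) (auto simp: funpow_swap1)

lemma hess_map_values [simp]: "hess_map 4 = 0" "hess_map 1 = 1" "hess_map (-8) = 1" "hess_map 0 = 0"
  by (simp_all add: hess_map_def)

lemma hess_map_eq_0: "z \<noteq> 0 \<Longrightarrow> hess_map z = 0 \<longleftrightarrow> z = 4"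
  by (simp add: hess_map_def)

lemma hess_map_eq_1: "z \<noteq> 0 \<Longrightarrow> hess_map z = 1 \<longleftrightarrow> z = 1 \<or> z = -8"
proof -
  assume z: "z \<noteq> 0"
  have "hess_map z = 1 \<longleftrightarrow> hess_map z - 1 = 0" by (rule eq_iff_diff_eq_0)
  also have "\<dots> \<longleftrightarrow> (z - 1) * (z + 8)^2 = 0" unfolding hess_map_minus_1[OF z] using z by simp
  also have "\<dots> \<longleftrightarrow> z - 1 = 0 \<or> z + 8 = 0" by simp
  also have "\<dots> \<longleftrightarrow> z = 1 \<or> z = -8" unfolding right_minus_eq eq_neg_iff_add_eq_0 ..
  finally show ?thesis .
qed

lemma hess_iterate_1: "(hess_map ^^ m) 1 = 1" by (induction m) auto

text \<open>A zero of the iterate is reached through the triple zero $4$. It cannot be reached earlier, because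
$4 \mapsto 0$ and $0$ is a pole; and $-8$ is excluded because its orbit stays at $1$.\<close>

lemma black_orbit:
  assumes z: "z \<in> dessin_set (Suc m)" and b: "(hess_map ^^ Suc m) z = 0"
  shows "(hess_map ^^ m) z = 4" "\<And>j. j < m \<Longrightarrow> (hess_map ^^ j) z \<notin> {0, 4, -8}"
proof -
  have D: "(hess_map ^^ j) z \<in> dessin_set (Suc m - j)" if "j \<le> Suc m" for j
    using dessin_set_iterate[of z j "Suc m - j"] z that by simp
  have nz: "(hess_map ^^ j) z \<noteq> 0" if "j \<le> m" for j
    using D[of j] that by (cases "Suc m - j") auto
  show "(hess_map ^^ m) z = 4" using b nz[of m] hess_map_eq_0[of "(hess_map ^^ m) z"] by simp
  show "(hess_map ^^ j) z \<notin> {0, 4, -8}" if "j < m" for j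
  proof -
    have "(hess_map ^^ j) z \<noteq> 0" using nz that by simp
    moreover have "(hess_map ^^ j) z \<noteq> 4" using nz[of "Suc j"] that by auto
    moreover have "(hess_map ^^ j) z \<noteq> -8"
    proof
      assume a: "(hess_map ^^ j) z = -8"
      have "(hess_map ^^ Suc m) z = (hess_map ^^ (m - j)) ((hess_map ^^ Suc j) z)"
        unfolding funpow_add[THEN fun_cong, unfolded o_apply, symmetric] using that by simp
      also have "\<dots> = 1" using a by (simp add: hess_iterate_1)
      finally show False using b by simp
    qed
    ultimately show ?thesis by simp
  qed
qed

text \<open>Neither $4$ nor $0$ lies on an orbit that ends at $1$, and $-8$ is met at most once because $1$ is
fixed.\<close>

lemma white_orbit:
  assumes z: "z \<in> dessin_set n" and w: "(hess_map ^^ n) z = 1"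
  shows "(\<forall>j<n. (hess_map ^^ j) z \<notin> {0, 4, -8}) \<or>
    (\<exists>k<n. (hess_map ^^ k) z = -8 \<and> (\<forall>j<k. (hess_map ^^ j) z \<notin> {0, 4, -8}))"
proof -
  have D: "(hess_map ^^ j) z \<in> dessin_set (n - j)" if "j \<le> n" for j
    using dessin_set_iterate[of z j "n - j"] z that by simp
  have nz: "(hess_map ^^ j) z \<noteq> 0" if "j < n" for j
    using D[of j] that by (cases "n - j") auto
  have n4: "(hess_map ^^ j) z \<noteq> 4" if "j < n" for j
  proof
    assume a: "(hess_map ^^ j) z = 4"
    hence "(hess_map ^^ Suc j) z = 0" by simp
    hence "\<not> Suc j < n" using nz[of "Suc j"] by blast
    hence "n = Suc j" using that by simp
    thus False using w a by simp
  qed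
  show ?thesis
  proof (cases "\<exists>k<n. (hess_map ^^ k) z = -8")
    case True
    then obtain k where k: "k < n \<and> (hess_map ^^ k) z = -8"
        and least: "\<forall>j<k. \<not> (j < n \<and> (hess_map ^^ j) z = -8)"
      using exists_least_iff[of "\<lambda>k. k < n \<and> (hess_map ^^ k) z = -8"] by blast
    have "(hess_map ^^ j) z \<notin> {0, 4, -8}" if "j < k" for j
    proof -
      have "j < n" using that k by simp
      thus ?thesis using nz[of j] n4[of j] least that by blast
    qed
    thus ?thesis using k by blast
  next
    case False
    thus ?thesis using nz n4 by auto
  qed
qed

section \<open>Directions of germs in the dessin\<close>

lemma dessin_set_1D: "y \<in> dessin_set 1 \<Longrightarrow> y \<noteq> 0" "y \<in> dessin_set 1 \<Longrightarrow> seg01 (hess_map y)"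
  by auto

lemma direction_at_4_real:
  assumes lim: "filterlim y (at 4) G" and D: "eventually (\<lambda>x. y x \<in> dessin_set 1) G" and re: "eventually (\<lambda>x. Im (y x) = 0) G"
  shows "((\<lambda>x. sgn (y x - 4)) \<longlongrightarrow> -1) G"
proof -
  have "eventually (\<lambda>x. y x \<noteq> 4) G" using lim by (simp add: filterlim_at eventually_conj_iff)
  with D re have "eventually (\<lambda>x. sgn (y x - 4) = -1) G"
  proof eventually_elim
    case (elim x)
    have "Re (y x) \<le> 4" using hess_map_on_reals(4)[OF dessin_set_1D(1)[OF elim(1)] elim(2)] dessin_set_1D(2)[OF elim(1)]
      by (simp add: seg01_def)
    moreover have "Re (y x) \<noteq> 4" using elim by (auto simp: complex_eq_iff)
    ultimately have "y x - 4 = of_real (Re (y x) - 4)" "Re (y x) - 4 < 0" using elim by (auto simp: complex_eq_iff)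
    thus ?case by (metis of_real_1 of_real_minus sgn_of_real sgn_neg)
  qed
  thus ?thesis by (rule tendsto_eventually)
qed

text \<open>Near $4$ the image is a negative multiple of $(y-4)^3/y^2$, so the cube of the direction tends to
$-1$. In the upper half-plane the edge stays outside the circle $|y| = 4$, which excludes the direction
$-1$ and leaves $e^{i\pi/3}$.\<close>

lemma direction_at_4_upper:
  assumes lim: "filterlim y (at 4) G" and D: "eventually (\<lambda>x. y x \<in> dessin_set 1) G" and up: "eventually (\<lambda>x. Im (y x) > 0) G"
  shows "((\<lambda>x. sgn (y x - 4)) \<longlongrightarrow> cis (pi/3)) G"
proof -
  define \<omega> where "\<omega> = cis (pi/3)"
  have w: "Re \<omega> = 1/2" "Im \<omega> = sqrt 3 / 2" by (simp_all add: \<omega>_def cos_60 sin_60)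
  have fac: "r^3 + 1 = (r + 1) * ((r - \<omega>) * (r - cnj \<omega>))" for r
  proof -
    have s: "\<omega> + cnj \<omega> = 1" using w by (simp add: complex_eq_iff)
    have s': "\<omega> * cnj \<omega> = 1" by (metis \<omega>_def complex_norm_square norm_cis of_real_1 one_power2)
    have "(r - \<omega>) * (r - cnj \<omega>) = r * r - r * (\<omega> + cnj \<omega>) + \<omega> * cnj \<omega>" by (simp add: algebra_simps)
    also have "\<dots> = r * r - r + 1" by (simp add: s s')
    finally have q: "(r - \<omega>) * (r - cnj \<omega>) = r * r - r + 1" .
    show ?thesis unfolding q by (simp add: power3_eq_cube algebra_simps)
  qed
  define r where "r = (\<lambda>x. sgn (y x - 4))"
  have ylim: "(y \<longlongrightarrow> 4) G" and ne: "eventually (\<lambda>x. y x \<noteq> 4) G"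
    using lim by (simp_all add: filterlim_at eventually_conj_iff)
  have "((\<lambda>x. sgn (y x)) \<longlongrightarrow> sgn 4) G" using ylim by (rule tendsto_sgn) simp
  hence "((\<lambda>x. - (sgn (y x) ^ 2) + 1) \<longlongrightarrow> - (sgn 4 ^ 2) + 1) G" by (intro tendsto_add tendsto_minus tendsto_power tendsto_const)
  moreover have "sgn (4 :: complex) = 1" by (simp add: complex_sgn_def scaleR_conv_of_real)
  ultimately have lim0: "((\<lambda>x. - (sgn (y x) ^ 2) + 1) \<longlongrightarrow> 0) G" by simp
  have "eventually (\<lambda>x. dist (y x) 4 < 4) G" using ylim by (rule tendstoD) simp
  with D up ne have "eventually (\<lambda>x. norm (r x - \<omega>) \<le> 4 * norm (- (sgn (y x) ^ 2) + 1)) G"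
  proof eventually_elim
    case (elim x)
    define z where "z = y x"
    have z0: "z \<noteq> 0" and on: "seg01 (hess_map z)" and z4: "z \<noteq> 4" and Iz: "Im z > 0" and near: "cmod (z - 4) < 4"
      using dessin_set_1D[OF elim(1)] elim(2-) by (auto simp: z_def dist_norm)
    have Q: "quartic z = 0" using on Im_hess_map[OF z0] z0 Iz by (auto simp: seg01_def)
    have big: "cmod z > 4" using hess_map_on_curve(3)[OF Iz Q] on by (force simp: seg01_def)
    define h where "h = Re (hess_map z)"
    have "hess_map z = of_real h" using on by (simp add: seg01_def h_def complex_eq_iff)
    moreover have "h \<noteq> 0" using calculation hess_map_eq_0[OF z0] z4 by auto
    moreover have "h \<ge> 0" using on by (simp add: seg01_def h_def)
    ultimately have h: "hess_map z = of_real h" "h > 0" by auto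
    have "- ((z - 4)^3) = of_real (27 * h) * z^2"
      using h(1) z0 by (simp add: hess_map_def field_simps)
    hence "- (- ((z - 4)^3)) = - (of_real (27 * h) * z^2)" by (rule arg_cong)
    hence "(z - 4)^3 = of_real (- (27 * h)) * z^2" by simp
    hence "sgn ((z - 4)^3) = sgn (of_real (- (27 * h))) * sgn z ^ 2"
      by (simp add: sgn_mult_complex power2_eq_square)
    moreover have "sgn (complex_of_real (- (27 * h))) = -1" using h(2) by (simp only: sgn_of_real) simp
    ultimately have r3: "r x ^ 3 = - (sgn z ^ 2)"
      by (simp add: r_def z_def[symmetric] sgn_mult_complex power3_eq_cube)
    have "of_real (cmod (z - 4)) * r x = z - 4"
      using z4 by (simp add: r_def z_def[symmetric] sgn_eq)
    hence zr: "z = 4 + of_real (cmod (z - 4)) * r x" by simp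
    define \<rho> where "\<rho> = cmod (z - 4)"
    have rho: "\<rho> > 0" "\<rho> < 4" using z4 near by (auto simp: \<rho>_def)
    have nr: "cmod (r x) = 1" using z4 by (simp add: r_def z_def[symmetric] norm_sgn)
    have "cmod z ^ 2 = 16 + 8 * \<rho> * Re (r x) + \<rho>^2"
    proof -
      have "cmod z ^ 2 = (4 + \<rho> * Re (r x))^2 + (\<rho> * Im (r x))^2"
      proof -
        have "Re z = 4 + \<rho> * Re (r x)" "Im z = \<rho> * Im (r x)"
          by (subst zr, simp add: \<rho>_def)+
        thus ?thesis by (simp add: cmod_power2)
      qed
      also have "\<dots> = 16 + 8 * \<rho> * Re (r x) + \<rho>^2 * (Re (r x) ^ 2 + Im (r x) ^ 2)"
        by (simp add: power2_eq_square algebra_simps)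
      finally show ?thesis using nr by (simp add: cmod_power2[symmetric])
    qed
    moreover have "cmod z ^ 2 > 16" using big power_strict_mono[of 4 "cmod z" 2] by simp
    ultimately have "\<rho> * (8 * Re (r x) + \<rho>) > 0" by (simp add: power2_eq_square algebra_simps)
    hence "8 * Re (r x) + \<rho> > 0" using rho by (simp add: zero_less_mult_iff)
    hence "Re (r x + 1) \<ge> 1/2" using rho by simp
    hence n1: "cmod (r x + 1) \<ge> 1/2" using complex_Re_le_cmod[of "r x + 1"] by linarith
    have "Im (r x) > 0" using Iz rho(1) by (simp add: r_def z_def[symmetric] complex_sgn_def \<rho>_def)
    moreover have "sqrt 3 \<ge> 1" by simp
    ultimately have "Im (r x - cnj \<omega>) \<ge> 1/2" unfolding minus_complex.simps cnj.simps w by linarith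
    hence n2: "cmod (r x - cnj \<omega>) \<ge> 1/2" using abs_Im_le_cmod[of "r x - cnj \<omega>"] by linarith
    have "1/2 * (cmod (r x - \<omega>) * (1/2)) \<le> cmod (r x + 1) * (cmod (r x - \<omega>) * cmod (r x - cnj \<omega>))"
      using n1 n2 by (intro mult_mono) auto
    also have "\<dots> = cmod (r x ^ 3 + 1)" unfolding fac norm_mult ..
    finally show ?case using r3 by (simp add: z_def)
  qed
  moreover have "((\<lambda>x. 4 * norm (- (sgn (y x) ^ 2) + 1)) \<longlongrightarrow> 0) G"
    using tendsto_mult_left[OF tendsto_norm[OF lim0], of 4] by simp
  ultimately have "((\<lambda>x. r x - \<omega>) \<longlongrightarrow> 0) G" by (rule Lim_null_comparison)
  thus ?thesis unfolding r_def \<omega>_def by (simp add: LIM_zero_iff)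
qed

lemma direction_at_4_lower:
  assumes lim: "filterlim y (at 4) G" and D: "eventually (\<lambda>x. y x \<in> dessin_set 1) G" and lo: "eventually (\<lambda>x. Im (y x) < 0) G"
  shows "((\<lambda>x. sgn (y x - 4)) \<longlongrightarrow> cis (- pi/3)) G"
proof -
  have "filterlim (\<lambda>x. cnj (y x)) (at 4) G"
  proof -
    have "((\<lambda>x. cnj (y x)) \<longlongrightarrow> cnj 4) G" using lim by (intro tendsto_cnj) (simp add: filterlim_at)
    moreover have "eventually (\<lambda>x. cnj (y x) \<noteq> 4) G"
      using lim unfolding filterlim_at eventually_conj_iff
      by (auto elim!: eventually_mono simp: complex_eq_iff)
    ultimately show ?thesis by (simp add: filterlim_at)
  qed
  moreover have "eventually (\<lambda>x. cnj (y x) \<in> dessin_set 1) G" using D by (simp only: dessin_set_cnj)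
  moreover have "eventually (\<lambda>x. Im (cnj (y x)) > 0) G" using lo by simp
  ultimately have "((\<lambda>x. sgn (cnj (y x) - 4)) \<longlongrightarrow> cis (pi/3)) G" by (rule direction_at_4_upper)
  hence "((\<lambda>x. cnj (sgn (cnj (y x) - 4))) \<longlongrightarrow> cnj (cis (pi/3))) G" by (rule tendsto_cnj)
  moreover have "cnj (sgn (cnj a - 4)) = sgn (a - 4)" for a
    using complex_mod_cnj[of "a - 4"] by (simp add: complex_sgn_def del: complex_mod_cnj)
  ultimately show ?thesis by (simp add: cis_cnj)
qed

text \<open>Vieta's formula for the product of the roots of $(x-4)^3 + 27 w x^2 = 0$.\<close>

lemma hess_map_three_preimages:
  assumes "x \<noteq> 0" "y \<noteq> 0" "z \<noteq> 0" "x \<noteq> y" "x \<noteq> z" "y \<noteq> z"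
    and "hess_map x = hess_map y" "hess_map x = hess_map z"
  shows "x * y * z = 64"
proof -
  have P: "(x*y)^2 - 48*(x*y) + 64*(x+y) = 0" "(x*z)^2 - 48*(x*z) + 64*(x+z) = 0"
    using hess_map_eq_iff[of x y] hess_map_eq_iff[of x z] assms by auto
  have "(y - z) * (x^2 * (y + z) - 48 * x + 64)
     = ((x*y)^2 - 48*(x*y) + 64*(x+y)) - ((x*z)^2 - 48*(x*z) + 64*(x+z))"
    by (simp add: power2_eq_square algebra_simps)
  also have "\<dots> = 0" using P by (simp only: diff_self)
  finally have L: "x^2 * (y + z) - 48 * x + 64 = 0" using assms(6) by simp
  have "x * (64 - x * y * z) = ((x*y)^2 - 48*(x*y) + 64*(x+y)) - y * (x^2 * (y + z) - 48 * x + 64)"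
    by (simp add: power2_eq_square algebra_simps)
  also have "\<dots> = 0" using P L by simp
  finally show ?thesis using assms(1) by simp
qed

lemma iterate_split: "k < n \<Longrightarrow> (hess_map ^^ n) z = (hess_map ^^ (n - Suc k)) (hess_map ((hess_map ^^ k) z))"
proof -
  assume "k < n"
  hence "n = (n - Suc k) + Suc k" by simp
  hence "(hess_map ^^ n) z = (hess_map ^^ ((n - Suc k) + Suc k)) z" by simp
  thus ?thesis by (simp add: funpow_add funpow_swap1)
qed

lemma conformal_at_iterate_1: "\<exists>d. conformal_at (hess_map ^^ l) 1 d"
  by (rule conformal_at_iterate) (auto simp: hess_iterate_1)

text \<open>At most one critical point, $-8$, lies on the orbit, and near $-8$ three distinct points with equal
images would have product $64$ although it is close to $-512$.\<close>

lemma white_two_to_one: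
  assumes z: "z0 \<in> dessin_set n" and w: "(hess_map ^^ n) z0 = 1"
  shows "\<exists>Q. eventually Q (nhds z0) \<and> (\<forall>x y z. Q x \<and> Q y \<and> Q z \<and> (hess_map ^^ n) x = (hess_map ^^ n) y
      \<and> (hess_map ^^ n) x = (hess_map ^^ n) z \<longrightarrow> x = y \<or> x = z \<or> y = z)"
  using white_orbit[OF z w]
proof
  assume "\<forall>j<n. (hess_map ^^ j) z0 \<notin> {0, 4, -8}"
  then obtain d where "conformal_at (hess_map ^^ n) z0 d" using conformal_at_iterate by blast
  then obtain Q where Q: "eventually Q (nhds z0)" "\<forall>x y. Q x \<and> Q y \<and> (hess_map ^^ n) x = (hess_map ^^ n) y \<longrightarrow> x = y"
    unfolding conformal_at_def by blast
  show ?thesis by (rule exI[of _ Q]) (use Q in blast)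
next
  assume "\<exists>k<n. (hess_map ^^ k) z0 = -8 \<and> (\<forall>j<k. (hess_map ^^ j) z0 \<notin> {0, 4, -8})"
  then obtain k where k: "k < n" "(hess_map ^^ k) z0 = -8" "\<forall>j<k. (hess_map ^^ j) z0 \<notin> {0, 4, -8}" by blast
  then obtain d where c: "conformal_at (hess_map ^^ k) z0 d" using conformal_at_iterate by blast
  then obtain Q where Q: "eventually Q (nhds z0)" "\<And>x y. Q x \<Longrightarrow> Q y \<Longrightarrow> (hess_map ^^ k) x = (hess_map ^^ k) y \<Longrightarrow> x = y"
    unfolding conformal_at_def by blast
  obtain d2 where c2: "conformal_at (hess_map ^^ (n - Suc k)) 1 d2" using conformal_at_iterate_1 by blast
  then obtain Q2 where Q2: "eventually Q2 (nhds 1)"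
      "\<And>x y. Q2 x \<Longrightarrow> Q2 y \<Longrightarrow> (hess_map ^^ (n - Suc k)) x = (hess_map ^^ (n - Suc k)) y \<Longrightarrow> x = y"
    unfolding conformal_at_def by blast
  define Q1 where "Q1 x \<longleftrightarrow> dist x (-8) < 1 \<and> Q2 (hess_map x)" for x :: complex
  have "filterlim hess_map (nhds (hess_map (-8))) (nhds (-8))"
    unfolding hess_map_def by (intro tendsto_intros filterlim_ident) auto
  hence "eventually (\<lambda>x. Q2 (hess_map x)) (nhds (-8))" using Q2(1) by (simp add: filterlim_iff)
  moreover have "eventually (\<lambda>x. dist x (-8) < 1) (nhds (-8 :: complex))"
    using eventually_nhds_metric zero_less_one by blast
  ultimately have "eventually Q1 (nhds (-8))" unfolding Q1_def by (rule eventually_conj[rotated])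
  moreover have "filterlim (hess_map ^^ k) (nhds (-8)) (nhds z0)"
    using c DERIV_isCont[of "hess_map ^^ k"] k(2) unfolding conformal_at_def
    by (metis isCont_def tendsto_at_iff_tendsto_nhds)
  ultimately have "eventually (\<lambda>x. Q1 ((hess_map ^^ k) x)) (nhds z0)" by (simp add: filterlim_iff)
  hence ev: "eventually (\<lambda>x. Q x \<and> Q1 ((hess_map ^^ k) x)) (nhds z0)" using Q(1) by (rule eventually_conj[rotated])
  have "x = y \<or> x = z \<or> y = z"
    if q: "Q x \<and> Q1 ((hess_map ^^ k) x)" "Q y \<and> Q1 ((hess_map ^^ k) y)" "Q z \<and> Q1 ((hess_map ^^ k) z)"
      and e: "(hess_map ^^ n) x = (hess_map ^^ n) y" "(hess_map ^^ n) x = (hess_map ^^ n) z" for x y z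
  proof (rule ccontr)
    assume ne: "\<not> (x = y \<or> x = z \<or> y = z)"
    define a b c where "a = (hess_map ^^ k) x" and "b = (hess_map ^^ k) y" and "c = (hess_map ^^ k) z"
    have ne': "a \<noteq> b" "a \<noteq> c" "b \<noteq> c" using ne q Q(2) by (auto simp: a_def b_def c_def)
    have H: "hess_map a = hess_map b" "hess_map a = hess_map c"
      using e q Q2(2) unfolding iterate_split[OF k(1)] a_def b_def c_def Q1_def by blast+
    have big: "7 < cmod v" if "Q1 v" for v
    proof -
      have "cmod (v + 8) < 1" using that by (simp add: Q1_def dist_norm)
      thus ?thesis using norm_triangle_ineq2[of "-8" "- v"] norm_triangle_ineq4[of "v + 8" v] by simp
    qed
    have ba: "7 < cmod a" "7 < cmod b" "7 < cmod c" using q big by (auto simp: a_def b_def c_def)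
    hence "a \<noteq> 0" "b \<noteq> 0" "c \<noteq> 0" by auto
    hence "a * b * c = 64" using hess_map_three_preimages ne' H by blast
    hence "cmod a * cmod b * cmod c = 64" by (metis norm_mult norm_numeral)
    moreover have "7 * 7 * 7 \<le> cmod a * cmod b * cmod c" using ba by (intro mult_mono) auto
    ultimately show False by simp
  qed
  thus ?thesis using ev by blast
qed

text \<open>If the orbit passes through $-8$, the iterate is, up to conformal maps, a square near the vertex;
since its values on the dessin are at most $1$, the square of the direction is determined.\<close>

lemma white_direction:
  assumes z: "z0 \<in> dessin_set n" and w: "(hess_map ^^ n) z0 = 1"
  shows "\<exists>\<kappa>. \<forall>(G :: real filter) \<zeta> u. G \<noteq> bot \<longrightarrow> filterlim \<zeta> (at z0) G \<longrightarrow> eventually (\<lambda>x. \<zeta> x \<in> dessin_set n) G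
      \<longrightarrow> ((\<lambda>x. sgn (\<zeta> x - z0)) \<longlongrightarrow> u) G \<longrightarrow> u^2 = \<kappa>"
proof -
  have fin: "sgn ((hess_map ^^ n) x - 1) = -1" if "x \<in> dessin_set n" "(hess_map ^^ n) x \<noteq> 1" for x
  proof -
    have "seg01 ((hess_map ^^ n) x)" using dessin_set_iterate[of x n 0] that by simp
    hence "(hess_map ^^ n) x - 1 = of_real (Re ((hess_map ^^ n) x) - 1)" "Re ((hess_map ^^ n) x) - 1 < 0"
      using that(2) by (auto simp: seg01_def complex_eq_iff)
    thus ?thesis by (metis of_real_1 of_real_minus sgn_of_real sgn_neg)
  qed
  show ?thesis using white_orbit[OF z w]
  proof
    assume "\<forall>j<n. (hess_map ^^ j) z0 \<notin> {0, 4, -8}"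
    then obtain d where c: "conformal_at (hess_map ^^ n) z0 d" using conformal_at_iterate by blast
    have d: "sgn d \<noteq> 0" using c by (auto simp: conformal_at_def sgn_zero_iff)
    have "u^2 = (-1 / sgn d)^2" if G: "G \<noteq> bot" "filterlim \<zeta> (at z0) G" "eventually (\<lambda>x. \<zeta> x \<in> dessin_set n) G"
        "((\<lambda>x. sgn (\<zeta> x - z0)) \<longlongrightarrow> u) G" for G :: "real filter" and \<zeta> u
    proof -
      have l: "((\<lambda>x. sgn ((hess_map ^^ n) (\<zeta> x) - 1)) \<longlongrightarrow> sgn d * u) G"
        using conformal_direction[OF c G(2)] G(4) w by simp
      have "eventually (\<lambda>x. (hess_map ^^ n) (\<zeta> x) \<noteq> 1) G"
        using conformal_filterlim[OF c G(2)] w by (simp add: filterlim_at eventually_conj_iff)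
      with G(3) have "eventually (\<lambda>x. sgn ((hess_map ^^ n) (\<zeta> x) - 1) = -1) G"
        by eventually_elim (rule fin)
      hence "((\<lambda>x. sgn ((hess_map ^^ n) (\<zeta> x) - 1)) \<longlongrightarrow> -1) G" by (rule tendsto_eventually)
      hence "sgn d * u = -1" using l tendsto_unique[OF G(1)] by blast
      hence "u = -1 / sgn d" using d by (simp add: field_simps)
      thus ?thesis by simp
    qed
    thus ?thesis by blast
  next
    assume "\<exists>k<n. (hess_map ^^ k) z0 = -8 \<and> (\<forall>j<k. (hess_map ^^ j) z0 \<notin> {0, 4, -8})"
    then obtain k where k: "k < n" "(hess_map ^^ k) z0 = -8" "\<forall>j<k. (hess_map ^^ j) z0 \<notin> {0, 4, -8}" by blast
    then obtain d where c: "conformal_at (hess_map ^^ k) z0 d" using conformal_at_iterate by blast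
    obtain d2 where c2: "conformal_at (hess_map ^^ (n - Suc k)) 1 d2" using conformal_at_iterate_1 by blast
    have d: "sgn d \<noteq> 0" "sgn d2 \<noteq> 0" using c c2 by (auto simp: conformal_at_def sgn_zero_iff)
    have "u^2 = -1 / (sgn d2 * sgn d ^ 2)" if G: "G \<noteq> bot" "filterlim \<zeta> (at z0) G" "eventually (\<lambda>x. \<zeta> x \<in> dessin_set n) G"
        "((\<lambda>x. sgn (\<zeta> x - z0)) \<longlongrightarrow> u) G" for G :: "real filter" and \<zeta> u
    proof -
      define y where "y = (\<lambda>x. (hess_map ^^ k) (\<zeta> x))"
      have y: "filterlim y (at (-8)) G" using conformal_filterlim[OF c G(2)] k(2) by (simp add: y_def)
      hence yl: "(y \<longlongrightarrow> -8) G" and yne: "eventually (\<lambda>x. y x \<noteq> -8) G"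
        by (simp_all add: filterlim_at eventually_conj_iff)
      have ysg: "((\<lambda>x. sgn (y x - (-8))) \<longlongrightarrow> sgn d * u) G"
        using conformal_direction[OF c G(2)] G(4) k(2) by (simp add: y_def)
      have y1: "eventually (\<lambda>x. y x \<noteq> 1) G" "eventually (\<lambda>x. y x \<noteq> 0) G"
        using yl by (auto intro: tendsto_imp_eventually_ne)
      have hl: "filterlim (\<lambda>x. hess_map (y x)) (at 1) G"
      proof -
        have "((\<lambda>x. hess_map (y x)) \<longlongrightarrow> hess_map (-8)) G"
          unfolding hess_map_def by (intro tendsto_intros yl) auto
        moreover have "eventually (\<lambda>x. hess_map (y x) \<noteq> 1) G"
          using y1 yne by eventually_elim (simp add: hess_map_eq_1)
        ultimately show ?thesis by (simp add: filterlim_at)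
      qed
      have "((\<lambda>x. sgn (- (y x - 1) / (27 * y x ^ 2))) \<longlongrightarrow> sgn (- (-8 - 1) / (27 * (-8)^2))) G"
        by (intro tendsto_intros yl) auto
      moreover have "sgn (- (-8 - 1) / (27 * (-8)^2) :: complex) = 1"
        by (simp add: complex_sgn_def norm_divide scaleR_conv_of_real)
      ultimately have "((\<lambda>x. sgn (- (y x - 1) / (27 * y x ^ 2)) * sgn (y x - (-8)) ^ 2) \<longlongrightarrow> 1 * (sgn d * u)^2) G"
        by (intro tendsto_intros ysg) simp
      hence "((\<lambda>x. sgn (hess_map (y x) - 1)) \<longlongrightarrow> 1 * (sgn d * u)^2) G"
        by (rule Lim_transform_eventually)
          (use y1(2) in \<open>eventually_elim, simp add: hess_map_minus_1 sgn_mult_complex sgn_divide_complex power2_eq_square\<close>)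
      hence "((\<lambda>x. sgn ((hess_map ^^ (n - Suc k)) (hess_map (y x)) - 1)) \<longlongrightarrow> sgn d2 * (sgn d * u)^2) G"
        using conformal_direction[OF c2 hl] by (simp add: hess_iterate_1)
      hence l: "((\<lambda>x. sgn ((hess_map ^^ n) (\<zeta> x) - 1)) \<longlongrightarrow> sgn d2 * (sgn d * u)^2) G"
        unfolding iterate_split[OF k(1)] y_def .
      have "eventually (\<lambda>x. (hess_map ^^ n) (\<zeta> x) \<noteq> 1) G"
        using conformal_filterlim[OF c2 hl]
        by (simp add: filterlim_at eventually_conj_iff hess_iterate_1 iterate_split[OF k(1)] y_def)
      with G(3) have "eventually (\<lambda>x. sgn ((hess_map ^^ n) (\<zeta> x) - 1) = -1) G"
        by eventually_elim (rule fin)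
      hence "((\<lambda>x. sgn ((hess_map ^^ n) (\<zeta> x) - 1)) \<longlongrightarrow> -1) G" by (rule tendsto_eventually)
      hence "sgn d2 * (sgn d * u)^2 = -1" using l tendsto_unique[OF G(1)] by blast
      thus ?thesis using d by (simp add: field_simps power_mult_distrib)
    qed
    thus ?thesis by blast
  qed
qed

section \<open>Directions of germs in the double\<close>

lemma cis_Arg_sgn: "z \<noteq> 0 \<Longrightarrow> cis (Arg z) = sgn z"
  by (simp add: cis_Arg)

text \<open>At a point inside an edge the interior angle is already $\pi$, so rescaling angles amounts to
rotating the edge onto the real axis.\<close>

lemma sector_coord_edge:
  assumes e: "cmod e = 1" and upper: "\<And>z. z \<in> S \<Longrightarrow> Im ((z - v) / e) \<ge> 0"
    and c: "Im ((c - v) / e) > 0"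
    and d1: "d1 > 0" "v + of_real d1 * e \<in> S" and d2: "d2 > 0" "v - of_real d2 * e \<in> S"
    and z: "z \<in> S"
  shows "sector_coord S c v z = (z - v) / e"
proof -
  have e0: "e \<noteq> 0" using e by auto
  define \<psi> where "\<psi> = Arg ((c - v) / e)"
  have psi: "0 < \<psi>" "\<psi> < pi" using c Arg_lt_pi[of "(c - v) / e"] by (auto simp: \<psi>_def)
  have cv: "c - v \<noteq> 0" using c by auto
  have ang: "sector_angle c v x = Arg ((x - v) / e) - \<psi>" if x: "x \<in> S" "x \<noteq> v" for x
  proof -
    have xv: "(x - v) / e \<noteq> 0" using x e0 by simp
    have chi: "0 \<le> Arg ((x - v) / e)" "Arg ((x - v) / e) \<le> pi"
      using upper[OF x(1)] Arg_le_pi[of "(x - v) / e"] Arg_less_0[of "(x - v) / e"] by auto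
    have q: "(x - v) / (c - v) = ((x - v) / e) / ((c - v) / e)" using e0 by simp
    have "sgn ((x - v) / (c - v)) = cis (Arg ((x - v) / e)) / cis \<psi>"
      unfolding q sgn_divide_complex \<psi>_def using xv cv e0 by (simp add: cis_Arg_sgn sgn_divide_complex)
    also have "\<dots> = cis (Arg ((x - v) / e) - \<psi>)" by (simp add: cis_divide)
    finally have "sgn ((x - v) / (c - v)) = cis (Arg ((x - v) / e) - \<psi>)" .
    thus ?thesis unfolding sector_angle_def using chi psi
      by (intro cis_Arg_unique) auto
  qed
  have nonneg: "0 \<le> Arg ((x - v) / e)" "Arg ((x - v) / e) \<le> pi" if "x \<in> S" for x
    using upper[OF that] Arg_le_pi[of "(x - v) / e"] Arg_less_0[of "(x - v) / e"] by auto
  have lo: "Inf (sector_angle c v ` (S - {v})) = - \<psi>"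
  proof (rule cInf_eq_minimum)
    have "sector_angle c v (v + of_real d1 * e) = - \<psi>"
      using ang[OF d1(2)] d1(1) e0 by simp
    thus "- \<psi> \<in> sector_angle c v ` (S - {v})" using d1 e0 by (intro image_eqI[of _ _ "v + of_real d1 * e"]) auto
  next
    fix y assume "y \<in> sector_angle c v ` (S - {v})"
    thus "- \<psi> \<le> y" using ang nonneg by auto
  qed
  have hi: "Sup (sector_angle c v ` (S - {v})) = pi - \<psi>"
  proof (rule cSup_eq_maximum)
    have "sector_angle c v (v - of_real d2 * e) = pi - \<psi>"
      using ang[OF d2(2)] d2(1) e0 Arg_of_real[of "- d2"] by simp
    thus "pi - \<psi> \<in> sector_angle c v ` (S - {v})" using d2 e0 by (intro image_eqI[of _ _ "v - of_real d2 * e"]) auto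
  next
    fix y assume "y \<in> sector_angle c v ` (S - {v})"
    thus "y \<le> pi - \<psi>" using ang nonneg by auto
  qed
  show ?thesis
  proof (cases "z = v")
    case True
    thus ?thesis by (simp add: sector_coord_def Let_def rcis_def)
  next
    case False
    have "sector_coord S c v z = rcis (cmod (z - v)) (Arg ((z - v) / e))"
      unfolding sector_coord_def Let_def lo hi ang[OF z False] by simp
    also have "cmod (z - v) = cmod ((z - v) / e)" using e by (simp add: norm_divide)
    finally show ?thesis by (simp add: rcis_cmod_Arg)
  qed
qed

lemma sgn_conj_unless: "sgn (conj_unless b x) = conj_unless b (sgn x)"
proof -
  have "sgn (cnj x) = cnj (sgn x)" by (simp add: complex_sgn_def)
  thus ?thesis by (simp add: conj_unless_def)
qed

context frame
begin

abbreviation "centroid \<equiv> (p0 + p1 + pinf) / 3"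

lemma centroid_point: "centroid = point (1/3, 1/3, 1/3)"
  by (simp add: point_def scaleR_conv_of_real add_divide_distrib)

text \<open>The height of a point above an edge is, up to a positive factor, the determinant that the point
forms with the endpoints of the edge. The chart rotates the edge to the real axis, in the direction
that has the triangle on its left, and so reverses the edge if the triangle is negatively oriented.\<close>

lemma sector_coord_between:
  assumes k: "k \<in> std_simplex" "k' \<in> std_simplex" and t: "0 < t" "t < 1" and l: "l = mix t k k'"
    and v: "\<And>m. m \<in> std_simplex \<Longrightarrow> bary_det k k' m \<ge> 0" "bary_det k k' (1/3, 1/3, 1/3) > 0"
  shows "\<exists>e. e \<noteq> 0 \<and> (\<forall>m \<in> std_simplex. sector_coord T centroid (point l) (point m) = (point m - point l) / e
      \<and> (bary_det k k' m = 0 \<longrightarrow> Im ((point m - point l) / e) = 0))"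
proof -
  define E where "E = point k' - point k"
  have cs: "(1/3, 1/3, 1/3) \<in> std_simplex" by (simp add: std_simplex_def)
  have E0: "E \<noteq> 0"
  proof
    assume "E = 0"
    hence "bary_det k k' (1/3, 1/3, 1/3) * area = 0" using point_bary_det[OF k cs] by (simp add: E_def)
    thus False using v(2) area_nonzero by simp
  qed
  \<comment> \<open>The unit direction of the edge that has the triangle on its left.\<close>
  define e where "e = of_real (sgn area / cmod E) * E"
  have ne: "cmod e = 1" using E0 area_nonzero by (simp add: e_def norm_mult norm_divide abs_sgn_eq)
  have Jl: "point l = point k + of_real t * E" unfolding l point_mix E_def by (simp add: scaleR_conv_of_real algebra_simps)
  have Im: "Im ((point m - point l) / e) = \<bar>area\<bar> * bary_det k k' m / cmod E" if m: "m \<in> std_simplex" for m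
  proof -
    have s2: "sgn area * sgn area = 1" using area_nonzero by (simp add: sgn_if)
    have "(point m - point l) / e = of_real (sgn area / cmod E) * (cnj E * (point m - point l))"
    proof -
      have "of_real (cmod E) * of_real (cmod E) = E * cnj E" using complex_norm_square[of E] by (simp add: power2_eq_square)
      moreover have "complex_of_real (sgn area) * of_real (sgn area) = 1" using s2 by (metis of_real_1 of_real_mult)
      ultimately show ?thesis unfolding e_def using E0 area_nonzero
        by (simp add: divide_simps)
    qed
    hence "Im ((point m - point l) / e) = sgn area / cmod E * Im (cnj E * (point m - point l))" by simp
    also have "cnj E * (point m - point l) = cnj E * (point m - point k) - of_real (t * cmod E ^ 2)"
      unfolding Jl complex_norm_square of_real_mult by (simp add: algebra_simps)
    also have "Im \<dots> = bary_det k k' m * area" using point_bary_det[OF k m] by (simp add: E_def)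
    finally show ?thesis by (simp add: abs_sgn mult_ac)
  qed
  have mem: "point m \<in> T" if "m \<in> std_simplex" for m using that point_image by blast
  have sc: "sector_coord T centroid (point l) (point m) = (point m - point l) / e" if m: "m \<in> std_simplex" for m
  proof -
    have up: "Im ((z - point l) / e) \<ge> 0" if "z \<in> T" for z
    proof -
      have "z \<in> point ` std_simplex" using that by (simp only: point_image)
      then obtain m where m: "m \<in> std_simplex" "z = point m" by (rule imageE)
      have "\<bar>area\<bar> * bary_det k k' m / cmod E \<ge> 0" using v(1)[OF m(1)] by simp
      thus ?thesis unfolding m(2) Im[OF m(1)] .
    qed
    have c: "Im ((centroid - point l) / e) > 0"
      unfolding centroid_point Im[OF cs] using v(2) E0 area_nonzero by simp
    have B: "point k' = point l + of_real ((1 - t) * cmod E * sgn area) * e" "point k = point l - of_real (t * cmod E * sgn area) * e"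
    proof -
      have "of_real (cmod E * sgn area) * e = of_real ((cmod E * sgn area) * (sgn area / cmod E)) * E"
        unfolding e_def by (simp only: of_real_mult mult.assoc)
      also have "(cmod E * sgn area) * (sgn area / cmod E) = 1" using area_nonzero E0 by (simp add: sgn_if)
      finally have "of_real (cmod E * sgn area) * e = E" by simp
      hence "of_real ((1 - t) * cmod E * sgn area) * e = of_real (1 - t) * E" "of_real (t * cmod E * sgn area) * e = of_real t * E"
        by (simp_all add: mult.assoc)
      thus "point k' = point l + of_real ((1 - t) * cmod E * sgn area) * e" "point k = point l - of_real (t * cmod E * sgn area) * e"
        unfolding Jl by (simp_all add: E_def algebra_simps)
    qed
    show ?thesis
    proof (cases "area > 0")
      case True
      hence "point l + of_real ((1 - t) * cmod E) * e \<in> T" "point l - of_real (t * cmod E) * e \<in> T"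
        using B mem[OF k(1)] mem[OF k(2)] by simp_all
      thus ?thesis using t E0 mem[OF m]
        by (intro sector_coord_edge[OF ne up c, where ?d1.0 = "(1 - t) * cmod E" and ?d2.0 = "t * cmod E"]) simp_all
    next
      case False
      hence "sgn area = -1" using area_nonzero by simp
      hence "point l + of_real (t * cmod E) * e \<in> T" "point l - of_real ((1 - t) * cmod E) * e \<in> T"
        using B mem[OF k(1)] mem[OF k(2)] by simp_all
      thus ?thesis using t E0 mem[OF m]
        by (intro sector_coord_edge[OF ne up c, where ?d1.0 = "t * cmod E" and ?d2.0 = "(1 - t) * cmod E"]) simp_all
    qed
  qed
  have "e \<noteq> 0" using ne by auto
  moreover have "Im ((point m - point l) / e) = 0" if "m \<in> std_simplex" "bary_det k k' m = 0" for m
    unfolding Im[OF that(1)] that(2) by simp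
  ultimately show ?thesis using sc by blast
qed

lemma sector_coord_nonvertex:
  assumes l: "l \<in> std_simplex" and fr: "point l \<in> frontier T"
    and nv: "fst l \<noteq> 1" "fst (snd l) \<noteq> 1" "snd (snd l) \<noteq> 1"
  shows "\<exists>e. e \<noteq> 0 \<and> (\<forall>m \<in> std_simplex. sector_coord T centroid (point l) (point m) = (point m - point l) / e
      \<and> (side01 l \<and> side01 m \<or> side1i l \<and> side1i m \<or> sidei0 l \<and> sidei0 m \<longrightarrow> Im ((point m - point l) / e) = 0))"
proof -
  obtain x y z where c: "l = (x, y, z)" by (cases l)
  have s: "0 \<le> x" "0 \<le> y" "0 \<le> z" "x + y + z = 1" "x \<noteq> 1" "y \<noteq> 1" "z \<noteq> 1"
    using l nv by (auto simp: std_simplex_def c)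
  have S: "(1,0,0) \<in> std_simplex" "(0,1,0) \<in> std_simplex" "(0,0,1) \<in> std_simplex" by (auto simp: std_simplex_def)
  have V: "bary_det (1,0,0) (0,1,0) m = snd (snd m)" "bary_det (0,1,0) (0,0,1) m = fst m" "bary_det (0,0,1) (1,0,0) m = fst (snd m)" for m
    by (cases m; simp add: bary_det_def)+
  have nn: "fst m \<ge> 0" "fst (snd m) \<ge> 0" "snd (snd m) \<ge> 0" if "m \<in> std_simplex" for m
    using that by (auto simp: std_simplex_def)
  consider "z = 0" | "x = 0" | "y = 0"
    using fr frontier_T[OF l] by (auto simp: c side01_def side1i_def sidei0_def)
  thus ?thesis
  proof cases
    case 1
    hence ne: "x \<noteq> 0" "y \<noteq> 0" using s by auto
    have "l = mix y (1,0,0) (0,1,0)" using 1 s by (auto simp: c mix_def)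
    moreover have "0 < y" "y < 1" using s ne by auto
    ultimately obtain e where "e \<noteq> 0" "\<forall>m \<in> std_simplex. sector_coord T centroid (point l) (point m) = (point m - point l) / e
      \<and> (bary_det (1,0,0) (0,1,0) m = 0 \<longrightarrow> Im ((point m - point l) / e) = 0)"
      using sector_coord_between[OF S(1,2), of y l] nn V by auto
    moreover have "bary_det (1,0,0) (0,1,0) m = 0" if "side01 l \<and> side01 m \<or> side1i l \<and> side1i m \<or> sidei0 l \<and> sidei0 m" for m
      using that s 1 ne unfolding V by (auto simp: c side01_def side1i_def sidei0_def)
    ultimately show ?thesis by blast
  next
    case 2
    hence ne: "y \<noteq> 0" "z \<noteq> 0" using s by auto
    have "l = mix z (0,1,0) (0,0,1)" using 2 s by (auto simp: c mix_def)
    moreover have "0 < z" "z < 1" using s ne by auto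
    ultimately obtain e where "e \<noteq> 0" "\<forall>m \<in> std_simplex. sector_coord T centroid (point l) (point m) = (point m - point l) / e
      \<and> (bary_det (0,1,0) (0,0,1) m = 0 \<longrightarrow> Im ((point m - point l) / e) = 0)"
      using sector_coord_between[OF S(2,3), of z l] nn V by auto
    moreover have "bary_det (0,1,0) (0,0,1) m = 0" if "side01 l \<and> side01 m \<or> side1i l \<and> side1i m \<or> sidei0 l \<and> sidei0 m" for m
      using that s 2 ne unfolding V by (auto simp: c side01_def side1i_def sidei0_def)
    ultimately show ?thesis by blast
  next
    case 3
    hence ne: "x \<noteq> 0" "z \<noteq> 0" using s by auto
    have "l = mix x (0,0,1) (1,0,0)" using 3 s by (auto simp: c mix_def)
    moreover have "0 < x" "x < 1" using s ne by auto
    ultimately obtain e where "e \<noteq> 0" "\<forall>m \<in> std_simplex. sector_coord T centroid (point l) (point m) = (point m - point l) / e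
      \<and> (bary_det (0,0,1) (1,0,0) m = 0 \<longrightarrow> Im ((point m - point l) / e) = 0)"
      using sector_coord_between[OF S(3,1), of x l] nn V by auto
    moreover have "bary_det (0,0,1) (1,0,0) m = 0" if "side01 l \<and> side01 m \<or> side1i l \<and> side1i m \<or> sidei0 l \<and> sidei0 m" for m
      using that s 3 ne unfolding V by (auto simp: c side01_def side1i_def sidei0_def)
    ultimately show ?thesis by blast
  qed
qed

definition chart :: "bool \<Rightarrow> complex \<times> bool \<Rightarrow> complex \<times> bool \<Rightarrow> complex" where
  "chart pos p x = (if pos then double_coord T centroid p x else cnj (double_coord T centroid p x))"

lemma chart_alt:
  "chart pos p x = conj_unless pos (conj_unless (snd x)
     (if fst p \<in> frontier T then sector_coord T centroid (fst p) (fst x) else fst x - fst p))"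
  by (simp add: chart_def double_coord_def conj_unless_def Let_def)

lemma mix_sides:
  assumes "l \<in> std_simplex" "m \<in> std_simplex" "0 < e" "e < 1"
  shows "side01 (mix e l m) \<longleftrightarrow> side01 l \<and> side01 m" "side1i (mix e l m) \<longleftrightarrow> side1i l \<and> side1i m" "sidei0 (mix e l m) \<longleftrightarrow> sidei0 l \<and> sidei0 m"
proof -
  have *: "(1 - e) * a + e * b = 0 \<longleftrightarrow> a = 0 \<and> b = 0" if "a \<ge> 0" "b \<ge> 0" for a b
    using assms(3,4) that by (auto simp: add_nonneg_eq_0_iff)
  show "side01 (mix e l m) \<longleftrightarrow> side01 l \<and> side01 m" "side1i (mix e l m) \<longleftrightarrow> side1i l \<and> side1i m" "sidei0 (mix e l m) \<longleftrightarrow> sidei0 l \<and> sidei0 m"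
    using assms(1,2) by (cases l; cases m; simp add: side01_def side1i_def sidei0_def mix_def std_simplex_def *)+
qed

definition arc_pt :: "tile list \<Rightarrow> bool \<Rightarrow> real \<Rightarrow> complex \<times> bool" where
  "arc_pt w s e = double_proj T (point (word_map w (edge_pt e)), s)"

text \<open>An edge of the subdivided triangle is a segment, and apart from its endpoints it lies entirely in the
boundary of the triangle or entirely inside; so its points have constant direction in every chart,
including the rescaled charts at the vertices of the triangle.\<close>

lemma direction_constant:
  assumes "e0 = 0 \<or> e0 = 1"
  shows "\<exists>d. \<forall>e. 0 < e \<and> e < 1 \<longrightarrow> sgn (chart pos (arc_pt w s e0) (arc_pt w s e)) = d"
proof -
  define l m where "l = word_map w (edge_pt 0)" and "m = word_map w (edge_pt 1)"
  have lm: "l \<in> std_simplex" "m \<in> std_simplex" by (simp_all add: l_def m_def word_map_simplex edge_pt_simplex)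
  have mixe: "word_map w (edge_pt e) = mix e l m" for e
    unfolding l_def m_def word_map_mix[symmetric] by (simp add: mix_def edge_pt_def)
  define v where "v = point (word_map w (edge_pt e0))"
  define q where "q = (if e0 = 0 then point m - point l else point l - point m)"
  define \<phi> where "\<phi> \<longleftrightarrow> side01 l \<and> side01 m \<or> side1i l \<and> side1i m \<or> sidei0 l \<and> sidei0 m"
  define r where "r e = (if e0 = 0 then e else 1 - e)" for e :: real
  have z: "point (word_map w (edge_pt e)) - v = r e *\<^sub>R q" for e
    using assms unfolding v_def mixe point_mix q_def r_def by (auto simp: algebra_simps)
  have fr: "point (word_map w (edge_pt e)) \<in> frontier T \<longleftrightarrow> \<phi>" if "0 < e" "e < 1" for e
  proof -
    have "mix e l m \<in> std_simplex" using lm that by (intro mix_simplex) auto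
    thus ?thesis unfolding mixe using frontier_T mix_sides[OF lm that] \<phi>_def by simp
  qed
  have scal: "sgn (r e *\<^sub>R q) = sgn q" if "0 < e" "e < 1" for e
    using that by (simp add: r_def sgn_scaleR)
  define \<theta> where "\<theta> = pi * (Arg (q / (centroid - v)) - Inf (sector_angle centroid v ` (T - {v}))) /
      (Sup (sector_angle centroid v ` (T - {v})) - Inf (sector_angle centroid v ` (T - {v})))"
  have sec: "sgn (sector_coord T centroid v (point (word_map w (edge_pt e)))) = of_real (sgn (cmod q)) * cis \<theta>" if e: "0 < e" "e < 1" for e
  proof -
    have re: "r e > 0" using e by (simp add: r_def)
    have "sector_angle centroid v (point (word_map w (edge_pt e))) = Arg (q / (centroid - v))"
    proof -
      have e1: "(r e *\<^sub>R q) / (centroid - v) = of_real (r e) * (q / (centroid - v))" by (simp add: scaleR_conv_of_real)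
      show ?thesis unfolding sector_angle_def z e1 by (rule Arg_times_of_real[OF re])
    qed
    hence "sector_coord T centroid v (point (word_map w (edge_pt e))) = rcis (r e * cmod q) \<theta>"
      unfolding sector_coord_def Let_def \<theta>_def z using re by simp
    also have "sgn \<dots> = of_real (sgn (cmod q)) * cis \<theta>"
      unfolding rcis_def sgn_mult_complex sgn_of_real using re by (simp add: sgn_mult complex_sgn_def)
    finally show ?thesis .
  qed
  have "sgn (chart pos (arc_pt w s e0) (arc_pt w s e)) = conj_unless pos (conj_unless (s \<or> \<phi>)
     (if v \<in> frontier T then of_real (sgn (cmod q)) * cis \<theta> else sgn q))" if e: "0 < e" "e < 1" for e
    unfolding chart_alt sgn_conj_unless arc_pt_def double_proj_def prod.case fst_conv snd_conv fr[OF e]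
    using sec[OF e] scal[OF e] z[of e] by (simp add: v_def[symmetric])
  thus ?thesis by blast
qed

end

text \<open>The point $b$: every edge at a black vertex is the image under an inverse branch of the edge from $b$
to $1$ (first tile) or to $a$ (the other two tiles); see \<open>tile_map_edge_pt\<close>.\<close>

definition branch_pt :: bary where "branch_pt = (0, 1/2, 1/2)"

definition edge_end :: "tile \<Rightarrow> bary" where "edge_end i = (if i = T1 then (0, 1, 0) else (1/2, 0, 1/2))"

lemma tile_map_edge_pt: "tile_map i (edge_pt e) = mix e branch_pt (edge_end i)"
  by (cases i) (auto simp: edge_pt_def mix_def branch_pt_def edge_end_def field_simps)

lemma bary_points: "branch_pt \<in> std_simplex" "edge_end i \<in> std_simplex"
  by (auto simp: branch_pt_def edge_end_def std_simplex_def)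

text \<open>The real sign of the imaginary part at the corresponding point near $4$; see \<open>ray_label\<close>. The
argument \<open>r\<close> tells whether the copy of the triangle goes to the upper half-plane.\<close>

definition germ_label :: "tile list \<Rightarrow> bool \<Rightarrow> tile \<Rightarrow> real" where
  "germ_label w r i = (if i = T1 then 0 else if word_sign w = r then 1 else -1)"

lemma Im_conj_unless_mult:
  "Im (cnj (conj_unless b x) * conj_unless b y) = (if b then 1 else -1) * Im (cnj x * y)"
  by (simp add: conj_unless_def)

lemma conj_unless_real: "Im x = 0 \<Longrightarrow> conj_unless b x = x"
  by (auto simp: conj_unless_def complex_eq_iff)

lemma norm_conj_unless [simp]: "cmod (conj_unless b x) = cmod x" by (simp add: conj_unless_def)

context frame
begin

text \<open>A black vertex is the midpoint of an edge of a triangle of $\mathcal{T}_{n-1}$. Hence it is not a vertex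
of $T$, and its chart is a rotation or a translation, possibly followed by conjugation. The side on
which the germs with nonzero label lie is then the sign of a determinant, which \<open>bary_det_word_map\<close>
relates to the sign of the word.\<close>

lemma branch_directions:
  assumes up: "up \<longleftrightarrow> (pos \<longleftrightarrow> area > 0)"
  shows "\<exists>D. (\<forall>i e. 0 < e \<and> e < 1 \<longrightarrow> sgn (chart pos (arc_pt (w @ [T1]) s 0) (arc_pt (w @ [i]) s e)) = D i)
    \<and> (\<forall>i. cmod (D i) = 1) \<and> (\<forall>i. i \<noteq> T1 \<longrightarrow> Im (cnj (D T1) * D i) * germ_label w (s = up) i < 0)"
proof -
  define l where "l = word_map w branch_pt"
  define k where "k i = word_map w (edge_end i)" for i
  have S: "l \<in> std_simplex" "k i \<in> std_simplex" for i
    using bary_points by (simp_all add: l_def k_def word_map_simplex)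
  define v where "v = point l"
  have p: "point (mix 0 l (k T1)) = v" by (simp add: v_def mix_def)
  have x: "arc_pt (w @ [i]) s e = double_proj T (point (mix e l (k i)), s)" for i e
    by (simp add: arc_pt_def word_map_append tile_map_edge_pt word_map_mix l_def k_def)
  define q where "q i = point (k i) - v" for i
  have z: "point (mix e l (k i)) - v = e *\<^sub>R q i" for i e
    by (simp add: point_mix q_def v_def algebra_simps)
  have zin: "mix e l (k i) \<in> std_simplex" if "0 < e" "e < 1" for e i using S that by (intro mix_simplex) auto
  obtain E where E: "E \<noteq> 0" and CE: "\<And>i e. 0 < e \<Longrightarrow> e < 1 \<Longrightarrow>
      chart pos (arc_pt (w @ [T1]) s 0) (arc_pt (w @ [i]) s e) = conj_unless (pos = s) (e *\<^sub>R q i / E)"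
  proof (cases "v \<in> frontier T")
    case False
    have "chart pos (arc_pt (w @ [T1]) s 0) (arc_pt (w @ [i]) s e) = conj_unless (pos = s) (e *\<^sub>R q i / 1)" if e: "0 < e" "e < 1" for i e
    proof -
      have "point (mix e l (k i)) \<notin> frontier T"
        using False frontier_T[OF S(1)] frontier_T[OF zin[OF e]] mix_sides[OF S(1) S(2) e] by (auto simp: v_def)
      thus ?thesis unfolding x p chart_alt double_proj_def prod.case fst_conv snd_conv conj_unless_conj_unless
        using False z by simp
    qed
    thus ?thesis using that[of 1] by simp
  next
    case True
    have ne: "word_map w (0,1,0) \<noteq> word_map w (0,0,1)"
      by (subst word_map_eq_iff) (auto simp: std_simplex_def)
    have mid: "l = mix (1/2) (word_map w (0,1,0)) (word_map w (0,0,1))"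
      unfolding l_def word_map_mix[symmetric] by (simp add: mix_def branch_pt_def)
    have mem: "word_map w (0,1,0) \<in> std_simplex" "word_map w (0,0,1) \<in> std_simplex"
      by (rule word_map_simplex, simp add: std_simplex_def)+
    have nv: "fst l \<noteq> 1" "fst (snd l) \<noteq> 1" "snd (snd l) \<noteq> 1"
    proof -
      obtain a b c where 1: "word_map w (0,1,0) = (a, b, c)" by (metis prod_cases3)
      obtain a' b' c' where 2: "word_map w (0,0,1) = (a', b', c')" by (metis prod_cases3)
      have s: "0 \<le> a" "0 \<le> b" "0 \<le> c" "a + b + c = 1" "0 \<le> a'" "0 \<le> b'" "0 \<le> c'" "a' + b' + c' = 1"
        "(a, b, c) \<noteq> (a', b', c')"
        using mem ne unfolding 1 2 by (auto simp: std_simplex_def)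
      have L: "l = ((a + a')/2, (b + b')/2, (c + c')/2)" unfolding mid 1 2 by (simp add: mix_def)
      show "fst l \<noteq> 1" "fst (snd l) \<noteq> 1" "snd (snd l) \<noteq> 1"
        unfolding L using s by auto
    qed
    obtain E where E: "E \<noteq> 0" "\<And>m. m \<in> std_simplex \<Longrightarrow> sector_coord T centroid v (point m) = (point m - v) / E"
        "\<And>m. m \<in> std_simplex \<Longrightarrow> side01 l \<and> side01 m \<or> side1i l \<and> side1i m \<or> sidei0 l \<and> sidei0 m \<Longrightarrow> Im ((point m - v) / E) = 0"
      using sector_coord_nonvertex[OF S(1) _ nv] True unfolding v_def by blast
    have "chart pos (arc_pt (w @ [T1]) s 0) (arc_pt (w @ [i]) s e) = conj_unless (pos = s) (e *\<^sub>R q i / E)" if e: "0 < e" "e < 1" for i e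
    proof (cases "point (mix e l (k i)) \<in> frontier T")
      case f: False
      thus ?thesis unfolding x p chart_alt double_proj_def prod.case fst_conv snd_conv conj_unless_conj_unless
        using True E(2)[OF zin[OF e]] z by simp
    next
      case f: True
      hence "side01 (mix e l (k i)) \<or> side1i (mix e l (k i)) \<or> sidei0 (mix e l (k i))" using frontier_T[OF zin[OF e]] by simp
      hence "side01 l \<and> side01 (mix e l (k i)) \<or> side1i l \<and> side1i (mix e l (k i)) \<or> sidei0 l \<and> sidei0 (mix e l (k i))"
        using mix_sides[OF S(1) S(2) e] by blast
      hence "Im ((point (mix e l (k i)) - v) / E) = 0" using E(3) zin[OF e] by blast
      hence "Im (e *\<^sub>R q i / E) = 0" unfolding z .
      hence r: "conj_unless b (e *\<^sub>R q i / E) = e *\<^sub>R q i / E" for b by (rule conj_unless_real)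
      show ?thesis unfolding x p chart_alt double_proj_def prod.case fst_conv snd_conv
        using True E(2)[OF zin[OF e]] z r by simp
    qed
    thus ?thesis using that E(1) by blast
  qed
  define D where "D i = conj_unless (pos = s) (sgn (q i / E))" for i
  have qne: "q i \<noteq> 0" for i
  proof -
    have "k i \<noteq> l" unfolding k_def l_def by (subst word_map_eq_iff) (auto simp: bary_points, auto simp: branch_pt_def edge_end_def split: if_splits)
    thus ?thesis using point_eq_iff S by (simp add: q_def v_def)
  qed
  have 1: "sgn (chart pos (arc_pt (w @ [T1]) s 0) (arc_pt (w @ [i]) s e)) = D i" if "0 < e" "e < 1" for i e
  proof -
    have "e *\<^sub>R q i / E = e *\<^sub>R (q i / E)" by (simp add: scaleR_conv_of_real)
    thus ?thesis unfolding CE[OF that] sgn_conj_unless D_def using that by (simp only: sgn_scaleR) simp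
  qed
  have 2: "cmod (D i) = 1" for i using qne[of i] E unfolding D_def norm_conj_unless norm_sgn by simp
  have 3: "Im (cnj (D T1) * D i) * germ_label w (s = up) i < 0" if i: "i \<noteq> T1" for i
  proof -
    obtain r where r: "r > 0" "bary_det l (k T1) (k i) = (if word_sign w then r else - r) * bary_det branch_pt (edge_end T1) (edge_end i)"
      using bary_det_word_map[of w branch_pt "edge_end T1" "edge_end i"] unfolding l_def k_def by blast
    have "bary_det branch_pt (edge_end T1) (edge_end i) = - 1/4"
      using i by (simp add: bary_det_def branch_pt_def edge_end_def)
    hence V: "Im (cnj (q T1) * q i) = (if word_sign w then - (r/4) else r/4) * area"
      using point_bary_det[OF S(1) S(2) S(2), of T1 i] r(2) by (simp add: q_def v_def)
    define c where "c = 1 / (cmod (q T1) * cmod (q i))"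
    have c: "c > 0" using qne by (simp add: c_def)
    have "cnj (sgn (q T1 / E)) * sgn (q i / E) = of_real c * (cnj (q T1) * q i)"
    proof -
      have "cnj (sgn E) * sgn E = 1"
        using complex_norm_square[of "sgn E"] E by (simp add: norm_sgn mult.commute)
      hence "cnj (sgn (q T1 / E)) * sgn (q i / E) = cnj (sgn (q T1)) * sgn (q i)"
        using E by (simp add: sgn_divide_complex sgn_zero_iff)
      thus ?thesis by (simp add: c_def sgn_eq)
    qed
    hence "Im (cnj (D T1) * D i) = (if pos = s then 1 else -1) * (c * Im (cnj (q T1) * q i))"
      unfolding D_def Im_conj_unless_mult by simp
    hence X: "Im (cnj (D T1) * D i) = (if pos = s then 1 else -1) * ((if word_sign w then -1 else 1) * (c * (r/4) * area))"
      unfolding V by simp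
    define x where "x = Im (cnj (D T1) * D i)"
    define K where "K = c * (r/4) * area"
    have x: "x = (if pos = s then 1 else -1) * ((if word_sign w then -1 else 1) * K)"
      unfolding x_def K_def by (rule X)
    have "c * (r/4) > 0" using c r(1) by simp
    hence K: "area > 0 \<Longrightarrow> K > 0" "\<not> area > 0 \<Longrightarrow> K < 0"
      using area_nonzero mult_pos_neg[of "c * (r/4)" area] by (auto simp: K_def)
    have "x * germ_label w (s = up) i < 0"
      unfolding x using up K i
      by (cases "area > 0"; cases pos; cases s; cases "word_sign w") (simp_all add: germ_label_def)
    thus ?thesis by (simp only: x_def)
  qed
  show ?thesis using 1 2 3 by blast
qed

end

context pl_model
begin

text \<open>The preimage in the dessin of the edge of $\tilde\Phi_n$ that belongs to the word \<open>w\<close> and to the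
copy \<open>s\<close>, parametrized by the value of the iterate.\<close>

definition ray :: "nat \<Rightarrow> bool \<Rightarrow> tile list \<Rightarrow> bool \<Rightarrow> real \<Rightarrow> complex" where
  "ray n up w s e = conj_unless (s = up) (dessin_pt n (word_map w (edge_pt e)))"

lemma edge_Phi_bary:
  assumes "length w = n" "0 \<le> e" "e \<le> 1"
  shows "edge_pt e \<in> Phi_bary 0" "word_map w (edge_pt e) \<in> Phi_bary n"
proof -
  show 0: "edge_pt e \<in> Phi_bary 0" using assms by (simp add: edge_pt_def std_simplex_def side01_def)
  show "word_map w (edge_pt e) \<in> Phi_bary n" using Phi_bary_word_map[OF 0, of w] assms by simp
qed

lemma to_double_ray:
  assumes "length w = n" "0 \<le> e" "e \<le> 1"
  shows "to_double n up (ray n up w s e) = arc_pt w s e"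
  unfolding ray_def arc_pt_def by (rule to_double_conj[OF edge_Phi_bary(2)[OF assms]])

lemma ray_value:
  assumes "length w = n" "0 \<le> e" "e \<le> 1"
  shows "(hess_map ^^ n) (ray n up w s e) = of_real e"
  using dessin_pt_word_map[OF edge_Phi_bary(1)[OF assms], of w] assms
  by (simp add: ray_def hess_iter_conj dessin_pt_edge_pt) (simp add: conj_unless_def)

lemma continuous_on_dessin_pt: "continuous_on (Phi_bary n) (dessin_pt n)"
  unfolding bary_of_image[symmetric]
  by (rule continuous_on_inv[OF continuous_on_bary_of compact_dessin_up]) (simp add: dessin_pt_bary_of)

lemma continuous_on_word_map: "continuous_on A g \<Longrightarrow> continuous_on A (\<lambda>x. word_map w (g x))"
  by (induction w) (auto intro: continuous_on_tile_map)

lemma continuous_on_ray: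
  assumes "length w = n"
  shows "continuous_on {0..1} (ray n up w s)"
proof -
  have "continuous_on {0..1} (\<lambda>e. word_map w (edge_pt e))"
    unfolding edge_pt_def by (intro continuous_on_word_map continuous_intros)
  hence L: "continuous_on {0..1} (\<lambda>e. dessin_pt n (word_map w (edge_pt e)))"
    by (rule continuous_on_compose2[OF continuous_on_dessin_pt]) (use edge_Phi_bary(2)[OF assms] in auto)
  have "ray n up w s = (\<lambda>e. if s = up then dessin_pt n (word_map w (edge_pt e)) else cnj (dessin_pt n (word_map w (edge_pt e))))"
    by (auto simp: ray_def conj_unless_def fun_eq_iff)
  thus ?thesis using L continuous_on_cnj[OF L] by (cases "s = up") simp_all
qed

lemma ray_exists:
  assumes "z \<in> dessin_set n"
  shows "\<exists>w s e. length w = n \<and> 0 \<le> e \<and> e \<le> 1 \<and> z = ray n up w s e"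
proof -
  obtain l where l: "l \<in> Phi_bary n" "z = conj_unless (Im z \<ge> 0) (dessin_pt n l)" using dessin_set_repr[OF assms] by blast
  obtain w e where w: "length w = n" "0 \<le> e" "e \<le> 1" "l = word_map w (edge_pt e)" using l(1) unfolding Phi_bary_words by auto
  have "((((Im z \<ge> 0) = up)) = up) = (Im z \<ge> 0)" by blast
  hence "z = ray n up w ((Im z \<ge> 0) = up) e" using l(2) w(4) by (simp add: ray_def)
  thus ?thesis using w by blast
qed

lemma finite_words: "finite {w :: tile list. length w = n}"
proof -
  have "(UNIV :: tile set) = {T1, T2, T3}" by (auto intro: tile.exhaust)
  hence "finite (UNIV :: tile set)" by (metis finite.emptyI finite_insert)
  from finite_lists_length_eq[OF this, of n] show ?thesis by simp
qed

text \<open>There are only finitely many edges, and those that do not issue from the vertex stay away from it.\<close>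

lemma near_rays:
  assumes z0: "z0 \<in> dessin_set n" "(hess_map ^^ n) z0 = of_real e0" and e0: "e0 = 0 \<or> e0 = 1"
  shows "eventually (\<lambda>z. \<exists>w s e. length w = n \<and> 0 < e \<and> e < 1 \<and> z = ray n up w s e \<and> ray n up w s e0 = z0) (at z0 within dessin_set n)"
proof -
  define B where "B = {w :: tile list. length w = n} \<times> (UNIV :: bool set)"
  have B: "finite B" unfolding B_def using finite_words by simp
  \<comment> \<open>The edges that do not issue from the vertex, and the other endpoints of all edges.\<close>
  define K1 where "K1 = (\<Union>(w, s) \<in> {p \<in> B. ray n up (fst p) (snd p) e0 \<noteq> z0}. ray n up w s ` {0..1})"
  define K2 where "K2 = (\<lambda>(w, s). ray n up w s (1 - e0)) ` B"
  have "compact (ray n up w s ` {0..1})" if "(w, s) \<in> B" for w s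
    using that by (intro compact_continuous_image continuous_on_ray) (auto simp: B_def)
  hence "closed K1" unfolding K1_def using B
    by (intro closed_UN) (auto intro!: compact_imp_closed)
  moreover have "closed K2" unfolding K2_def using B by (intro finite_imp_closed finite_imageI)
  ultimately have op: "open (- (K1 \<union> K2))" by (metis open_Compl closed_Un)
  have par: "e = e0" if "(w, s) \<in> B" "0 \<le> e" "e \<le> 1" "ray n up w s e = z0" for w s e
    using ray_value[of w n e up s] that z0(2) by (auto simp: B_def)
  have "z0 \<notin> K1" using par by (fastforce simp: K1_def)
  moreover have "z0 \<notin> K2" using par[of _ _ "1 - e0"] e0 by (force simp: K2_def)
  ultimately have "eventually (\<lambda>z. z \<in> - (K1 \<union> K2)) (at z0 within dessin_set n)"
    using eventually_nhds_in_open[OF op, of z0] at_within_le_nhds by (auto intro: filter_leD)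
  moreover have "eventually (\<lambda>z. z \<in> dessin_set n \<and> z \<noteq> z0) (at z0 within dessin_set n)"
    by (auto simp: eventually_at_filter)
  ultimately show ?thesis
  proof eventually_elim
    case (elim z)
    obtain w s e where w: "length w = n" "0 \<le> e" "e \<le> 1" "z = ray n up w s e"
      using ray_exists elim(2) by blast
    have wB: "(w, s) \<in> B" using w by (simp add: B_def)
    have r0: "ray n up w s e0 = z0"
    proof (rule ccontr)
      assume "ray n up w s e0 \<noteq> z0"
      hence "z \<in> K1" unfolding K1_def using w wB by (intro UN_I[of "(w, s)"]) auto
      thus False using elim by blast
    qed
    have "e \<noteq> e0" using r0 w(4) elim(2) by auto
    moreover have "e \<noteq> 1 - e0"
    proof
      assume "e = 1 - e0"
      hence "z \<in> K2" unfolding K2_def using w wB by (intro image_eqI[of _ _ "(w, s)"]) auto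
      thus False using elim by blast
    qed
    ultimately have "0 < e" "e < 1" using e0 w by auto
    thus ?case using w r0 by blast
  qed
qed

lemma ray_tendsto:
  assumes "length w = n" "ray n up w s e0 = z0"
  shows "e0 = 0 \<Longrightarrow> (ray n up w s \<longlongrightarrow> z0) (at_right 0)" "e0 = 1 \<Longrightarrow> (ray n up w s \<longlongrightarrow> z0) (at_left 1)"
proof -
  have c: "continuous_on {0..1} (ray n up w s)" by (rule continuous_on_ray[OF assms(1)])
  show "e0 = 0 \<Longrightarrow> (ray n up w s \<longlongrightarrow> z0) (at_right 0)"
    using c[unfolded continuous_on_def, rule_format, of 0] assms(2) at_within_Icc_at_right[of 0 "1::real"] by simp
  show "e0 = 1 \<Longrightarrow> (ray n up w s \<longlongrightarrow> z0) (at_left 1)"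
    using c[unfolded continuous_on_def, rule_format, of 1] assms(2) at_within_Icc_at_left[of 0 "1::real"] by simp
qed

text \<open>Three germs with different directions would contain, arbitrarily close to the vertex, three points
of the dessin where the iterate takes the same value, contrary to \<open>white_two_to_one\<close>.\<close>

lemma white_germs_double:
  assumes z0: "z0 \<in> dessin_set n" "(hess_map ^^ n) z0 = 1"
  shows "\<exists>U. finite U \<and> card U \<le> 2 \<and> eventually (\<lambda>z. sgn (chart pos (to_double n up z0) (to_double n up z)) \<in> U) (at z0 within dessin_set n)"
proof -
  define W where "W = {p. length (fst p) = n \<and> ray n up (fst p) (snd p) 1 = z0}"
  have "W \<subseteq> {w. length w = n} \<times> UNIV" by (auto simp: W_def)
  hence finW: "finite W" by (rule finite_subset) (simp add: finite_words)
  define C where "C z = sgn (chart pos (to_double n up z0) (to_double n up z))" for z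
  have "\<exists>d. \<forall>e. 0 < e \<and> e < 1 \<longrightarrow> C (ray n up (fst p) (snd p) e) = d" if p: "p \<in> W" for p
  proof -
    have l: "length (fst p) = n" "ray n up (fst p) (snd p) 1 = z0" using p by (auto simp: W_def)
    have "to_double n up z0 = arc_pt (fst p) (snd p) 1" using to_double_ray[OF l(1), of 1 up "snd p"] l(2) by simp
    thus ?thesis unfolding C_def using direction_constant[of 1 pos "fst p" "snd p"] to_double_ray[OF l(1)] by auto
  qed
  then obtain d where d: "\<And>p e. p \<in> W \<Longrightarrow> 0 < e \<Longrightarrow> e < 1 \<Longrightarrow> C (ray n up (fst p) (snd p) e) = d p" by metis
  have "eventually (\<lambda>z. \<exists>w s e. length w = n \<and> 0 < e \<and> e < 1 \<and> z = ray n up w s e \<and> ray n up w s 1 = z0) (at z0 within dessin_set n)"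
    by (rule near_rays) (use z0 in simp_all)
  hence ev: "eventually (\<lambda>z. C z \<in> d ` W) (at z0 within dessin_set n)"
  proof eventually_elim
    case (elim z)
    then obtain w s e where w: "length w = n" "0 < e" "e < 1" "z = ray n up w s e" "ray n up w s 1 = z0" by blast
    hence "(w, s) \<in> W" by (simp add: W_def)
    thus ?case using d[of "(w, s)" e] w by (metis fst_conv image_eqI snd_conv)
  qed
  have "card (d ` W) \<le> 2"
  proof (rule ccontr)
    assume "\<not> card (d ` W) \<le> 2"
    then obtain V where V: "V \<subseteq> d ` W" "card V = 3" using obtain_subset_with_card_n[of 3 "d ` W"] by auto
    then obtain a b c where abc: "V = {a, b, c}" "a \<noteq> b" "a \<noteq> c" "b \<noteq> c" by (metis card_3_iff)
    hence "a \<in> d ` W" "b \<in> d ` W" "c \<in> d ` W" using V(1) by simp_all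
    then obtain p q r where "p \<in> W" "q \<in> W" "r \<in> W" "a = d p" "b = d q" "c = d r" by blast
    hence pqr: "p \<in> W" "q \<in> W" "r \<in> W" "d p \<noteq> d q" "d p \<noteq> d r" "d q \<noteq> d r" using abc by simp_all
    obtain Q where Q: "eventually Q (nhds z0)" "\<And>x y z. Q x \<Longrightarrow> Q y \<Longrightarrow> Q z \<Longrightarrow> (hess_map ^^ n) x = (hess_map ^^ n) y
      \<Longrightarrow> (hess_map ^^ n) x = (hess_map ^^ n) z \<Longrightarrow> x = y \<or> x = z \<or> y = z"
      using white_two_to_one[OF z0] by blast
    have near: "eventually (\<lambda>e. Q (ray n up (fst p) (snd p) e)) (at_left 1)" if "p \<in> W" for p
      using ray_tendsto(2)[of "fst p" n up "snd p" 1 z0] that Q(1) by (simp add: W_def filterlim_iff)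
    have "eventually (\<lambda>e::real. e \<in> {0<..<1}) (at_left 1)" by (rule eventually_at_left_real) simp
    with near[OF pqr(1)] near[OF pqr(2)] near[OF pqr(3)]
    have "eventually (\<lambda>e. Q (ray n up (fst p) (snd p) e) \<and> Q (ray n up (fst q) (snd q) e) \<and> Q (ray n up (fst r) (snd r) e) \<and> e \<in> {0<..<1}) (at_left 1)"
      by eventually_elim blast
    then obtain e where e: "Q (ray n up (fst p) (snd p) e)" "Q (ray n up (fst q) (snd q) e)" "Q (ray n up (fst r) (snd r) e)" "0 < e" "e < 1"
      using eventually_happens'[OF trivial_limit_at_left_real] unfolding greaterThanLessThan_iff by blast
    have val: "(hess_map ^^ n) (ray n up (fst p) (snd p) e) = of_real e" if "p \<in> W" for p
      using ray_value[of "fst p" n e up "snd p"] that e by (simp add: W_def)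
    have "ray n up (fst p) (snd p) e \<noteq> ray n up (fst q) (snd q) e" "ray n up (fst p) (snd p) e \<noteq> ray n up (fst r) (snd r) e"
      "ray n up (fst q) (snd q) e \<noteq> ray n up (fst r) (snd r) e"
      using d[OF pqr(1) e(4,5)] d[OF pqr(2) e(4,5)] d[OF pqr(3) e(4,5)] pqr(4-6) by metis+
    thus False using Q(2)[OF e(1-3)] val pqr(1-3) by simp
  qed
  thus ?thesis using ev finW unfolding C_def by blast
qed

lemma dessin_pt_1_Im:
  assumes "0 < e" "e < 1"
  shows "Im (dessin_pt (Suc 0) (tile_map T1 (edge_pt e))) = 0" "i \<noteq> T1 \<Longrightarrow> Im (dessin_pt (Suc 0) (tile_map i (edge_pt e))) > 0"
proof -
  have P: "tile_map i (edge_pt e) \<in> Phi_bary (Suc 0)" for i using edge_Phi_bary(1)[of "[]" 0 e] assms by (intro Phi_bary_tile_map) simp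
  show "Im (dessin_pt (Suc 0) (tile_map T1 (edge_pt e))) = 0"
    unfolding dessin_pt_real_iff[OF P] by (simp add: edge_pt_def side1i_def)
  assume i: "i \<noteq> T1"
  have "Im (dessin_pt (Suc 0) (tile_map i (edge_pt e))) \<noteq> 0"
    unfolding dessin_pt_real_iff[OF P] using i assms by (cases i) (auto simp: edge_pt_def side1i_def side01_def sidei0_def diff_divide_distrib)
  moreover have "Im (dessin_pt (Suc 0) (tile_map i (edge_pt e))) \<ge> 0" using dessin_pt(1)[OF P[of i]] by (simp add: dessin_up_def)
  ultimately show "Im (dessin_pt (Suc 0) (tile_map i (edge_pt e))) > 0" by simp
qed

lemma ray_iterate:
  assumes "length w = m" "0 < e" "e < 1"
  shows "(hess_map ^^ m) (ray (Suc m) up (w @ [i]) s e)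
     = conj_unless (word_sign w = (s = up)) (dessin_pt (Suc 0) (tile_map i (edge_pt e)))"
proof -
  have P: "tile_map i (edge_pt e) \<in> Phi_bary (Suc 0)" using edge_Phi_bary(1)[of "[]" 0 e] assms by (intro Phi_bary_tile_map) simp
  have "(hess_map ^^ m) (dessin_pt (Suc m) (word_map w (tile_map i (edge_pt e)))) = conj_unless (word_sign w) (dessin_pt (Suc 0) (tile_map i (edge_pt e)))"
    using dessin_pt_word_map[OF P, of w] assms(1) by simp
  hence "(hess_map ^^ m) (ray (Suc m) up (w @ [i]) s e) = conj_unless (s = up) (conj_unless (word_sign w) (dessin_pt (Suc 0) (tile_map i (edge_pt e))))"
    by (simp add: ray_def hess_iter_conj word_map_append)
  thus ?thesis unfolding conj_unless_conj_unless by (simp only: eq_commute[of "s = up" "word_sign w"])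
qed

lemma ray_label:
  assumes "length w = m" "0 < e" "e < 1"
  shows "sgn (Im ((hess_map ^^ m) (ray (Suc m) up (w @ [i]) s e))) = germ_label w (s = up) i"
  unfolding ray_iterate[OF assms] using dessin_pt_1_Im[OF assms(2,3)]
  by (cases "i = T1") (auto simp: germ_label_def conj_unless_def)

text \<open>Edges with equal labels coincide near the vertex, because they have the same image under an iterate
that is injective there. So the direction is a function of the label; to a label that does not occur
a direction on the correct side is assigned arbitrarily.\<close>

lemma black_germs_double:
  assumes up: "up \<longleftrightarrow> (pos \<longleftrightarrow> area > 0)"
    and z0: "z0 \<in> dessin_set (Suc m)" "(hess_map ^^ Suc m) z0 = 0"
  shows "\<exists>u :: real \<Rightarrow> complex. (\<forall>l \<in> {0, 1, -1}. cmod (u l) = 1) \<and> (\<forall>l \<in> {1, -1}. Im (cnj (u 0) * u l) * l < 0) \<and>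
     eventually (\<lambda>z. sgn (chart pos (to_double (Suc m) up z0) (to_double (Suc m) up z)) = u (sgn (Im ((hess_map ^^ m) z)))) (at z0 within dessin_set (Suc m))"
proof -
  define C where "C z = sgn (chart pos (to_double (Suc m) up z0) (to_double (Suc m) up z))" for z
  define W where "W = {p. length (fst p) = m \<and> ray (Suc m) up (fst p @ [T1]) (snd p) 0 = z0}"
  have r0: "ray (Suc m) up (w @ [i]) s 0 = ray (Suc m) up (w @ [T1]) s 0" for w s i
    by (simp add: ray_def word_map_append tile_map_edge_pt mix_def)
  have "\<forall>p. \<exists>D. p \<in> W \<longrightarrow> (\<forall>i e. 0 < e \<and> e < 1 \<longrightarrow> C (ray (Suc m) up (fst p @ [i]) (snd p) e) = D i)
    \<and> (\<forall>i. cmod (D i) = 1) \<and> (\<forall>i. i \<noteq> T1 \<longrightarrow> Im (cnj (D T1) * D i) * germ_label (fst p) (snd p = up) i < 0)"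
  proof
    fix p
    show "\<exists>D. p \<in> W \<longrightarrow> (\<forall>i e. 0 < e \<and> e < 1 \<longrightarrow> C (ray (Suc m) up (fst p @ [i]) (snd p) e) = D i)
      \<and> (\<forall>i. cmod (D i) = 1) \<and> (\<forall>i. i \<noteq> T1 \<longrightarrow> Im (cnj (D T1) * D i) * germ_label (fst p) (snd p = up) i < 0)"
    proof (cases "p \<in> W")
      case True
      hence l: "length (fst p @ [i]) = Suc m" and z: "ray (Suc m) up (fst p @ [T1]) (snd p) 0 = z0" for i by (auto simp: W_def)
      have k0: "to_double (Suc m) up z0 = arc_pt (fst p @ [T1]) (snd p) 0" using to_double_ray[OF l, of 0 up T1 "snd p"] z by simp
      obtain D where D: "\<forall>i e. 0 < e \<and> e < 1 \<longrightarrow> sgn (chart pos (arc_pt (fst p @ [T1]) (snd p) 0) (arc_pt (fst p @ [i]) (snd p) e)) = D i"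
        "\<forall>i. cmod (D i) = 1" "\<forall>i. i \<noteq> T1 \<longrightarrow> Im (cnj (D T1) * D i) * germ_label (fst p) (snd p = up) i < 0"
        using branch_directions[OF up, of "fst p" "snd p"] by blast
      have "\<forall>i e. 0 < e \<and> e < 1 \<longrightarrow> C (ray (Suc m) up (fst p @ [i]) (snd p) e) = D i"
        using D(1) unfolding C_def k0 by (simp add: to_double_ray[OF l])
      thus ?thesis using D(2,3) by blast
    qed simp
  qed
  then obtain D where D: "\<And>p i e. p \<in> W \<Longrightarrow> 0 < e \<Longrightarrow> e < 1 \<Longrightarrow> C (ray (Suc m) up (fst p @ [i]) (snd p) e) = D p i"
      "\<And>p i. p \<in> W \<Longrightarrow> cmod (D p i) = 1"
      "\<And>p i. p \<in> W \<Longrightarrow> i \<noteq> T1 \<Longrightarrow> Im (cnj (D p T1) * D p i) * germ_label (fst p) (snd p = up) i < 0"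
    by metis
  define lab where "lab p i = germ_label (fst p) (snd p = up) i" for p i
  obtain d where "conformal_at (hess_map ^^ m) z0 d" using conformal_at_iterate black_orbit(2)[OF z0] by blast
  then obtain Q where Q: "eventually Q (nhds z0)" "\<And>x y. Q x \<Longrightarrow> Q y \<Longrightarrow> (hess_map ^^ m) x = (hess_map ^^ m) y \<Longrightarrow> x = y"
    unfolding conformal_at_def by blast
  have same: "D p i = D q j" if pq: "p \<in> W" "q \<in> W" and lab: "lab p i = lab q j" for p q i j
  proof -
    have near: "eventually (\<lambda>e. Q (ray (Suc m) up (fst p @ [i]) (snd p) e)) (at_right 0)" if "p \<in> W" for p i
    proof -
      have "length (fst p @ [i]) = Suc m" "ray (Suc m) up (fst p @ [i]) (snd p) 0 = z0" using that r0 by (auto simp: W_def)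
      from ray_tendsto(1)[OF this refl] show ?thesis using Q(1) by (simp add: filterlim_iff)
    qed
    have "eventually (\<lambda>e::real. e \<in> {0<..<1}) (at_right 0)" by (rule eventually_at_right_real) simp
    with near[OF pq(1), of i] near[OF pq(2), of j]
    have "eventually (\<lambda>e. Q (ray (Suc m) up (fst p @ [i]) (snd p) e) \<and> Q (ray (Suc m) up (fst q @ [j]) (snd q) e) \<and> e \<in> {0<..<1}) (at_right 0)"
      by eventually_elim blast
    then obtain e where e: "Q (ray (Suc m) up (fst p @ [i]) (snd p) e)" "Q (ray (Suc m) up (fst q @ [j]) (snd q) e)" "0 < e" "e < 1"
      using eventually_happens'[OF trivial_limit_at_right_real] unfolding greaterThanLessThan_iff by blast
    have lpq: "length (fst p) = m" "length (fst q) = m" using pq by (auto simp: W_def)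
    have ij: "i = T1 \<longleftrightarrow> j = T1" and sg: "i \<noteq> T1 \<Longrightarrow> (word_sign (fst p) = (snd p = up)) = (word_sign (fst q) = (snd q = up))"
      using lab by (auto simp: lab_def germ_label_def split: if_splits)
    have ends: "tile_map i (edge_pt e) = tile_map j (edge_pt e)" using ij by (simp add: tile_map_edge_pt edge_end_def)
    have "conj_unless b (dessin_pt (Suc 0) (tile_map T1 (edge_pt e))) = dessin_pt (Suc 0) (tile_map T1 (edge_pt e))" for b
      using dessin_pt_1_Im(1)[OF e(3,4)] by (simp add: conj_unless_def complex_eq_iff)
    hence "(hess_map ^^ m) (ray (Suc m) up (fst p @ [i]) (snd p) e) = (hess_map ^^ m) (ray (Suc m) up (fst q @ [j]) (snd q) e)"
      unfolding ray_iterate[OF lpq(1) e(3,4)] ray_iterate[OF lpq(2) e(3,4)] ends using ij sg by (cases "j = T1") auto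
    hence "ray (Suc m) up (fst p @ [i]) (snd p) e = ray (Suc m) up (fst q @ [j]) (snd q) e" using Q(2) e by blast
    thus ?thesis using D(1)[OF pq(1) e(3,4), of i] D(1)[OF pq(2) e(3,4), of j] by simp
  qed
  have split: "\<exists>p i e. p \<in> W \<and> z = ray (Suc m) up (fst p @ [i]) (snd p) e"
    if len: "length w = Suc m" and start: "ray (Suc m) up w s 0 = z0" and z: "z = ray (Suc m) up w s e" for w s e z
  proof -
    obtain v i where v: "w = v @ [i]" "length v = m" using len by (cases w rule: rev_cases) auto
    hence "(v, s) \<in> W" using start r0[of v i s] by (simp add: W_def)
    thus ?thesis using v z by (intro exI[of _ "(v, s)"] exI[of _ i] exI[of _ e]) simp
  qed
  have "\<exists>p. p \<in> W"
  proof -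
    obtain w s e where w: "length w = Suc m" "0 \<le> e" "e \<le> 1" "z0 = ray (Suc m) up w s e" using ray_exists[OF z0(1)] by blast
    hence "e = 0" using ray_value[OF w(1-3), of up s] z0(2) by simp
    thus ?thesis using split[OF w(1), of s z0 0] w(4) by auto
  qed
  then obtain p0' where p0': "p0' \<in> W" by blast
  define u0 where "u0 = D p0' T1"
  have u0: "cmod u0 = 1" using D(2)[OF p0'] by (simp add: u0_def)
  define u where "u l = (if l = 0 then u0 else if \<exists>p i. p \<in> W \<and> lab p i = l then (SOME d. \<exists>p i. p \<in> W \<and> lab p i = l \<and> d = D p i)
     else - (of_real l * \<i> * u0))" for l :: real
  have l0: "lab p i = 0 \<longleftrightarrow> i = T1" for p i by (simp add: lab_def germ_label_def)
  have uD: "u (lab p i) = D p i" if p: "p \<in> W" for p i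
  proof (cases "i = T1")
    case True
    have "lab p0' T1 = lab p T1" by (simp add: lab_def germ_label_def)
    hence "D p0' T1 = D p T1" by (rule same[OF p0' p])
    thus ?thesis using l0[of p T1] True by (simp add: u_def u0_def)
  next
    case False
    hence n0: "lab p i \<noteq> 0" using l0 by simp
    have "\<exists>d. \<exists>q j. q \<in> W \<and> lab q j = lab p i \<and> d = D q j" using p by blast
    from someI_ex[OF this] obtain q j where q: "q \<in> W" "lab q j = lab p i"
      "(SOME d. \<exists>q j. q \<in> W \<and> lab q j = lab p i \<and> d = D q j) = D q j" by blast
    have ex: "\<exists>p' i'. p' \<in> W \<and> lab p' i' = lab p i" using p by blast
    have "u (lab p i) = D q j" unfolding u_def if_not_P[OF n0] if_P[OF ex] by (rule q(3))
    thus ?thesis using same[OF q(1) p q(2)] by simp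
  qed
  have n: "cmod (u l) = 1" if l: "l \<in> {0, 1, -1}" for l
  proof (cases "\<exists>p i. p \<in> W \<and> lab p i = l")
    case True
    then obtain p i where "p \<in> W" "lab p i = l" by blast
    thus ?thesis using uD[of p i] D(2)[of p i] by simp
  next
    case False
    hence "u l = (if l = 0 then u0 else - (of_real l * \<i> * u0))" by (auto simp: u_def)
    thus ?thesis using l u0 by (auto simp: norm_mult)
  qed
  have or: "Im (cnj (u 0) * u l) * l < 0" if l: "l \<in> {1, -1}" for l
  proof (cases "\<exists>p i. p \<in> W \<and> lab p i = l")
    case True
    then obtain p i where p: "p \<in> W" "lab p i = l" by blast
    have "i \<noteq> T1" using p l l0[of p i] by auto
    moreover have "u 0 = D p T1" using uD[OF p(1), of T1] l0[of p T1] by simp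
    moreover have "u l = D p i" using uD[OF p(1), of i] p(2) by simp
    ultimately show ?thesis using D(3)[OF p(1), of i] p(2) by (simp add: lab_def)
  next
    case False
    hence "u l = - (of_real l * \<i> * u0)" using l by (auto simp: u_def)
    moreover have "u 0 = u0" by (simp add: u_def)
    ultimately have "cnj (u 0) * u l = - (of_real l * \<i> * (u0 * cnj u0))" by (simp add: mult_ac)
    also have "u0 * cnj u0 = 1" using complex_norm_square[of u0] u0 by simp
    finally show ?thesis using l by auto
  qed
  have "eventually (\<lambda>z. \<exists>w s e. length w = Suc m \<and> 0 < e \<and> e < 1 \<and> z = ray (Suc m) up w s e \<and> ray (Suc m) up w s 0 = z0)
      (at z0 within dessin_set (Suc m))"
    by (rule near_rays) (use z0 in \<open>simp_all del: funpow.simps\<close>)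
  hence ev: "eventually (\<lambda>z. C z = u (sgn (Im ((hess_map ^^ m) z)))) (at z0 within dessin_set (Suc m))"
  proof eventually_elim
    case (elim z)
    then obtain w s e where w: "length w = Suc m" "0 < e" "e < 1" "z = ray (Suc m) up w s e" "ray (Suc m) up w s 0 = z0" by blast
    obtain v i where v: "w = v @ [i]" "length v = m" using w(1) by (cases w rule: rev_cases) auto
    hence vW: "(v, s) \<in> W" using w(5) r0[of v i s] by (simp add: W_def)
    have "sgn (Im ((hess_map ^^ m) z)) = lab (v, s) i" using ray_label[OF v(2) w(2,3), of up i s] w(4) v(1) by (simp add: lab_def)
    moreover have "C z = D (v, s) i" using D(1)[OF vW w(2,3), of i] w(4) v(1) by simp
    ultimately show ?case using uD[OF vW, of i] by simp
  qed
  show ?thesis using n or ev unfolding C_def by blast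
qed

end

section \<open>Cyclic orders\<close>

lemma positive_triple_distinct: "positive_triple a b c \<Longrightarrow> a \<noteq> b \<and> a \<noteq> c \<and> b \<noteq> c"
  by (auto simp: positive_triple_def algebra_simps)

lemma positive_triple_rotate: "positive_triple a b c \<Longrightarrow> positive_triple b c a"
  by (simp add: positive_triple_def algebra_simps)

lemma positive_triple_asym: "positive_triple a b c \<Longrightarrow> \<not> positive_triple a c b"
  by (simp add: positive_triple_def algebra_simps)

lemma positive_triple_sides:
  assumes n: "cmod a = 1" "cmod b = 1" "cmod c = 1" and s: "Im (cnj a * b) > 0" "Im (cnj a * c) < 0"
  shows "positive_triple a b c"
proof -
  define P R where "P = cnj a * b" and "R = cnj a * c"
  have aa: "a * cnj a = 1" using complex_norm_square[of a] n by simp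
  have nPR: "cmod P = 1" "cmod R = 1" using n by (simp_all add: P_def R_def norm_mult)
  have lt: "Re z < 1" if "cmod z = 1" "Im z \<noteq> 0" for z
  proof -
    have "Re z ^ 2 + Im z ^ 2 = 1" using that(1) by (simp add: cmod_power2[symmetric])
    hence "Re z ^ 2 < 1 ^ 2" using that(2) by (smt (verit) zero_less_power2 one_power2)
    thus ?thesis by (rule power2_less_imp_less) simp
  qed
  have "cnj (b - a) * (c - a) = cnj b * c - cnj b * a - cnj a * c + cnj a * a" by (simp add: algebra_simps)
  also have "cnj b * c = cnj b * (a * cnj a) * c" by (simp add: aa)
  also have "cnj b * (a * cnj a) * c - cnj b * a - cnj a * c + cnj a * a = cnj P * R - cnj P - R + 1"
    using aa by (simp add: P_def R_def mult_ac)
  finally have "Im (cnj (b - a) * (c - a)) = Im (cnj P * R - cnj P - R + 1)" by (rule arg_cong)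
  also have "\<dots> = Im P * (1 - Re R) + (- Im R) * (1 - Re P)" by (simp add: algebra_simps)
  also have "\<dots> > 0" using s lt[OF nPR(1)] lt[OF nPR(2)]
    by (intro add_pos_pos mult_pos_pos) (auto simp: P_def[symmetric] R_def[symmetric])
  finally show ?thesis by (simp add: positive_triple_def)
qed

text \<open>Directions labelled by $0$, $1$ and $-1$, where those labelled $1$ and $-1$ lie strictly to the right
and to the left of the one labelled $0$. This pins down the cyclic order.\<close>

definition trivalent :: "(real \<Rightarrow> complex) \<Rightarrow> bool" where
  "trivalent u \<longleftrightarrow> (\<forall>l \<in> {0, 1, -1}. cmod (u l) = 1) \<and> (\<forall>l \<in> {1, -1}. Im (cnj (u 0) * u l) * l < 0)"

lemma trivalent_triple:
  assumes "trivalent u" "i \<in> {0, 1, -1}" "j \<in> {0, 1, -1}" "k \<in> {0, 1, -1}"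
  shows "positive_triple (u i) (u j) (u k) \<longleftrightarrow> (i, j, k) \<in> {(0, -1, 1), (-1, 1, 0), (1, 0, -1)}"
proof -
  have 1: "positive_triple (u 0) (u (-1)) (u 1)"
    using assms(1) by (intro positive_triple_sides) (auto simp: trivalent_def)
  have 2: "positive_triple (u (-1)) (u 1) (u 0)" by (rule positive_triple_rotate[OF 1])
  have 3: "positive_triple (u 1) (u 0) (u (-1))" by (rule positive_triple_rotate[OF 2])
  note N = positive_triple_asym[OF 1] positive_triple_asym[OF 2] positive_triple_asym[OF 3]
  have d: "\<not> positive_triple a a b" "\<not> positive_triple a b a" "\<not> positive_triple b a a" for a b
    using positive_triple_distinct by blast+
  show ?thesis using assms(2-4) by (elim insertE emptyE) (simp_all add: 1 2 3 N d)
qed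

lemma trivalent_inj: "trivalent u \<Longrightarrow> inj_on u {0, 1, -1}"
proof -
  assume t: "trivalent u"
  have 1: "positive_triple (u 0) (u (-1)) (u 1)"
    using t by (intro positive_triple_sides) (auto simp: trivalent_def)
  from positive_triple_distinct[OF 1] show ?thesis by (auto simp: inj_on_def)
qed

lemma finite_limit:
  fixes f :: "real \<Rightarrow> complex"
  assumes "finite U" "eventually (\<lambda>x. f x \<in> U) G" "(f \<longlongrightarrow> v) G" "G \<noteq> bot"
  shows "v \<in> U" "eventually (\<lambda>x. f x = v) G"
proof -
  show "v \<in> U" using Lim_in_closed_set[OF finite_imp_closed[OF assms(1)] assms(2) assms(4) assms(3)] .
  have "open (- (U - {v}))" using assms(1) by (intro open_Compl finite_imp_closed) auto
  hence "eventually (\<lambda>x. f x \<in> - (U - {v})) G" using assms(3) by (auto simp: tendsto_def)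
  with assms(2) show "eventually (\<lambda>x. f x = v) G" by eventually_elim auto
qed

text \<open>If the germs through a vertex are recognized by a label, then a path has a limiting direction on
one surface if and only if it eventually stays in one germ, and thus if and only if it has a limiting
direction on the other surface.\<close>

lemma label_limits:
  fixes G :: "real filter" and u :: "real \<Rightarrow> complex" and C :: "complex \<Rightarrow> complex"
  assumes u: "inj_on u {0, 1, -1}" "inj_on u' {0, 1, -1}" and lab: "\<And>z. lab z \<in> {0, 1, -1 :: real}"
    and A: "eventually (\<lambda>z. C z = u (lab z)) (at z0 within D)"
    and B: "\<And>l (G :: real filter) \<zeta>. filterlim \<zeta> (at z0 within D) G \<Longrightarrow> eventually (\<lambda>x. lab (\<zeta> x) = l) G
        \<Longrightarrow> l \<in> {0, 1, -1} \<Longrightarrow> ((\<lambda>x. sgn (\<zeta> x - z0)) \<longlongrightarrow> u' l) G"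
    and z: "filterlim \<zeta> (at z0 within D) G" "G \<noteq> bot"
  shows "((\<lambda>x. C (\<zeta> x)) \<longlongrightarrow> v) G \<Longrightarrow> \<exists>l \<in> {0, 1, -1}. v = u l \<and> ((\<lambda>x. sgn (\<zeta> x - z0)) \<longlongrightarrow> u' l) G"
    and "((\<lambda>x. sgn (\<zeta> x - z0)) \<longlongrightarrow> v') G \<Longrightarrow> \<exists>l \<in> {0, 1, -1}. v' = u' l \<and> ((\<lambda>x. C (\<zeta> x)) \<longlongrightarrow> u l) G"
proof -
  have A': "eventually (\<lambda>x. C (\<zeta> x) = u (lab (\<zeta> x))) G" using eventually_compose_filterlim[OF A z(1)] .
  show "\<exists>l \<in> {0, 1, -1}. v = u l \<and> ((\<lambda>x. sgn (\<zeta> x - z0)) \<longlongrightarrow> u' l) G" if v: "((\<lambda>x. C (\<zeta> x)) \<longlongrightarrow> v) G"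
  proof -
    have "eventually (\<lambda>x. C (\<zeta> x) \<in> u ` {0, 1, -1}) G" using A' by eventually_elim (use lab in blast)
    moreover have "finite (u ` {0, 1, -1})" by simp
    ultimately
    have "v \<in> u ` {0, 1, -1}" and e: "eventually (\<lambda>x. C (\<zeta> x) = v) G"
      using finite_limit[OF _ _ v z(2)] by blast+
    then obtain l where l: "l \<in> {0, 1, -1}" "v = u l" by blast
    have "eventually (\<lambda>x. lab (\<zeta> x) = l) G" using e A'
      by eventually_elim (use l lab u(1) in \<open>metis inj_onD\<close>)
    thus ?thesis using B[OF z(1)] l by blast
  qed
  show "\<exists>l \<in> {0, 1, -1}. v' = u' l \<and> ((\<lambda>x. C (\<zeta> x)) \<longlongrightarrow> u l) G" if v: "((\<lambda>x. sgn (\<zeta> x - z0)) \<longlongrightarrow> v') G"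
  proof -
    have fr: "v' = u' l" if l: "l \<in> {0, 1, -1}" and f: "\<not> eventually (\<lambda>x. lab (\<zeta> x) \<noteq> l) G" for l
    proof -
      define G' where "G' = inf G (principal {x. lab (\<zeta> x) = l})"
      have "G' \<le> G" by (simp add: G'_def)
      have nb: "G' \<noteq> bot" using f by (simp add: G'_def trivial_limit_def eventually_inf_principal)
      have "eventually (\<lambda>x. lab (\<zeta> x) = l) G'" by (simp add: G'_def eventually_inf_principal)
      hence "((\<lambda>x. sgn (\<zeta> x - z0)) \<longlongrightarrow> u' l) G'"
        using B[OF filterlim_mono[OF z(1) order_refl \<open>G' \<le> G\<close>]] l by blast
      thus ?thesis using tendsto_unique[OF nb tendsto_mono[OF \<open>G' \<le> G\<close> v]] by blast
    qed
    have "\<exists>l \<in> {0, 1, -1}. \<not> eventually (\<lambda>x. lab (\<zeta> x) \<noteq> l) G"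
    proof (rule ccontr)
      assume "\<not> ?thesis"
      hence "eventually (\<lambda>x. \<forall>l \<in> {0, 1, -1}. lab (\<zeta> x) \<noteq> l) G" by (simp add: eventually_ball_finite eventually_conj_iff)
      hence "eventually (\<lambda>x. False) G" by eventually_elim (use lab in blast)
      thus False using z(2) by simp
    qed
    then obtain l where l: "l \<in> {0, 1, -1}" "\<not> eventually (\<lambda>x. lab (\<zeta> x) \<noteq> l) G" by blast
    have "eventually (\<lambda>x. lab (\<zeta> x) \<noteq> l') G" if "l' \<in> {0, 1, -1} - {l}" for l'
      using fr[of l'] fr[OF l] that l u(2) by (metis Diff_iff inj_onD singletonI)
    hence "eventually (\<lambda>x. \<forall>l' \<in> {0, 1, -1} - {l}. lab (\<zeta> x) \<noteq> l') G" by (intro eventually_ball_finite) auto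
    with A' have "eventually (\<lambda>x. C (\<zeta> x) = u l) G" by eventually_elim (use lab in \<open>metis Diff_iff singletonD\<close>)
    hence "((\<lambda>x. C (\<zeta> x)) \<longlongrightarrow> u l) G" by (rule tendsto_eventually)
    thus ?thesis using fr[OF l] l by blast
  qed
qed

lemma trivalent_directions_at_4: "trivalent (\<lambda>l. if l = 0 then -1 else cis (l * pi / 3))"
  by (auto simp: trivalent_def sin_60 cos_60)

lemma trivalent_divide: "trivalent u \<Longrightarrow> cmod d = 1 \<Longrightarrow> trivalent (\<lambda>l. u l / d)"
proof -
  assume u: "trivalent u" and d: "cmod d = 1"
  have "cnj (a / d) * (b / d) = cnj a * b" for a b
  proof -
    have "cnj d * d = 1" using complex_norm_square[of d] d by (simp add: mult.commute)
    moreover have "d \<noteq> 0" using d by auto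
    ultimately show ?thesis by (simp add: divide_simps)
  qed
  thus ?thesis using u d by (simp add: trivalent_def norm_divide)
qed

text \<open>The directions at $4$, transported by the derivative of the iterate.\<close>

lemma black_germs_dessin:
  assumes z0: "z0 \<in> dessin_set (Suc m)" "(hess_map ^^ Suc m) z0 = 0"
  shows "\<exists>u'. trivalent u' \<and> (\<forall>l (G :: real filter) \<zeta>. filterlim \<zeta> (at z0 within dessin_set (Suc m)) G \<longrightarrow>
     eventually (\<lambda>x. sgn (Im ((hess_map ^^ m) (\<zeta> x))) = l) G \<longrightarrow> l \<in> {0, 1, -1} \<longrightarrow> ((\<lambda>x. sgn (\<zeta> x - z0)) \<longlongrightarrow> u' l) G)"
proof -
  obtain d where c: "conformal_at (hess_map ^^ m) z0 d" using conformal_at_iterate black_orbit(2)[OF z0] by blast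
  have h4: "(hess_map ^^ m) z0 = 4" by (rule black_orbit(1)[OF z0])
  have d: "cmod (sgn d) = 1" "sgn d \<noteq> 0" using c by (auto simp: conformal_at_def norm_sgn sgn_zero_iff)
  define e where "e l = (if l = 0 then -1 else cis (l * pi / 3))" for l :: real
  have lim: "((\<lambda>x. sgn (\<zeta> x - z0)) \<longlongrightarrow> e l / sgn d) G"
    if z: "filterlim \<zeta> (at z0 within dessin_set (Suc m)) G" and l: "eventually (\<lambda>x. sgn (Im ((hess_map ^^ m) (\<zeta> x))) = l) G" "l \<in> {0, 1, -1}"
    for l and G :: "real filter" and \<zeta>
  proof -
    define y where "y = (\<lambda>x. (hess_map ^^ m) (\<zeta> x))"
    have z': "filterlim \<zeta> (at z0) G" and zD: "eventually (\<lambda>x. \<zeta> x \<in> dessin_set (Suc m)) G"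
      using z by (auto simp: filterlim_at elim: eventually_mono)
    have y4: "filterlim y (at 4) G" using conformal_filterlim[OF c z'] by (simp add: y_def h4)
    have yD: "eventually (\<lambda>x. y x \<in> dessin_set 1) G"
      using zD by eventually_elim (use dessin_set_iterate[of _ m 1] in \<open>simp add: y_def\<close>)
    have "((\<lambda>x. sgn (y x - 4)) \<longlongrightarrow> e l) G"
    proof -
      consider "l = 0" | "l = 1" | "l = -1" using l(2) by blast
      thus ?thesis
      proof cases
        case 1
        have "eventually (\<lambda>x. Im (y x) = 0) G" using l(1) 1 by (simp add: y_def sgn_zero_iff)
        thus ?thesis using direction_at_4_real[OF y4 yD] 1 by (simp add: e_def)
      next
        case 2
        have "eventually (\<lambda>x. Im (y x) > 0) G" using l(1) 2 by (simp add: y_def sgn_1_pos)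
        thus ?thesis using direction_at_4_upper[OF y4 yD] 2 by (simp add: e_def)
      next
        case 3
        have "eventually (\<lambda>x. Im (y x) < 0) G" using l(1) 3 by (simp add: y_def sgn_1_neg)
        thus ?thesis using direction_at_4_lower[OF y4 yD] 3 by (simp add: e_def)
      qed
    qed
    moreover have "sgn d * (e l / sgn d) = e l" using d by simp
    ultimately show ?thesis using conformal_direction[OF c z', of "e l / sgn d"] by (simp add: y_def h4)
  qed
  moreover have "trivalent (\<lambda>l. e l / sgn d)"
    using trivalent_divide[OF trivalent_directions_at_4 d(1)] by (simp add: e_def[abs_def])
  ultimately show ?thesis by blast
qed

context pl_model
begin

text \<open>At a white vertex both sides are false, as there are at most two directions; at a black vertex the
labels identify the germs, and both triples of directions are trivalent.\<close>

lemma cyclic_order_transfer: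
  assumes up: "up \<longleftrightarrow> (pos \<longleftrightarrow> area > 0)" and n: "n \<ge> 1"
    and z0: "z0 \<in> dessin_set n" "(hess_map ^^ n) z0 = 0 \<or> (hess_map ^^ n) z0 = 1"
    and z: "filterlim \<zeta>1 (at z0 within dessin_set n) (at_right (0::real))" "filterlim \<zeta>2 (at z0 within dessin_set n) (at_right (0::real))"
      "filterlim \<zeta>3 (at z0 within dessin_set n) (at_right (0::real))"
  defines "C \<equiv> \<lambda>z. sgn (chart pos (to_double n up z0) (to_double n up z))"
  shows "(\<exists>u1 u2 u3. ((\<lambda>t. C (\<zeta>1 t)) \<longlongrightarrow> u1) (at_right 0) \<and> ((\<lambda>t. C (\<zeta>2 t)) \<longlongrightarrow> u2) (at_right 0)
        \<and> ((\<lambda>t. C (\<zeta>3 t)) \<longlongrightarrow> u3) (at_right 0) \<and> positive_triple u1 u2 u3) \<longleftrightarrow>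
    (\<exists>u1 u2 u3. ((\<lambda>t. sgn (\<zeta>1 t - z0)) \<longlongrightarrow> u1) (at_right 0) \<and> ((\<lambda>t. sgn (\<zeta>2 t - z0)) \<longlongrightarrow> u2) (at_right 0)
        \<and> ((\<lambda>t. sgn (\<zeta>3 t - z0)) \<longlongrightarrow> u3) (at_right 0) \<and> positive_triple u1 u2 u3)"
  using z0(2)
proof
  assume w: "(hess_map ^^ n) z0 = 1"
  obtain U where U: "finite U" "card U \<le> 2" and Uev: "eventually (\<lambda>z. C z \<in> U) (at z0 within dessin_set n)"
    using white_germs_double[OF z0(1) w] unfolding C_def by blast
  have inU: "u \<in> U" if "filterlim \<zeta> (at z0 within dessin_set n) (at_right 0)" "((\<lambda>t. C (\<zeta> t)) \<longlongrightarrow> u) (at_right 0)" for \<zeta> :: "real \<Rightarrow> complex" and u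
  proof -
    have "eventually (\<lambda>t. C (\<zeta> t) \<in> U) (at_right 0)" using eventually_compose_filterlim[OF Uev that(1)] .
    thus ?thesis by (rule finite_limit(1)[OF U(1) _ that(2)]) simp
  qed
  have card: "\<not> (a \<in> U \<and> b \<in> U \<and> c \<in> U \<and> a \<noteq> b \<and> a \<noteq> c \<and> b \<noteq> c)" for a b c
  proof
    assume a: "a \<in> U \<and> b \<in> U \<and> c \<in> U \<and> a \<noteq> b \<and> a \<noteq> c \<and> b \<noteq> c"
    hence "card {a, b, c} \<le> card U" by (intro card_mono U) auto
    thus False using U(2) a by simp
  qed
  obtain \<kappa> where \<kappa>: "\<forall>(G :: real filter) \<zeta> u. G \<noteq> bot \<longrightarrow> filterlim \<zeta> (at z0) G \<longrightarrow> eventually (\<lambda>x. \<zeta> x \<in> dessin_set n) G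
      \<longrightarrow> ((\<lambda>x. sgn (\<zeta> x - z0)) \<longlongrightarrow> u) G \<longrightarrow> u^2 = \<kappa>"
    using white_direction[OF z0(1) w] by blast
  have sq: "u^2 = \<kappa>" if "filterlim \<zeta> (at z0 within dessin_set n) (at_right 0)" "((\<lambda>t. sgn (\<zeta> t - z0)) \<longlongrightarrow> u) (at_right 0)" for \<zeta> :: "real \<Rightarrow> complex" and u
  proof -
    have "filterlim \<zeta> (at z0) (at_right 0)" "eventually (\<lambda>x. \<zeta> x \<in> dessin_set n) (at_right 0)"
      using that(1) by (auto simp: filterlim_at elim: eventually_mono)
    thus ?thesis using \<kappa>[rule_format, OF trivial_limit_at_right_real _ _ that(2)] by blast
  qed
  have three: "\<not> (a \<noteq> b \<and> a \<noteq> c \<and> b \<noteq> c)" if "a^2 = \<kappa>" "b^2 = \<kappa>" "c^2 = \<kappa>" for a b c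
    using that by (metis power2_eq_iff)
  show ?thesis using inU[OF z(1)] inU[OF z(2)] inU[OF z(3)] sq[OF z(1)] sq[OF z(2)] sq[OF z(3)] card three positive_triple_distinct
    by meson
next
  assume b: "(hess_map ^^ n) z0 = 0"
  obtain m where m: "n = Suc m" using n by (cases n) auto
  obtain u where u: "trivalent u" and uC: "eventually (\<lambda>z. C z = u (sgn (Im ((hess_map ^^ m) z)))) (at z0 within dessin_set n)"
    using black_germs_double[OF up z0(1)[unfolded m] b[unfolded m]] unfolding C_def m trivalent_def by blast
  obtain u' where u': "trivalent u'" and uD: "\<And>l (G :: real filter) \<zeta>. filterlim \<zeta> (at z0 within dessin_set n) G \<Longrightarrow>
     eventually (\<lambda>x. sgn (Im ((hess_map ^^ m) (\<zeta> x))) = l) G \<Longrightarrow> l \<in> {0, 1, -1} \<Longrightarrow> ((\<lambda>x. sgn (\<zeta> x - z0)) \<longlongrightarrow> u' l) G"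
    using black_germs_dessin[OF z0(1)[unfolded m] b[unfolded m]] unfolding m by blast
  have lab: "sgn (Im ((hess_map ^^ m) z)) \<in> {0, 1, -1}" for z by (simp add: sgn_if)
  note LL = label_limits[OF trivalent_inj[OF u] trivalent_inj[OF u'], of "\<lambda>z. sgn (Im ((hess_map ^^ m) z))", OF lab uC uD]
  have nb: "at_right (0::real) \<noteq> bot" by simp
  show ?thesis (is "?A \<longleftrightarrow> ?B")
  proof
    assume ?A
    then obtain u1 u2 u3 where h: "((\<lambda>t. C (\<zeta>1 t)) \<longlongrightarrow> u1) (at_right 0)" "((\<lambda>t. C (\<zeta>2 t)) \<longlongrightarrow> u2) (at_right 0)"
        "((\<lambda>t. C (\<zeta>3 t)) \<longlongrightarrow> u3) (at_right 0)" "positive_triple u1 u2 u3" by blast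
    obtain i where i: "i \<in> {0,1,-1}" "u1 = u i" "((\<lambda>t. sgn (\<zeta>1 t - z0)) \<longlongrightarrow> u' i) (at_right 0)" using LL(1)[OF _ _ _ z(1) nb h(1)] by blast
    obtain j where j: "j \<in> {0,1,-1}" "u2 = u j" "((\<lambda>t. sgn (\<zeta>2 t - z0)) \<longlongrightarrow> u' j) (at_right 0)" using LL(1)[OF _ _ _ z(2) nb h(2)] by blast
    obtain k where k: "k \<in> {0,1,-1}" "u3 = u k" "((\<lambda>t. sgn (\<zeta>3 t - z0)) \<longlongrightarrow> u' k) (at_right 0)" using LL(1)[OF _ _ _ z(3) nb h(3)] by blast
    have "positive_triple (u' i) (u' j) (u' k)"
      using h(4) unfolding i(2) j(2) k(2) trivalent_triple[OF u i(1) j(1) k(1)] trivalent_triple[OF u' i(1) j(1) k(1)] .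
    thus ?B using i j k by blast
  next
    assume ?B
    then obtain u1 u2 u3 where h: "((\<lambda>t. sgn (\<zeta>1 t - z0)) \<longlongrightarrow> u1) (at_right 0)" "((\<lambda>t. sgn (\<zeta>2 t - z0)) \<longlongrightarrow> u2) (at_right 0)"
        "((\<lambda>t. sgn (\<zeta>3 t - z0)) \<longlongrightarrow> u3) (at_right 0)" "positive_triple u1 u2 u3" by blast
    obtain i where i: "i \<in> {0,1,-1}" "u1 = u' i" "((\<lambda>t. C (\<zeta>1 t)) \<longlongrightarrow> u i) (at_right 0)" using LL(2)[OF _ _ _ z(1) nb h(1)] by blast
    obtain j where j: "j \<in> {0,1,-1}" "u2 = u' j" "((\<lambda>t. C (\<zeta>2 t)) \<longlongrightarrow> u j) (at_right 0)" using LL(2)[OF _ _ _ z(2) nb h(2)] by blast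
    obtain k where k: "k \<in> {0,1,-1}" "u3 = u' k" "((\<lambda>t. C (\<zeta>3 t)) \<longlongrightarrow> u k) (at_right 0)" using LL(2)[OF _ _ _ z(3) nb h(3)] by blast
    have "positive_triple (u i) (u j) (u k)"
      using h(4) unfolding i(2) j(2) k(2) trivalent_triple[OF u i(1) j(1) k(1)] trivalent_triple[OF u' i(1) j(1) k(1)] .
    thus ?A using i j k by blast
  qed
qed

lemma F_to_double:
  assumes "z \<in> dessin_set n"
  shows "(F ^^ n) (fst (to_double n up z)) = (1 - Re ((hess_map ^^ n) z)) *\<^sub>R p0 + Re ((hess_map ^^ n) z) *\<^sub>R p1"
    "Im ((hess_map ^^ n) z) = 0"
proof -
  obtain w s e where w: "length w = n" "0 \<le> e" "e \<le> 1" "z = ray n up w s e" using ray_exists[OF assms] by blast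
  have v: "(hess_map ^^ n) z = of_real e" using ray_value[OF w(1-3)] w(4) by simp
  have "fst (to_double n up z) = point (word_map w (edge_pt e))" using to_double_ray[OF w(1-3)] w(4) by (simp add: arc_pt_def double_proj_def)
  thus "(F ^^ n) (fst (to_double n up z)) = (1 - Re ((hess_map ^^ n) z)) *\<^sub>R p0 + Re ((hess_map ^^ n) z) *\<^sub>R p1"
    using F_word_map[OF edge_pt_simplex[OF w(2,3)], of w] w(1) v by (simp add: point_edge_pt)
  show "Im ((hess_map ^^ n) z) = 0" using v by simp
qed

lemma p0_ne_p1: "p0 \<noteq> p1" using noncollinear by auto

lemma to_double_colours:
  "double T {x \<in> Phi p0 p1 pinf F n. (F ^^ n) x = p0} = to_double n up ` {z \<in> dessin_set n. (hess_map ^^ n) z = 0}"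
  "double T {x \<in> Phi p0 p1 pinf F n. (F ^^ n) x = p1} = to_double n up ` {z \<in> dessin_set n. (hess_map ^^ n) z = 1}"
proof -
  have gen: "double T {x \<in> Phi p0 p1 pinf F n. P x} = to_double n up ` {z \<in> dessin_set n. P (fst (to_double n up z))}" for P
  proof -
    have "double T {x \<in> Phi p0 p1 pinf F n. P x} = {p \<in> double T (point ` Phi_bary n). P (fst p)}"
      unfolding Phi_eq by (auto simp: double_def double_proj_def)
    also have "\<dots> = to_double n up ` {z \<in> dessin_set n. P (fst (to_double n up z))}" unfolding to_double_image[of n up, symmetric] by blast
    finally show ?thesis .
  qed
  have "(F ^^ n) (fst (to_double n up z)) = p0 \<longleftrightarrow> (hess_map ^^ n) z = 0"
    "(F ^^ n) (fst (to_double n up z)) = p1 \<longleftrightarrow> (hess_map ^^ n) z = 1" if z: "z \<in> dessin_set n" for z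
  proof -
    define e where "e = Re ((hess_map ^^ n) z)"
    have v: "(hess_map ^^ n) z = of_real e" using F_to_double(2)[OF z] by (simp add: e_def complex_eq_iff)
    have "(1 - e) *\<^sub>R p0 + e *\<^sub>R p1 - p0 = e *\<^sub>R (p1 - p0)" "(1 - e) *\<^sub>R p0 + e *\<^sub>R p1 - p1 = (1 - e) *\<^sub>R (p0 - p1)"
      by (simp_all add: algebra_simps)
    hence "(1 - e) *\<^sub>R p0 + e *\<^sub>R p1 = p0 \<longleftrightarrow> e = 0" "(1 - e) *\<^sub>R p0 + e *\<^sub>R p1 = p1 \<longleftrightarrow> e = 1"
      using p0_ne_p1 by (metis scaleR_eq_0_iff right_minus_eq)+
    moreover have "complex_of_real e = 0 \<longleftrightarrow> e = 0" "complex_of_real e = 1 \<longleftrightarrow> e = 1" by auto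
    ultimately show "(F ^^ n) (fst (to_double n up z)) = p0 \<longleftrightarrow> (hess_map ^^ n) z = 0"
      "(F ^^ n) (fst (to_double n up z)) = p1 \<longleftrightarrow> (hess_map ^^ n) z = 1"
      unfolding F_to_double(1)[OF z] e_def[symmetric] v by simp_all
  qed
  thus "double T {x \<in> Phi p0 p1 pinf F n. (F ^^ n) x = p0} = to_double n up ` {z \<in> dessin_set n. (hess_map ^^ n) z = 0}"
    "double T {x \<in> Phi p0 p1 pinf F n. (F ^^ n) x = p1} = to_double n up ` {z \<in> dessin_set n. (hess_map ^^ n) z = 1}"
    unfolding gen by (auto intro!: image_cong)
qed

theorem Phi_tilde_homeomorphic_dessin:
  assumes H: "hessian_dynamical_system H" and n: "n \<ge> 1"
  shows "\<exists>g. decorated_homeomorphism (Phi_tilde pos p0 p1 pinf F n) (dessin (H ^^ n)) g"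
proof -
  \<comment> \<open>The oriented copy of the triangle with positively ordered vertices goes to the upper half-plane.\<close>
  define up where "up \<longleftrightarrow> (pos \<longleftrightarrow> area > 0)"
  define X where "X = subtopology (double_topology T) (double T (Phi p0 p1 pinf F n))"
  obtain h where h: "homeomorphic_maps (top_of_set (dessin_set n)) X (to_double n up) h"
    using to_double_homeomorphic[of n up] unfolding X_def[symmetric] homeomorphic_map_maps by blast
  have hk: "h (to_double n up z) = z" if "z \<in> dessin_set n" for z using h that by (simp add: homeomorphic_maps_def)
  have kh: "to_double n up (h p) = p" if "p \<in> topspace X" for p using h that by (simp add: homeomorphic_maps_def)
  have hcont: "continuous_map X (top_of_set (dessin_set n)) h" using h by (simp add: homeomorphic_maps_def)
  define g where "g = Some \<circ> h"
  have iter: "(H ^^ n) z = Some t \<and> seg01 t \<longleftrightarrow> (\<exists>x \<in> dessin_set n. z = Some x \<and> t = (hess_map ^^ n) x)" for z t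
    by (rule iterate_hessian_dynamical_system[OF H])
  have Dn: "{z. \<exists>t::real. 0 \<le> t \<and> t \<le> 1 \<and> (H ^^ n) z = Some (complex_of_real t)} = Some ` dessin_set n" (is "?L = _")
  proof
    show "?L \<subseteq> Some ` dessin_set n"
    proof
      fix z assume "z \<in> ?L"
      then obtain t :: real where "0 \<le> t" "t \<le> 1" "(H ^^ n) z = Some (complex_of_real t)" by blast
      hence "(H ^^ n) z = Some (complex_of_real t) \<and> seg01 (complex_of_real t)" by (simp add: seg01_def)
      thus "z \<in> Some ` dessin_set n" unfolding iter by blast
    qed
    show "Some ` dessin_set n \<subseteq> ?L"
    proof
      fix z assume "z \<in> Some ` dessin_set n"
      then obtain x where "x \<in> dessin_set n" "z = Some x" by blast
      hence "(H ^^ n) z = Some ((hess_map ^^ n) x) \<and> seg01 ((hess_map ^^ n) x)" unfolding iter by blast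
      moreover from this have "(hess_map ^^ n) x = complex_of_real (Re ((hess_map ^^ n) x))"
        by (simp add: seg01_def complex_eq_iff)
      ultimately have "(H ^^ n) z = Some (complex_of_real (Re ((hess_map ^^ n) x)))"
        "0 \<le> Re ((hess_map ^^ n) x)" "Re ((hess_map ^^ n) x) \<le> 1" by (simp_all add: seg01_def)
      thus "z \<in> ?L" by blast
    qed
  qed
  have col: "{z. (H ^^ n) z = Some c} = Some ` {z \<in> dessin_set n. (hess_map ^^ n) z = c}" if "seg01 c" for c
    using iter[of _ c] that by blast
  have on: "seg01 0" "seg01 1" by (simp_all add: seg01_def)
  define G where "G = Phi_tilde pos p0 p1 pinf F n"
  have G: "gspace G = X" "black G = to_double n up ` {z \<in> dessin_set n. (hess_map ^^ n) z = 0}"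
      "white G = to_double n up ` {z \<in> dessin_set n. (hess_map ^^ n) z = 1}" "coord G = chart pos"
    by (simp_all add: G_def Phi_tilde_def Let_def X_def to_double_colours[where up = up] chart_def[abs_def] fun_eq_iff)
  define G' where "G' = dessin (H ^^ n)"
  have G': "gspace G' = subtopology P1 (Some ` dessin_set n)" "black G' = Some ` {z \<in> dessin_set n. (hess_map ^^ n) z = 0}"
      "white G' = Some ` {z \<in> dessin_set n. (hess_map ^^ n) z = 1}" "coord G' = P1_coord"
    by (simp_all add: G'_def dessin_def Dn col[OF on(1)] col[OF on(2)])
  have "homeomorphic_map (gspace G) (gspace G') g"
    unfolding G(1) G'(1) g_def
  proof (rule homeomorphic_map_compose[OF _ homeomorphic_map_Some])
    have "homeomorphic_maps X (top_of_set (dessin_set n)) h (to_double n up)" by (rule homeomorphic_maps_sym[THEN iffD1, OF h])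
    thus "homeomorphic_map X (top_of_set (dessin_set n)) h" unfolding homeomorphic_map_maps by blast
  qed
  moreover have gk: "g ` to_double n up ` A = Some ` A" if "A \<subseteq> dessin_set n" for A
  proof -
    have "g ` to_double n up ` A = (\<lambda>z. Some (h (to_double n up z))) ` A" by (simp add: g_def image_image)
    also have "\<dots> = Some ` A" using hk that by (intro image_cong) auto
    finally show ?thesis .
  qed
  have "g ` black G = black G'" "g ` white G = white G'" unfolding G G' by (rule gk; blast)+
  moreover have "\<forall>v \<in> black G \<union> white G. \<forall>\<gamma>1 \<gamma>2 \<gamma>3.
      edge_arc G v \<gamma>1 \<and> edge_arc G v \<gamma>2 \<and> edge_arc G v \<gamma>3 \<longrightarrow>
      (cyclic_order G v \<gamma>1 \<gamma>2 \<gamma>3 \<longleftrightarrow> cyclic_order G' (g v) (g \<circ> \<gamma>1) (g \<circ> \<gamma>2) (g \<circ> \<gamma>3))"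
  proof (intro ballI allI impI)
    fix v \<gamma>1 \<gamma>2 \<gamma>3 assume v: "v \<in> black G \<union> white G" and arcs: "edge_arc G v \<gamma>1 \<and> edge_arc G v \<gamma>2 \<and> edge_arc G v \<gamma>3"
    obtain z0 where z0: "z0 \<in> dessin_set n" "(hess_map ^^ n) z0 = 0 \<or> (hess_map ^^ n) z0 = 1" "v = to_double n up z0"
      using v unfolding G by blast
    have gv: "g v = Some z0" using z0 hk by (simp add: g_def)
    have arc: "filterlim (\<lambda>t. h (\<gamma> t)) (at z0 within dessin_set n) (at_right 0)"
      "\<And>u. initial_direction G v \<gamma> u \<longleftrightarrow> ((\<lambda>t. sgn (chart pos (to_double n up z0) (to_double n up (h (\<gamma> t))))) \<longlongrightarrow> u) (at_right 0)"
      "\<And>u. initial_direction G' (g v) (g \<circ> \<gamma>) u \<longleftrightarrow> ((\<lambda>t. sgn (h (\<gamma> t) - z0)) \<longlongrightarrow> u) (at_right 0)"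
      if a: "edge_arc G v \<gamma>" for \<gamma>
    proof -
      have p: "pathin X \<gamma>" "inj_on \<gamma> {0..1}" "\<gamma> 0 = v" using a by (simp_all add: edge_arc_def G)
      have top: "\<gamma> t \<in> topspace X" if "t \<in> {0..1}" for t
        using p(1) that unfolding pathin_def by (auto simp: continuous_map_def Pi_iff)
      have c: "continuous_map (top_of_set {0..1}) (top_of_set (dessin_set n)) (h \<circ> \<gamma>)"
        using continuous_map_compose[OF p(1)[unfolded pathin_def] hcont] .
      hence cont: "continuous_on {0..1} (\<lambda>t. h (\<gamma> t))" and mem: "\<And>t. t \<in> {0..1} \<Longrightarrow> h (\<gamma> t) \<in> dessin_set n"
        by (auto simp: continuous_map_in_subtopology o_def)
      have h0: "h (\<gamma> 0) = z0" using p(3) z0 hk by simp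
      have "((\<lambda>t. h (\<gamma> t)) \<longlongrightarrow> z0) (at_right 0)"
        using cont[unfolded continuous_on_def, rule_format, of 0] h0 at_within_Icc_at_right[of 0 "1::real"] by simp
      moreover have ev: "eventually (\<lambda>t. t \<in> {0<..<1}) (at_right (0::real))" by (rule eventually_at_right_real) simp
      have "eventually (\<lambda>t. h (\<gamma> t) \<in> dessin_set n \<and> h (\<gamma> t) \<noteq> z0) (at_right 0)"
        using ev
      proof eventually_elim
        case (elim t)
        have "h (\<gamma> t) \<noteq> z0"
        proof
          assume "h (\<gamma> t) = z0"
          hence "\<gamma> t = \<gamma> 0" using kh[OF top[of t]] p(3) z0(3) elim by simp
          hence "t = 0" using inj_onD[OF p(2), of t 0] elim by simp
          thus False using elim by simp
        qed
        thus ?case using mem elim by simp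
      qed
      ultimately show "filterlim (\<lambda>t. h (\<gamma> t)) (at z0 within dessin_set n) (at_right 0)" by (simp add: filterlim_at)
      have "eventually (\<lambda>t. sgn (chart pos v (\<gamma> t)) = sgn (chart pos (to_double n up z0) (to_double n up (h (\<gamma> t))))) (at_right 0)"
        using ev by eventually_elim (use kh top z0(3) in simp)
      thus "initial_direction G v \<gamma> u \<longleftrightarrow> ((\<lambda>t. sgn (chart pos (to_double n up z0) (to_double n up (h (\<gamma> t))))) \<longlongrightarrow> u) (at_right 0)" for u
        unfolding initial_direction_def G by (rule tendsto_cong)
      show "initial_direction G' (g v) (g \<circ> \<gamma>) u \<longleftrightarrow> ((\<lambda>t. sgn (h (\<gamma> t) - z0)) \<longlongrightarrow> u) (at_right 0)" for u
        unfolding initial_direction_def G' gv by (simp add: g_def)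
    qed
    have a: "edge_arc G v \<gamma>1" "edge_arc G v \<gamma>2" "edge_arc G v \<gamma>3" using arcs by auto
    show "cyclic_order G v \<gamma>1 \<gamma>2 \<gamma>3 \<longleftrightarrow> cyclic_order G' (g v) (g \<circ> \<gamma>1) (g \<circ> \<gamma>2) (g \<circ> \<gamma>3)"
      unfolding cyclic_order_def arc(2)[OF a(1)] arc(2)[OF a(2)] arc(2)[OF a(3)] arc(3)[OF a(1)] arc(3)[OF a(2)] arc(3)[OF a(3)]
      by (rule cyclic_order_transfer[OF up_def n z0(1,2) arc(1)[OF a(1)] arc(1)[OF a(2)] arc(1)[OF a(3)]])
  qed
  ultimately show ?thesis unfolding decorated_homeomorphism_def G_def[symmetric] G'_def[symmetric] by blast
qed

end

theorem proposition5p1: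
  fixes H :: "complex option \<Rightarrow> complex option"
    and p0 p1 pinf :: complex
    and H_PL :: "complex \<Rightarrow> complex"
    and pos :: bool
    and n :: nat
  assumes H: "hessian_dynamical_system H"
    and T: "\<not> collinear {p0, p1, pinf}"
    and H_PL: "is_H_PL p0 p1 pinf H_PL"
    and n: "n \<ge> 1"
  shows "\<exists>g. decorated_homeomorphism (Phi_tilde pos p0 p1 pinf H_PL n) (dessin (H ^^ n)) g"
proof -
  interpret pl_model p0 p1 pinf H_PL by unfold_locales (rule T, rule H_PL)
  show ?thesis by (rule Phi_tilde_homeomorphic_dessin[OF H n])
qed

end
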